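(* Let $\psi\colon S\to M$ be a codimension-two spacelike submanifold in a spacetime $(M,g)$ of dimension $n+2\geq 4$. Assume $\psi$ is free of umbilical points. If $\psi$ is shear-isotropic, then there exist a globally defined lightlike normal vector field $\xi\in\mathfrak X^\perp(S)$ and a smooth function $\rho\in C^\infty(S)$ such that $A_\xi=\rho I$. Furthermore, any other umbilical normal vector field on $S$ is proportional to $\xi$ at each point of $S$.
   Context: A spacetime $(M,g)$ is a connected time-oriented Lorentzian manifold of signature $(-,+,\dots,+)$. A vector $v$ is lightlike if $g(v,v)=0$ and $v\ne0$. A codimension-two spacelike submanifold $\psi\colon S\to M$ is an immersion of a connected $n$-manifold $S$ whose induced metric (also denoted $g$) is Riemannian. $\mathrm{II}$ is the second fundamental form (normal part of $\widetilde\nabla_XY$), $A_\zeta$ is the shape operator of a normal field $\zeta$, with $g(A_\zeta X,Y)=g(\mathrm{II}(X,Y),\zeta)$, and $\mathbf H=\frac1n\operatorname{trace}_g\mathrm{II}$ is the mean curvature vector. A normal field $\zeta$ is umbilical if $A_\zeta=\rho I$ for some function $\rho$. A point $p\in S$ is umbilical if there is $\zeta\in T_p^\perp S$ with $\mathrm{II}(X,Y)=g(X,Y)\zeta$ for all $X,Y\in T_pS$. The total shear tensor is $\mathring{\mathrm{II}}(X,Y)=\mathrm{II}(X,Y)-g(X,Y)\mathbf H$. The submanifold $\psi$ is shear-isotropic if at every $p\in S$ the number $g(\mathring{\mathrm{II}}(X,X),\mathring{\mathrm{II}}(X,X))$ does not depend on the choice of the unit vector $X\in T_pS$. *)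

theory Defs
  imports "HOL-Analysis.Analysis"
begin

section \<open>Smooth maps between Euclidean spaces\<close>

text \<open>Meant for open sets S only. In finite dimensions, C^k amounts to iterated
  differentiability of all directional derivatives, with continuous ones at order k.\<close>

primrec Ck_on :: "nat \<Rightarrow> 'a::euclidean_space set \<Rightarrow> ('a \<Rightarrow> 'b::real_normed_vector) \<Rightarrow> bool" where
  "Ck_on 0 S f \<longleftrightarrow> continuous_on S f"
| "Ck_on (Suc k) S f \<longleftrightarrow>
     (\<forall>x\<in>S. f differentiable (at x)) \<and> (\<forall>v. Ck_on k S (\<lambda>x. frechet_derivative f (at x) v))"

definition smooth_on :: "'a::euclidean_space set \<Rightarrow> ('a \<Rightarrow> 'b::real_normed_vector) \<Rightarrow> bool" where
  "smooth_on S f \<longleftrightarrow> (\<forall>k. Ck_on k S f)"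


section \<open>Smooth manifolds\<close>

text \<open>The underlying set of a manifold is a whole type, Hausdorff and second countable by its type
  classes; the manifold is given by a (not necessarily maximal) smooth atlas. A chart is a pair of
  its domain and its coordinate map, the latter being relevant only on the domain.\<close>

type_synonym ('a, 'e) chart = "'a set \<times> ('a \<Rightarrow> 'e)"

definition chart_inv :: "('a, 'e) chart \<Rightarrow> 'e \<Rightarrow> 'a" where
  "chart_inv c = inv_into (fst c) (snd c)"

definition is_chart :: "('a::topological_space, 'e::euclidean_space) chart \<Rightarrow> bool" where
  "is_chart c \<longleftrightarrow> open (fst c) \<and> open (snd c ` fst c) \<and>
     homeomorphism (fst c) (snd c ` fst c) (snd c) (chart_inv c)"

definition smooth_manifold ::
  "('a::{t2_space,second_countable_topology}, 'e::euclidean_space) chart set \<Rightarrow> bool" where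
  "smooth_manifold A \<longleftrightarrow> (\<forall>c\<in>A. is_chart c) \<and> (\<Union>c\<in>A. fst c) = UNIV \<and>
     (\<forall>c\<in>A. \<forall>c'\<in>A. smooth_on (snd c ` (fst c \<inter> fst c')) (snd c' \<circ> chart_inv c))"

text \<open>Every point p gets a preferred chart, and the tangent space at p is represented by the model
  space 'e: a tangent vector is identified with its components in the preferred chart at p. The
  functions in_chart and from_chart pass to and from the components in an arbitrary chart around p.\<close>

definition chart_at :: "('a, 'e) chart set \<Rightarrow> 'a \<Rightarrow> ('a, 'e) chart" where
  "chart_at A p = (SOME c. c \<in> A \<and> p \<in> fst c)"

definition coord_change ::
  "('a, 'e::euclidean_space) chart \<Rightarrow> ('a, 'e) chart \<Rightarrow> 'a \<Rightarrow> 'e \<Rightarrow> 'e" where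
  "coord_change c c' p = frechet_derivative (snd c' \<circ> chart_inv c) (at (snd c p))"

definition in_chart ::
  "('a, 'e::euclidean_space) chart set \<Rightarrow> ('a, 'e) chart \<Rightarrow> 'a \<Rightarrow> 'e \<Rightarrow> 'e" where
  "in_chart A c p v = coord_change (chart_at A p) c p v"

definition from_chart ::
  "('a, 'e::euclidean_space) chart set \<Rightarrow> ('a, 'e) chart \<Rightarrow> 'a \<Rightarrow> 'e \<Rightarrow> 'e" where
  "from_chart A c p w = coord_change c (chart_at A p) p w"

definition smooth_function :: "('a, 'e::euclidean_space) chart set \<Rightarrow> ('a \<Rightarrow> real) \<Rightarrow> bool" where
  "smooth_function A f \<longleftrightarrow> (\<forall>c\<in>A. smooth_on (snd c ` fst c) (f \<circ> chart_inv c))"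

definition smooth_map ::
  "('a::topological_space, 'e::euclidean_space) chart set \<Rightarrow>
   ('b::topological_space, 'f::euclidean_space) chart set \<Rightarrow> ('a \<Rightarrow> 'b) \<Rightarrow> bool" where
  "smooth_map A B \<psi> \<longleftrightarrow> continuous_on UNIV \<psi> \<and>
     (\<forall>c\<in>A. \<forall>d\<in>B. smooth_on (snd c ` (fst c \<inter> \<psi> -` fst d)) (snd d \<circ> \<psi> \<circ> chart_inv c))"

definition differential ::
  "('a, 'e::euclidean_space) chart set \<Rightarrow> ('b, 'f::euclidean_space) chart set \<Rightarrow>
   ('a \<Rightarrow> 'b) \<Rightarrow> 'a \<Rightarrow> 'e \<Rightarrow> 'f" where
  "differential A B \<psi> p =
     frechet_derivative (snd (chart_at B (\<psi> p)) \<circ> \<psi> \<circ> chart_inv (chart_at A p))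
       (at (snd (chart_at A p) p))"

text \<open>V is a vector field along \<psi>, V p being a tangent vector at \<psi> p, that is smooth on the open
  set W. Vector fields on a manifold are the fields along its identity map.\<close>

definition smooth_field_along ::
  "('a, 'e::euclidean_space) chart set \<Rightarrow> ('b, 'f::euclidean_space) chart set \<Rightarrow>
   ('a \<Rightarrow> 'b) \<Rightarrow> 'a set \<Rightarrow> ('a \<Rightarrow> 'f) \<Rightarrow> bool" where
  "smooth_field_along A B \<psi> W V \<longleftrightarrow>
     (\<forall>c\<in>A. \<forall>d\<in>B. smooth_on (snd c ` (fst c \<inter> W \<inter> \<psi> -` fst d))
        (\<lambda>y. in_chart B d (\<psi> (chart_inv c y)) (V (chart_inv c y))))"

definition smooth_vector_field ::
  "('a, 'e::euclidean_space) chart set \<Rightarrow> 'a set \<Rightarrow> ('a \<Rightarrow> 'e) \<Rightarrow> bool" where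
  "smooth_vector_field A W X \<longleftrightarrow> smooth_field_along A A id W X"


section \<open>Spacetimes\<close>

definition metric_in_chart ::
  "('b, 'f::euclidean_space) chart set \<Rightarrow> ('b \<Rightarrow> 'f \<Rightarrow> 'f \<Rightarrow> real) \<Rightarrow>
   ('b, 'f) chart \<Rightarrow> 'f \<Rightarrow> 'f \<Rightarrow> 'f \<Rightarrow> real" where
  "metric_in_chart B g d y u v =
     g (chart_inv d y) (from_chart B d (chart_inv d y) u) (from_chart B d (chart_inv d y) v)"

definition lorentzian_metric ::
  "('b, 'f::euclidean_space) chart set \<Rightarrow> ('b \<Rightarrow> 'f \<Rightarrow> 'f \<Rightarrow> real) \<Rightarrow> bool" where
  "lorentzian_metric B g \<longleftrightarrow>
     (\<forall>q. bilinear (g q) \<and> (\<forall>u v. g q u v = g q v u) \<and>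
        (\<exists>e :: 'f \<Rightarrow> 'f. \<exists>i0\<in>Basis. \<forall>i\<in>Basis. \<forall>j\<in>Basis.
           g q (e i) (e j) = (if i \<noteq> j then 0 else if i = i0 then -1 else 1))) \<and>
     (\<forall>d\<in>B. \<forall>u v. smooth_on (snd d ` fst d) (\<lambda>y. metric_in_chart B g d y u v))"

text \<open>The time orientation is given by a global timelike vector field T.\<close>

definition spacetime ::
  "('b::{t2_space,second_countable_topology}, 'f::euclidean_space) chart set \<Rightarrow>
   ('b \<Rightarrow> 'f \<Rightarrow> 'f \<Rightarrow> real) \<Rightarrow> ('b \<Rightarrow> 'f) \<Rightarrow> bool" where
  "spacetime B g T \<longleftrightarrow> smooth_manifold B \<and> connected (UNIV :: 'b set) \<and>
     lorentzian_metric B g \<and> smooth_vector_field B UNIV T \<and> (\<forall>q. g q (T q) (T q) < 0)"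

definition lightlike :: "('f::real_vector \<Rightarrow> 'f \<Rightarrow> real) \<Rightarrow> 'f \<Rightarrow> bool" where
  "lightlike h v \<longleftrightarrow> h v v = 0 \<and> v \<noteq> 0"

text \<open>Levi-Civita connection in the chart d: christoffel B g d y u w is the vector
  with k-th component \<Gamma>^k_ij u^i w^j, determined by the Koszul formula for constant
  coordinate fields.\<close>

definition christoffel ::
  "('b, 'f::euclidean_space) chart set \<Rightarrow> ('b \<Rightarrow> 'f \<Rightarrow> 'f \<Rightarrow> real) \<Rightarrow>
   ('b, 'f) chart \<Rightarrow> 'f \<Rightarrow> 'f \<Rightarrow> 'f \<Rightarrow> 'f" where
  "christoffel B g d y u w = (THE z. \<forall>v. metric_in_chart B g d y z v =
     (frechet_derivative (\<lambda>y'. metric_in_chart B g d y' w v) (at y) u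
      + frechet_derivative (\<lambda>y'. metric_in_chart B g d y' u v) (at y) w
      - frechet_derivative (\<lambda>y'. metric_in_chart B g d y' u w) (at y) v) / 2)"

text \<open>Covariant derivative at p, in the direction x, of a field V along \<psi>, induced by the
  Levi-Civita connection of g. It is computed in the preferred charts at p and \<psi> p, so that
  the result is again a tangent vector at \<psi> p in the above representation.\<close>

definition covariant_derivative ::
  "('a, 'e::euclidean_space) chart set \<Rightarrow> ('b, 'f::euclidean_space) chart set \<Rightarrow>
   ('b \<Rightarrow> 'f \<Rightarrow> 'f \<Rightarrow> real) \<Rightarrow> ('a \<Rightarrow> 'b) \<Rightarrow> 'a \<Rightarrow> 'e \<Rightarrow> ('a \<Rightarrow> 'f) \<Rightarrow> 'f" where
  "covariant_derivative A B g \<psi> p x V =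
     (let c = chart_at A p; d = chart_at B (\<psi> p) in
      frechet_derivative (\<lambda>y. in_chart B d (\<psi> (chart_inv c y)) (V (chart_inv c y))) (at (snd c p)) x
      + christoffel B g d (snd d (\<psi> p)) (differential A B \<psi> p x) (V p))"


section \<open>Spacelike submanifolds\<close>

definition induced_metric ::
  "('a, 'e::euclidean_space) chart set \<Rightarrow> ('b, 'f::euclidean_space) chart set \<Rightarrow>
   ('b \<Rightarrow> 'f \<Rightarrow> 'f \<Rightarrow> real) \<Rightarrow> ('a \<Rightarrow> 'b) \<Rightarrow> 'a \<Rightarrow> 'e \<Rightarrow> 'e \<Rightarrow> real" where
  "induced_metric A B g \<psi> p x y = g (\<psi> p) (differential A B \<psi> p x) (differential A B \<psi> p y)"

definition spacelike_submanifold ::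
  "('a::{t2_space,second_countable_topology}, 'e::euclidean_space) chart set \<Rightarrow>
   ('b::{t2_space,second_countable_topology}, 'f::euclidean_space) chart set \<Rightarrow>
   ('b \<Rightarrow> 'f \<Rightarrow> 'f \<Rightarrow> real) \<Rightarrow> ('a \<Rightarrow> 'b) \<Rightarrow> bool" where
  "spacelike_submanifold A B g \<psi> \<longleftrightarrow> smooth_manifold A \<and> connected (UNIV :: 'a set) \<and>
     smooth_map A B \<psi> \<and> (\<forall>p. inj (differential A B \<psi> p)) \<and>
     (\<forall>p x. x \<noteq> 0 \<longrightarrow> induced_metric A B g \<psi> p x x > 0)"

definition normal_space ::
  "('a, 'e::euclidean_space) chart set \<Rightarrow> ('b, 'f::euclidean_space) chart set \<Rightarrow>
   ('b \<Rightarrow> 'f \<Rightarrow> 'f \<Rightarrow> real) \<Rightarrow> ('a \<Rightarrow> 'b) \<Rightarrow> 'a \<Rightarrow> 'f set" where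
  "normal_space A B g \<psi> p = {v. \<forall>x. g (\<psi> p) v (differential A B \<psi> p x) = 0}"

definition normal_part ::
  "('a, 'e::euclidean_space) chart set \<Rightarrow> ('b, 'f::euclidean_space) chart set \<Rightarrow>
   ('b \<Rightarrow> 'f \<Rightarrow> 'f \<Rightarrow> real) \<Rightarrow> ('a \<Rightarrow> 'b) \<Rightarrow> 'a \<Rightarrow> 'f \<Rightarrow> 'f" where
  "normal_part A B g \<psi> p v =
     (THE w. w \<in> normal_space A B g \<psi> p \<and> v - w \<in> range (differential A B \<psi> p))"

definition smooth_normal_field ::
  "('a, 'e::euclidean_space) chart set \<Rightarrow> ('b, 'f::euclidean_space) chart set \<Rightarrow>
   ('b \<Rightarrow> 'f \<Rightarrow> 'f \<Rightarrow> real) \<Rightarrow> ('a \<Rightarrow> 'b) \<Rightarrow> ('a \<Rightarrow> 'f) \<Rightarrow> bool" where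
  "smooth_normal_field A B g \<psi> \<zeta> \<longleftrightarrow>
     smooth_field_along A B \<psi> UNIV \<zeta> \<and> (\<forall>p. \<zeta> p \<in> normal_space A B g \<psi> p)"

text \<open>The second fundamental form is tensorial: its value on x and y is the normal part of
  the covariant derivative in the direction x of (the image under the differential of) any local
  smooth vector field on the submanifold that extends y.\<close>

definition second_fundamental_form ::
  "('a::topological_space, 'e::euclidean_space) chart set \<Rightarrow> ('b, 'f::euclidean_space) chart set \<Rightarrow>
   ('b \<Rightarrow> 'f \<Rightarrow> 'f \<Rightarrow> real) \<Rightarrow> ('a \<Rightarrow> 'b) \<Rightarrow> 'a \<Rightarrow> 'e \<Rightarrow> 'e \<Rightarrow> 'f" where
  "second_fundamental_form A B g \<psi> p x y =
     (THE z. \<forall>W Y. open W \<and> p \<in> W \<and> smooth_vector_field A W Y \<and> Y p = y \<longrightarrow>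
        z = normal_part A B g \<psi> p
              (covariant_derivative A B g \<psi> p x (\<lambda>q. differential A B \<psi> q (Y q))))"

text \<open>Trace of a bilinear map with respect to an inner product h: the common value for all
  h-orthonormal bases, which are indexed here by the standard basis of the model space.\<close>

definition metric_trace ::
  "('e::euclidean_space \<Rightarrow> 'e \<Rightarrow> real) \<Rightarrow> ('e \<Rightarrow> 'e \<Rightarrow> 'f::real_vector) \<Rightarrow> 'f" where
  "metric_trace h b = (THE t. \<forall>e :: 'e \<Rightarrow> 'e.
     (\<forall>i\<in>Basis. \<forall>j\<in>Basis. h (e i) (e j) = (if i = j then 1 else 0)) \<longrightarrow>
     t = (\<Sum>i\<in>Basis. b (e i) (e i)))"

definition mean_curvature ::
  "('a::topological_space, 'e::euclidean_space) chart set \<Rightarrow> ('b, 'f::euclidean_space) chart set \<Rightarrow>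
   ('b \<Rightarrow> 'f \<Rightarrow> 'f \<Rightarrow> real) \<Rightarrow> ('a \<Rightarrow> 'b) \<Rightarrow> 'a \<Rightarrow> 'f" where
  "mean_curvature A B g \<psi> p =
     (1 / real DIM('e)) *\<^sub>R
       metric_trace (induced_metric A B g \<psi> p) (second_fundamental_form A B g \<psi> p)"

definition total_shear ::
  "('a::topological_space, 'e::euclidean_space) chart set \<Rightarrow> ('b, 'f::euclidean_space) chart set \<Rightarrow>
   ('b \<Rightarrow> 'f \<Rightarrow> 'f \<Rightarrow> real) \<Rightarrow> ('a \<Rightarrow> 'b) \<Rightarrow> 'a \<Rightarrow> 'e \<Rightarrow> 'e \<Rightarrow> 'f" where
  "total_shear A B g \<psi> p x y =
     second_fundamental_form A B g \<psi> p x y - induced_metric A B g \<psi> p x y *\<^sub>R mean_curvature A B g \<psi> p"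

text \<open>Shape operator at p with respect to the normal vector z at p.\<close>

definition shape_operator ::
  "('a::topological_space, 'e::euclidean_space) chart set \<Rightarrow> ('b, 'f::euclidean_space) chart set \<Rightarrow>
   ('b \<Rightarrow> 'f \<Rightarrow> 'f \<Rightarrow> real) \<Rightarrow> ('a \<Rightarrow> 'b) \<Rightarrow> 'a \<Rightarrow> 'f \<Rightarrow> 'e \<Rightarrow> 'e" where
  "shape_operator A B g \<psi> p z x = (THE a. \<forall>y.
     induced_metric A B g \<psi> p a y = g (\<psi> p) (second_fundamental_form A B g \<psi> p x y) z)"

definition umbilical_field ::
  "('a::topological_space, 'e::euclidean_space) chart set \<Rightarrow> ('b, 'f::euclidean_space) chart set \<Rightarrow>
   ('b \<Rightarrow> 'f \<Rightarrow> 'f \<Rightarrow> real) \<Rightarrow> ('a \<Rightarrow> 'b) \<Rightarrow> ('a \<Rightarrow> 'f) \<Rightarrow> bool" where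
  "umbilical_field A B g \<psi> \<zeta> \<longleftrightarrow> smooth_normal_field A B g \<psi> \<zeta> \<and>
     (\<exists>\<rho>. \<forall>p. shape_operator A B g \<psi> p (\<zeta> p) = (\<lambda>x. \<rho> p *\<^sub>R x))"

definition umbilical_point ::
  "('a::topological_space, 'e::euclidean_space) chart set \<Rightarrow> ('b, 'f::euclidean_space) chart set \<Rightarrow>
   ('b \<Rightarrow> 'f \<Rightarrow> 'f \<Rightarrow> real) \<Rightarrow> ('a \<Rightarrow> 'b) \<Rightarrow> 'a \<Rightarrow> bool" where
  "umbilical_point A B g \<psi> p \<longleftrightarrow> (\<exists>\<zeta>\<in>normal_space A B g \<psi> p. \<forall>x y.
     second_fundamental_form A B g \<psi> p x y = induced_metric A B g \<psi> p x y *\<^sub>R \<zeta>)"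

definition shear_isotropic ::
  "('a::topological_space, 'e::euclidean_space) chart set \<Rightarrow> ('b, 'f::euclidean_space) chart set \<Rightarrow>
   ('b \<Rightarrow> 'f \<Rightarrow> 'f \<Rightarrow> real) \<Rightarrow> ('a \<Rightarrow> 'b) \<Rightarrow> bool" where
  "shear_isotropic A B g \<psi> \<longleftrightarrow> (\<forall>p x y.
     induced_metric A B g \<psi> p x x = 1 \<and> induced_metric A B g \<psi> p y y = 1 \<longrightarrow>
     g (\<psi> p) (total_shear A B g \<psi> p x x) (total_shear A B g \<psi> p x x) =
     g (\<psi> p) (total_shear A B g \<psi> p y y) (total_shear A B g \<psi> p y y))"

end

theory Submission
  imports Defs
begin

text \<open>At a point, the normal space is a Lorentzian plane with null directions l and m. Writing the
  total shear as \<alpha> l + \<beta> m with trace-free symmetric forms \<alpha> and \<beta>, shear-isotropy says that the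
  product of the quadratic forms \<alpha>(x,x) and \<beta>(x,x) is c h(x,x)^2, where h is the induced metric. A
  trace-free form has a nonzero null vector, so c = 0, and a product of two quadratic forms vanishes
  only if one of them does. Hence the total shear takes values in one null line. It does not vanish,
  as the point is not umbilical, so the vectors of this line are exactly the umbilical normal vectors.

  The field \<xi> spans this line and is normalized by g(T,\<xi>) = -1 with the time orientation T. It is
  smooth because near each point w = h(y,y) II(x,x) - h(x,x) II(y,y) is nonzero for suitable
  coordinate fields x and y, and then \<xi> = - w / g(T,w). Since tangent vectors at a point are represented in
  the preferred chart of that point, which varies without any continuity, the smoothness of w
  requires the expression of II in a fixed pair of charts, that is, the transformation law of
  the Christoffel symbols.\<close>

subsection \<open>Calculus of C^k maps\<close>

text \<open>The normalization against \<open>T\<close> does the global work. A timelike vector is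
  never orthogonal to a lightlike one, so every null line contains exactly one vector whose product
  with \<open>T\<close> is -1. Hence \<xi> is unique pointwise, and local formulas for it agree on
  overlaps whatever coordinate fields they start from. The vector w replaces the shear itself
  because the mean curvature cancels in it: only h and II remain, both with smooth expressions in
  charts, and the trace stays confined to the algebra at one point. Christoffel symbols and
  tangential components are given only as solutions of linear equations. Their smoothness comes from
  \<open>Ck_on_nondegenerate_solution\<close>, which works with the equations rather than with a
  formula for the inverse. Under a change of charts, the second derivative of the target transition
  map cancels against the inhomogeneous Christoffel term. What survives is the image of the second
  derivative of the source transition map; it is tangent and disappears in the normal part.\<close>

lemma frechet_derivative_eqI:
  "(f has_derivative f') (at x) \<Longrightarrow> frechet_derivative f (at x) = f'"
  using frechet_derivative_at by metis

lemma Ck_on_Suc_has_derivative: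
  "Ck_on (Suc k) S f \<Longrightarrow> x \<in> S \<Longrightarrow> (f has_derivative frechet_derivative f (at x)) (at x)"
  by (simp add: frechet_derivative_works[symmetric])

lemma Ck_on_cong:
  fixes f g :: "'a::euclidean_space \<Rightarrow> 'b::real_normed_vector"
  assumes "open S" "\<And>x. x \<in> S \<Longrightarrow> f x = g x"
  shows "Ck_on k S f \<longleftrightarrow> Ck_on k S g"
proof -
  have *: "Ck_on k S f \<Longrightarrow> Ck_on k S g"
    if "\<And>x. x \<in> S \<Longrightarrow> f x = g x" for f g :: "'a \<Rightarrow> 'b"
    using that
  proof (induction k arbitrary: f g)
    case 0
    then show ?case using continuous_on_cong[of S S f g] by simp
  next
    case (Suc k)
    have diff: "g differentiable at x" if "x \<in> S" for x
    proof -
      obtain f' where "(f has_derivative f') (at x)"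
        using Suc.prems(1) \<open>x \<in> S\<close> by (auto simp: differentiable_def)
      then have "(g has_derivative f') (at x)"
        by (rule has_derivative_transform_within_open[OF _ \<open>open S\<close> \<open>x \<in> S\<close>]) (use Suc.prems in auto)
      then show ?thesis by (auto simp: differentiable_def)
    qed
    have eq: "frechet_derivative f (at x) v = frechet_derivative g (at x) v" if "x \<in> S" for x v
    proof -
      have "f differentiable at x" using Suc.prems(1) \<open>x \<in> S\<close> by simp
      from frechet_derivative_transform_within_open[OF this \<open>open S\<close> \<open>x \<in> S\<close>, of g]
      show ?thesis using Suc.prems by metis
    qed
    show ?case
      using Suc.IH[of "\<lambda>x. frechet_derivative f (at x) v" "\<lambda>x. frechet_derivative g (at x) v" for v]
        Suc.prems(1) eq diff by auto
  qed
  show ?thesis using *[of f g] *[of g f] assms(2) by auto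
qed

lemma Ck_on_imp_continuous_on: "Ck_on k S f \<Longrightarrow> continuous_on S f"
  by (cases k) (auto intro!: continuous_at_imp_continuous_on differentiable_imp_continuous_within)

lemma Ck_on_Suc_imp: "Ck_on (Suc k) S f \<Longrightarrow> Ck_on k S f"
proof (induction k arbitrary: f)
  case 0
  then show ?case using Ck_on_imp_continuous_on[of "Suc 0"] by simp
next
  case (Suc k)
  then show ?case by (metis Ck_on.simps(2))
qed

lemma Ck_on_subset: "Ck_on k S f \<Longrightarrow> S' \<subseteq> S \<Longrightarrow> Ck_on k S' f"
  by (induction k arbitrary: f) (auto intro: continuous_on_subset)

text \<open>Continuity at a point and derivatives \<open>at x\<close> only see a neighbourhood of
  the point, so covering \<open>S\<close> by open sets is enough.\<close>

lemma Ck_on_local: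
  assumes "\<And>x. x \<in> S \<Longrightarrow> \<exists>U. open U \<and> x \<in> U \<and> Ck_on k U f"
  shows "Ck_on k S f"
  using assms
proof (induction k arbitrary: f)
  case 0
  show ?case unfolding Ck_on.simps
  proof (rule continuous_at_imp_continuous_on, rule ballI)
    fix x assume "x \<in> S"
    then obtain U where "open U" "x \<in> U" "continuous_on U f" using 0 by force
    then show "isCont f x" using continuous_on_eq_continuous_at by blast
  qed
next
  case (Suc k)
  show ?case unfolding Ck_on.simps
  proof (intro conjI ballI allI)
    fix x assume "x \<in> S"
    then show "f differentiable at x" using Suc.prems by force
  next
    fix v
    show "Ck_on k S (\<lambda>x. frechet_derivative f (at x) v)"
    proof (rule Suc.IH)
      fix x assume "x \<in> S"
      then show "\<exists>U. open U \<and> x \<in> U \<and> Ck_on k U (\<lambda>x. frechet_derivative f (at x) v)"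
        using Suc.prems by fastforce
    qed
  qed
qed

lemma Ck_on_const [simp]: "Ck_on k S (\<lambda>x. c)"
  by (induction k arbitrary: c) simp_all

lemma Ck_on_bounded_linear:
  assumes "bounded_linear L" "open S" "Ck_on k S f"
  shows "Ck_on k S (\<lambda>x. L (f x))"
  using assms(3)
proof (induction k arbitrary: f)
  case 0
  then show ?case by (simp add: bounded_linear.continuous_on[OF assms(1)])
next
  case (Suc k)
  have D: "((\<lambda>x. L (f x)) has_derivative (\<lambda>v. L (frechet_derivative f (at x) v))) (at x)"
    if "x \<in> S" for x
    by (rule bounded_linear.has_derivative[OF assms(1) Ck_on_Suc_has_derivative[OF Suc.prems that]])
  have "Ck_on k S (\<lambda>x. frechet_derivative (\<lambda>x. L (f x)) (at x) v)" for v
  proof -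
    have "Ck_on k S (\<lambda>x. L (frechet_derivative f (at x) v))"
      using Suc by simp
    then show ?thesis
      by (subst Ck_on_cong[OF assms(2), of _ "\<lambda>x. L (frechet_derivative f (at x) v)"])
        (simp_all add: frechet_derivative_eqI[OF D])
  qed
  then show ?case using D by (auto simp: differentiable_def)
qed

lemma Ck_on_add:
  assumes "open S" "Ck_on k S f" "Ck_on k S g"
  shows "Ck_on k S (\<lambda>x. f x + g x)"
  using assms(2,3)
proof (induction k arbitrary: f g)
  case 0
  then show ?case by (simp add: continuous_on_add)
next
  case (Suc k)
  have D: "((\<lambda>x. f x + g x) has_derivative
      (\<lambda>v. frechet_derivative f (at x) v + frechet_derivative g (at x) v)) (at x)" if "x \<in> S" for x
    by (intro has_derivative_add Ck_on_Suc_has_derivative[OF Suc.prems(1) that]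
        Ck_on_Suc_has_derivative[OF Suc.prems(2) that])
  have "Ck_on k S (\<lambda>x. frechet_derivative (\<lambda>x. f x + g x) (at x) v)" for v
  proof -
    have "Ck_on k S (\<lambda>x. frechet_derivative f (at x) v + frechet_derivative g (at x) v)"
      using Suc by simp
    then show ?thesis
      by (subst Ck_on_cong[OF assms(1), of _ "\<lambda>x. frechet_derivative f (at x) v + frechet_derivative g (at x) v"])
        (simp_all add: frechet_derivative_eqI[OF D])
  qed
  then show ?case using D by (auto simp: differentiable_def)
qed

lemma Ck_on_scaleR:
  assumes "open S" "Ck_on k S f" "Ck_on k S g"
  shows "Ck_on k S (\<lambda>x. f x *\<^sub>R g x)"
  using assms(2,3)
proof (induction k arbitrary: f g)
  case 0
  then show ?case by (simp add: continuous_on_scaleR)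
next
  case (Suc k)
  have D: "((\<lambda>x. f x *\<^sub>R g x) has_derivative
      (\<lambda>v. f x *\<^sub>R frechet_derivative g (at x) v + frechet_derivative f (at x) v *\<^sub>R g x)) (at x)"
    if "x \<in> S" for x
    by (intro has_derivative_scaleR Ck_on_Suc_has_derivative[OF Suc.prems(1) that]
        Ck_on_Suc_has_derivative[OF Suc.prems(2) that])
  have "Ck_on k S (\<lambda>x. frechet_derivative (\<lambda>x. f x *\<^sub>R g x) (at x) v)" for v
  proof -
    have "Ck_on k S f" "Ck_on k S g"
      using Suc.prems by (auto intro: Ck_on_Suc_imp simp del: Ck_on.simps)
    then have "Ck_on k S (\<lambda>x. f x *\<^sub>R frechet_derivative g (at x) v + frechet_derivative f (at x) v *\<^sub>R g x)"
      using Suc by (intro Ck_on_add assms) simp_all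
    then show ?thesis
      by (subst Ck_on_cong[OF assms(1), of _ "\<lambda>x. f x *\<^sub>R frechet_derivative g (at x) v + frechet_derivative f (at x) v *\<^sub>R g x"])
        (simp_all add: frechet_derivative_eqI[OF D])
  qed
  then show ?case using D by (auto simp: differentiable_def)
qed

lemma Ck_on_sum:
  assumes "open S" "\<And>i. i \<in> I \<Longrightarrow> Ck_on k S (f i)"
  shows "Ck_on k S (\<lambda>x. \<Sum>i\<in>I. f i x)"
  using assms(2) by (induction I rule: infinite_finite_induct) (auto intro: Ck_on_add assms(1))

lemma linear_eq_sum_Basis:
  fixes L :: "'a::euclidean_space \<Rightarrow> 'b::real_vector"
  assumes "linear L"
  shows "L v = (\<Sum>i\<in>Basis. (v \<bullet> i) *\<^sub>R L i)"
proof -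
  have "L v = L (\<Sum>i\<in>Basis. (v \<bullet> i) *\<^sub>R i)" by (simp add: euclidean_representation)
  also have "\<dots> = (\<Sum>i\<in>Basis. (v \<bullet> i) *\<^sub>R L i)"
    by (simp only: linear_sum[OF assms] linear_scale[OF assms])
  finally show ?thesis .
qed

lemma Ck_on_compose:
  fixes f :: "'a::euclidean_space \<Rightarrow> 'b::euclidean_space"
  assumes "open S" "open U" "Ck_on k S f" "Ck_on k U g" "f ` S \<subseteq> U"
  shows "Ck_on k S (\<lambda>x. g (f x))"
  using assms(3,4)
proof (induction k arbitrary: g)
  case 0
  then show ?case using continuous_on_compose2[of U g S f] assms(5) by simp
next
  case (Suc k)
  have D: "((\<lambda>x. g (f x)) has_derivative
      (\<lambda>v. frechet_derivative g (at (f x)) (frechet_derivative f (at x) v))) (at x)"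
    if "x \<in> S" for x
  proof -
    have "f x \<in> U" using assms(5) that by auto
    from diff_chain_at[OF Ck_on_Suc_has_derivative[OF Suc.prems(1) that]
        Ck_on_Suc_has_derivative[OF Suc.prems(2) this]]
    show ?thesis by (simp add: o_def)
  qed
  have "Ck_on k S (\<lambda>x. frechet_derivative (\<lambda>x. g (f x)) (at x) v)" for v
  proof -
    \<comment> \<open>Regularity is known for derivatives of \<open>g\<close> in fixed directions
      only, whereas the direction in the chain rule moves with \<open>x\<close>. Expanding it in
      \<open>Basis\<close> reduces to fixed directions.\<close>
    have "Ck_on k S (\<lambda>x. frechet_derivative g (at (f x)) i)" for i
      using Suc.prems by (intro Suc.IH Ck_on_Suc_imp[OF Suc.prems(1)]) simp
    then have "Ck_on k S (\<lambda>x. \<Sum>i\<in>Basis. (frechet_derivative f (at x) v \<bullet> i) *\<^sub>R frechet_derivative g (at (f x)) i)"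
      using Suc.prems
      by (intro Ck_on_sum Ck_on_scaleR Ck_on_bounded_linear[where L="\<lambda>u. u \<bullet> i" for i] assms(1)
          bounded_linear_inner_left) auto
    moreover have "frechet_derivative (\<lambda>x. g (f x)) (at x) v =
        (\<Sum>i\<in>Basis. (frechet_derivative f (at x) v \<bullet> i) *\<^sub>R frechet_derivative g (at (f x)) i)"
      if "x \<in> S" for x
    proof -
      have "linear (frechet_derivative g (at (f x)))"
        using Suc.prems(2) assms(5) that by (intro linear_frechet_derivative) auto
      then show ?thesis
        using linear_eq_sum_Basis frechet_derivative_eqI[OF D[OF that]] by metis
    qed
    ultimately show ?thesis
      by (subst Ck_on_cong[OF assms(1)]) auto
  qed
  then show ?case using D by (auto simp: differentiable_def)
qed

lemma Ck_on_inverse: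
  fixes f :: "'a::euclidean_space \<Rightarrow> real"
  assumes "open S" "Ck_on k S f" "\<And>x. x \<in> S \<Longrightarrow> f x \<noteq> 0"
  shows "Ck_on k S (\<lambda>x. inverse (f x))"
  using assms(2)
proof (induction k)
  case 0
  then show ?case using assms(3) by (simp add: continuous_on_inverse)
next
  case (Suc k)
  have D: "((\<lambda>x. inverse (f x)) has_derivative
      (\<lambda>v. - (inverse (f x) * frechet_derivative f (at x) v * inverse (f x)))) (at x)"
    if "x \<in> S" for x
    by (intro Deriv.has_derivative_inverse Ck_on_Suc_has_derivative[OF Suc.prems that] assms(3) that)
  have "Ck_on k S (\<lambda>x. frechet_derivative (\<lambda>x. inverse (f x)) (at x) v)" for v
  proof -
    have "Ck_on k S (\<lambda>x. inverse (f x))"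
      using Suc by (auto intro: Ck_on_Suc_imp simp del: Ck_on.simps)
    then have "Ck_on k S (\<lambda>x. (- 1) *\<^sub>R ((inverse (f x) *\<^sub>R frechet_derivative f (at x) v) *\<^sub>R inverse (f x)))"
      using Suc.prems by (intro Ck_on_scaleR assms) auto
    then show ?thesis
      by (subst Ck_on_cong[OF assms(1), of _ "\<lambda>x. (- 1) *\<^sub>R ((inverse (f x) *\<^sub>R frechet_derivative f (at x) v) *\<^sub>R inverse (f x))"])
        (simp_all add: frechet_derivative_eqI[OF D])
  qed
  then show ?case using D by (auto simp: differentiable_def)
qed

text \<open>A product rule in which one factor is merely continuous: since \<open>f\<close> vanishes
  at \<open>x\<close>, the increments of \<open>u\<close> enter only multiplied by something of
  first order. It lets the solution of a linear system be differentiated when only its continuity is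
  known.\<close>

lemma has_derivative_scaleR_vanishing:
  fixes f :: "'a::real_normed_vector \<Rightarrow> real" and u :: "'a \<Rightarrow> 'b::real_normed_vector"
  assumes f: "(f has_derivative f') (at x)" and "f x = 0" and u: "isCont u x"
  shows "((\<lambda>y. f y *\<^sub>R u y) has_derivative (\<lambda>v. f' v *\<^sub>R u x)) (at x)"
proof -
  interpret bounded_linear f' using f by (rule has_derivative_bounded_linear)
  obtain K where K: "K > 0" "\<And>v. norm (f' v) \<le> norm v * K"
    using pos_bounded by blast
  have lim_f: "((\<lambda>y. norm (f y - f x - f' (y - x)) / norm (y - x)) \<longlongrightarrow> 0) (at x)"
    using f by (simp add: has_derivative_iff_norm)
  have lim_u: "(u \<longlongrightarrow> u x) (at x)" using u by (simp add: isCont_def)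
  have "((\<lambda>y. norm (f y - f x - f' (y - x)) / norm (y - x) * norm (u y) + K * norm (u y - u x)) \<longlongrightarrow>
      0 * norm (u x) + K * norm (u x - u x)) (at x)"
    by (intro tendsto_intros lim_f lim_u)
  then have lim: "((\<lambda>y. norm (f y - f x - f' (y - x)) / norm (y - x) * norm (u y) + K * norm (u y - u x)) \<longlongrightarrow> 0) (at x)"
    by simp
  have est: "norm (f y *\<^sub>R u y - f x *\<^sub>R u x - f' (y - x) *\<^sub>R u x) / norm (y - x) \<le>
      norm (f y - f x - f' (y - x)) / norm (y - x) * norm (u y) + K * norm (u y - u x)"
    if "y \<noteq> x" for y
  proof -
    have "f y *\<^sub>R u y - f x *\<^sub>R u x - f' (y - x) *\<^sub>R u x =
        (f y - f x - f' (y - x)) *\<^sub>R u y + f' (y - x) *\<^sub>R (u y - u x)"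
      using \<open>f x = 0\<close> by (simp add: algebra_simps)
    then have "norm (f y *\<^sub>R u y - f x *\<^sub>R u x - f' (y - x) *\<^sub>R u x) \<le>
        norm (f y - f x - f' (y - x)) * norm (u y) + norm (f' (y - x)) * norm (u y - u x)"
      using norm_triangle_ineq by (metis norm_scaleR real_norm_def)
    also have "norm (f' (y - x)) * norm (u y - u x) \<le> (norm (y - x) * K) * norm (u y - u x)"
      by (intro mult_right_mono K) simp
    finally have "norm (f y *\<^sub>R u y - f x *\<^sub>R u x - f' (y - x) *\<^sub>R u x) \<le>
        norm (f y - f x - f' (y - x)) * norm (u y) + norm (y - x) * K * norm (u y - u x)" by simp
    then show ?thesis using that by (simp add: field_simps)
  qed
  have "((\<lambda>y. norm (f y *\<^sub>R u y - f x *\<^sub>R u x - f' (y - x) *\<^sub>R u x) / norm (y - x)) \<longlongrightarrow> 0) (at x)"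
    by (rule tendsto_sandwich[OF _ _ tendsto_const lim])
      (use est in \<open>auto simp: eventually_at_filter simp del: real_norm_def intro!: always_eventually\<close>)
  moreover have "bounded_linear (\<lambda>v. f' v *\<^sub>R u x)"
    using bounded_linear_scaleR_left bounded_linear_compose bounded_linear_axioms by blast
  ultimately show ?thesis by (simp add: has_derivative_iff_norm)
qed


lemma Ck_on_diff:
  assumes "open S" "Ck_on k S f" "Ck_on k S g"
  shows "Ck_on k S (\<lambda>x. f x - g x)"
  using Ck_on_add[OF assms(1,2), of "\<lambda>x. - 1 *\<^sub>R g x"] Ck_on_scaleR[OF assms(1) Ck_on_const assms(3), of "- 1"]
  by simp

text \<open>The solution of a nondegenerate linear system is as regular as its coefficients. The
  system is compared with the one frozen at a point \<open>y\<close>, first to get continuity, then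
  differentiability; higher orders follow because the derivative of the solution solves a system
  with the same \<open>G\<close>.\<close>

lemma Ck_on_nondegenerate_solution:
  fixes G :: "'a::euclidean_space \<Rightarrow> 'v::euclidean_space \<Rightarrow> 'v \<Rightarrow> real"
  assumes "open S"
    and bil: "\<And>x. x \<in> S \<Longrightarrow> bilinear (G x)"
    and nondeg: "\<And>x u. x \<in> S \<Longrightarrow> (\<And>v. G x u v = 0) \<Longrightarrow> u = 0"
    and G: "\<And>u v. Ck_on k S (\<lambda>x. G x u v)"
    and b: "\<And>v. Ck_on k S (\<lambda>x. b x v)"
    and sol: "\<And>x v. x \<in> S \<Longrightarrow> G x (s x) v = b x v"
  shows "Ck_on k S s"
proof -
  have expand: "G x u v = (\<Sum>j\<in>Basis. (u \<bullet> j) * G x j v)" if "x \<in> S" for x u v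
    using linear_eq_sum_Basis[of "\<lambda>u. G x u v" u] bil[OF that] by (simp add: bilinear_def)
  have expandr: "G x u v = (\<Sum>j\<in>Basis. (v \<bullet> j) * G x u j)" if "x \<in> S" for x u v
    using linear_eq_sum_Basis[of "G x u" v] bil[OF that] by (simp add: bilinear_def)
  \<comment> \<open>\<open>M\<close> is a left inverse of the system frozen at \<open>y\<close>.
    Applying it to the equation at \<open>x\<close> expresses \<open>s\<close> by the right-hand
    side, up to a correction whose coefficients \<open>G x j i - G y j i\<close> vanish at
    \<open>x = y\<close>. The same \<open>M\<close> serves all \<open>x\<close>, \<open>s\<close>
    and \<open>b\<close>.\<close>
  have rep: "\<exists>M :: 'v \<Rightarrow> 'v. \<forall>x s b. x \<in> S \<longrightarrow> (\<forall>v. G x s v = b v) \<longrightarrow>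
      s = (\<Sum>i\<in>Basis. b i *\<^sub>R M i)
        - (\<Sum>i\<in>Basis. \<Sum>j\<in>Basis. (G x j i - G y j i) *\<^sub>R ((s \<bullet> j) *\<^sub>R M i))" if "y \<in> S" for y
  proof -
    define L where "L u = (\<Sum>i\<in>Basis. G y u i *\<^sub>R i)" for u
    have lin: "linear (\<lambda>u. G y u v)" for v using bil[OF \<open>y \<in> S\<close>] by (simp add: bilinear_def)
    have linL: "linear L"
      unfolding L_def
      by (rule linearI) (simp_all add: linear_add[OF lin] linear_scale[OF lin] scaleR_left_distrib
          sum.distrib scaleR_sum_right)
    have "u = 0" if "L u = 0" for u
    proof (rule nondeg[OF \<open>y \<in> S\<close>])
      fix v
      have "G y u i = 0" if "i \<in> Basis" for i
      proof -
        have "L u \<bullet> i = G y u i" using that unfolding L_def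
          by (simp add: inner_sum_left inner_Basis if_distrib cong: if_cong)
        then show ?thesis using \<open>L u = 0\<close> by simp
      qed
      then show "G y u v = 0" using expandr[OF \<open>y \<in> S\<close>, of u v] by simp
    qed
    then have "inj L" using linear_injective_0[OF linL] by auto
    then obtain M where M: "linear M" "M \<circ> L = id" using linear_injective_left_inverse[OF linL] by auto
    have "s = (\<Sum>i\<in>Basis. b i *\<^sub>R M i)
        - (\<Sum>i\<in>Basis. \<Sum>j\<in>Basis. (G x j i - G y j i) *\<^sub>R ((s \<bullet> j) *\<^sub>R M i))"
      if "x \<in> S" "\<forall>v. G x s v = b v" for x s b
    proof -
      have "L s = (\<Sum>i\<in>Basis. (b i - (G x s i - G y s i)) *\<^sub>R i)"
        unfolding L_def using that(2) by (intro sum.cong) auto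
      then have "s = M (\<Sum>i\<in>Basis. (b i - (G x s i - G y s i)) *\<^sub>R i)"
        using M(2) by (metis comp_apply id_apply)
      also have "\<dots> = (\<Sum>i\<in>Basis. (b i - (G x s i - G y s i)) *\<^sub>R M i)"
        by (simp only: linear_sum[OF M(1)] linear_scale[OF M(1)])
      also have "\<dots> = (\<Sum>i\<in>Basis. b i *\<^sub>R M i) - (\<Sum>i\<in>Basis. (G x s i - G y s i) *\<^sub>R M i)"
        by (simp add: scaleR_left_diff_distrib sum_subtractf)
      also have "(\<Sum>i\<in>Basis. (G x s i - G y s i) *\<^sub>R M i) =
          (\<Sum>i\<in>Basis. \<Sum>j\<in>Basis. (G x j i - G y j i) *\<^sub>R ((s \<bullet> j) *\<^sub>R M i))"
      proof (rule sum.cong[OF refl])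
        fix i :: 'v assume "i \<in> Basis"
        have "G x s i - G y s i = (\<Sum>j\<in>Basis. (G x j i - G y j i) * (s \<bullet> j))"
          unfolding expand[OF that(1), of s i] expand[OF \<open>y \<in> S\<close>, of s i]
          by (simp add: algebra_simps sum_subtractf)
        then show "(G x s i - G y s i) *\<^sub>R M i = (\<Sum>j\<in>Basis. (G x j i - G y j i) *\<^sub>R ((s \<bullet> j) *\<^sub>R M i))"
          by (simp add: scaleR_sum_left)
      qed
      finally show ?thesis .
    qed
    then show ?thesis by blast
  qed
  have cont: "continuous_on S s"
    if G: "\<And>u v. continuous_on S (\<lambda>x. G x u v)" and b: "\<And>v. continuous_on S (\<lambda>x. b x v)"
      and sol: "\<And>x v. x \<in> S \<Longrightarrow> G x (s x) v = b x v" for b s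
  proof (rule continuous_at_imp_continuous_on, rule ballI)
    fix y assume "y \<in> S"
    then obtain M where M: "\<And>x. x \<in> S \<Longrightarrow> s x = (\<Sum>i\<in>Basis. b x i *\<^sub>R M i)
        - (\<Sum>i\<in>Basis. \<Sum>j\<in>Basis. (G x j i - G y j i) *\<^sub>R ((s x \<bullet> j) *\<^sub>R M i))"
      using rep[OF \<open>y \<in> S\<close>] sol by meson
    define e where "e x = (\<Sum>i\<in>Basis. \<Sum>j\<in>Basis. \<bar>G x j i - G y j i\<bar> * norm (M i))" for x
    define w where "w x = (\<Sum>i\<in>Basis. b x i *\<^sub>R M i)" for x
    have Gc: "((\<lambda>x. G x u v) \<longlongrightarrow> G y u v) (at y)" for u v
      using G \<open>y \<in> S\<close> \<open>open S\<close> by (metis continuous_on_eq_continuous_at isCont_def)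
    have bc: "((\<lambda>x. b x v) \<longlongrightarrow> b y v) (at y)" for v
      using b \<open>y \<in> S\<close> \<open>open S\<close> by (metis continuous_on_eq_continuous_at isCont_def)
    have e0: "e \<midarrow>y\<rightarrow> (\<Sum>i\<in>Basis. \<Sum>j\<in>Basis. \<bar>G y j i - G y j i\<bar> * norm (M i))"
      unfolding e_def by (intro tendsto_intros Gc)
    then have e: "e \<midarrow>y\<rightarrow> 0" by simp
    have w: "w \<midarrow>y\<rightarrow> w y" unfolding w_def by (intro tendsto_intros bc)
    have sy: "s y = w y" using M[OF \<open>y \<in> S\<close>] by (simp add: w_def)
    have aux: "a - b = - c" if "a = b - c" for a b c :: 'v using that by simp
    have est: "norm (s x - w x) \<le> e x * norm (s x)" if "x \<in> S" for x
    proof -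
      have "s x - w x = - (\<Sum>i\<in>Basis. \<Sum>j\<in>Basis. (G x j i - G y j i) *\<^sub>R ((s x \<bullet> j) *\<^sub>R M i))"
        using aux[OF M[OF that]] unfolding w_def .
      then have "norm (s x - w x) = norm (\<Sum>i\<in>Basis. \<Sum>j\<in>Basis. (G x j i - G y j i) *\<^sub>R ((s x \<bullet> j) *\<^sub>R M i))"
        by simp
      also have "\<dots> \<le> (\<Sum>i\<in>Basis. \<Sum>j\<in>Basis. \<bar>G x j i - G y j i\<bar> * norm (M i) * norm (s x))"
      proof (intro sum_norm_le)
        fix i j :: 'v assume "j \<in> Basis"
        have "\<bar>G x j i - G y j i\<bar> * (\<bar>s x \<bullet> j\<bar> * norm (M i)) \<le>
            \<bar>G x j i - G y j i\<bar> * (norm (s x) * norm (M i))"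
          by (intro mult_left_mono mult_right_mono Basis_le_norm \<open>j \<in> Basis\<close>) auto
        then show "norm ((G x j i - G y j i) *\<^sub>R ((s x \<bullet> j) *\<^sub>R M i)) \<le> \<bar>G x j i - G y j i\<bar> * norm (M i) * norm (s x)"
          by (simp add: abs_mult mult_ac)
      qed
      also have "\<dots> = e x * norm (s x)" unfolding e_def by (simp add: sum_distrib_right)
      finally show ?thesis .
    qed
    \<comment> \<open>Once \<open>e x < 1/2\<close>, the error \<open>e x * norm (s x)\<close> can
      be absorbed: \<open>norm (s x)\<close> is at most twice \<open>norm (w x)\<close>, and
      \<open>w\<close> has a limit at \<open>y\<close>. No a priori bound on \<open>s\<close>
      enters.\<close>
    have ev: "eventually (\<lambda>x. x \<in> S \<and> e x < 1/2) (at y)"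
      using order_tendstoD(2)[OF e, of "1/2"] eventually_at_topological \<open>open S\<close> \<open>y \<in> S\<close>
      by (intro eventually_conj) auto
    have e_nonneg: "e x \<ge> 0" for x unfolding e_def by (intro sum_nonneg) auto
    have bound: "eventually (\<lambda>x. norm (s x - w x) \<le> e x * (2 * norm (w x))) (at y)"
      using ev
    proof eventually_elim
      case (elim x)
      have "norm (s x) \<le> norm (w x) + norm (s x - w x)" by (metis norm_triangle_sub add.commute)
      also have "norm (s x - w x) \<le> (1/2) * norm (s x)"
        using est[of x] elim mult_right_mono[of "e x" "1/2" "norm (s x)"] norm_ge_zero[of "s x"] by force
      finally have "norm (s x) \<le> 2 * norm (w x)" by simp
      then have "e x * norm (s x) \<le> e x * (2 * norm (w x))" using e_nonneg by (intro mult_left_mono)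
      then show ?case using est[of x] elim by linarith
    qed
    have "((\<lambda>x. e x * (2 * norm (w x))) \<longlongrightarrow> 0 * (2 * norm (w y))) (at y)"
      by (intro tendsto_intros e w)
    then have "((\<lambda>x. s x - w x) \<longlongrightarrow> 0) (at y)"
      by (intro Lim_null_comparison[OF bound]) simp
    from tendsto_add[OF this w] show "isCont s y" by (simp add: isCont_def sy)
  qed
  have diff: "s differentiable at y"
    if "y \<in> S" and G: "\<And>u v. Ck_on (Suc 0) S (\<lambda>x. G x u v)" and b: "\<And>v. Ck_on (Suc 0) S (\<lambda>x. b x v)"
      and sol: "\<And>x v. x \<in> S \<Longrightarrow> G x (s x) v = b x v" for b s y
  proof -
    have "continuous_on S s" using Ck_on_imp_continuous_on[OF G] Ck_on_imp_continuous_on[OF b] sol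
      by (rule cont)
    then have sc: "isCont s y" using \<open>open S\<close> \<open>y \<in> S\<close> continuous_on_eq_continuous_at by blast
    obtain M where M: "\<And>x. x \<in> S \<Longrightarrow> s x = (\<Sum>i\<in>Basis. b x i *\<^sub>R M i)
        - (\<Sum>i\<in>Basis. \<Sum>j\<in>Basis. (G x j i - G y j i) *\<^sub>R ((s x \<bullet> j) *\<^sub>R M i))"
      using rep[OF \<open>y \<in> S\<close>] sol by meson
    \<comment> \<open>The scalar factor vanishes at \<open>y\<close>, so the product is
      differentiable there although \<open>s\<close> is so far only known to be continuous.\<close>
    have "((\<lambda>x. (G x j i - G y j i) *\<^sub>R ((s x \<bullet> j) *\<^sub>R M i)) has_derivative
        (\<lambda>v. frechet_derivative (\<lambda>x. G x j i) (at y) v *\<^sub>R ((s y \<bullet> j) *\<^sub>R M i))) (at y)" for i j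
      using has_derivative_diff[OF Ck_on_Suc_has_derivative[OF G \<open>y \<in> S\<close>] has_derivative_const, of j i]
      by (intro has_derivative_scaleR_vanishing continuous_intros sc) simp_all
    then have "((\<lambda>x. (\<Sum>i\<in>Basis. b x i *\<^sub>R M i)
        - (\<Sum>i\<in>Basis. \<Sum>j\<in>Basis. (G x j i - G y j i) *\<^sub>R ((s x \<bullet> j) *\<^sub>R M i))) has_derivative
        (\<lambda>v. (\<Sum>i\<in>Basis. frechet_derivative (\<lambda>x. b x i) (at y) v *\<^sub>R M i)
        - (\<Sum>i\<in>Basis. \<Sum>j\<in>Basis. frechet_derivative (\<lambda>x. G x j i) (at y) v *\<^sub>R ((s y \<bullet> j) *\<^sub>R M i)))) (at y)"
      by (intro has_derivative_diff has_derivative_sum has_derivative_scaleR_left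
          Ck_on_Suc_has_derivative[OF b \<open>y \<in> S\<close>])
    then have "(s has_derivative (\<lambda>v. (\<Sum>i\<in>Basis. frechet_derivative (\<lambda>x. b x i) (at y) v *\<^sub>R M i)
        - (\<Sum>i\<in>Basis. \<Sum>j\<in>Basis. frechet_derivative (\<lambda>x. G x j i) (at y) v *\<^sub>R ((s y \<bullet> j) *\<^sub>R M i)))) (at y)"
      by (rule has_derivative_transform_within_open[OF _ \<open>open S\<close> \<open>y \<in> S\<close>]) (rule M[symmetric])
    then show ?thesis by (auto simp: differentiable_def)
  qed
  show ?thesis using G b sol
  proof (induction k arbitrary: b s)
    case 0
    then show ?case using cont[of b s] by simp
  next
    case (Suc k)
    note G1 = Suc.prems(1) and b1 = Suc.prems(2) and sol = Suc.prems(3)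
    have Ck0: "Ck_on (Suc 0) S f" if "Ck_on (Suc k) S f" for f :: "'a \<Rightarrow> real"
      using that Ck_on_imp_continuous_on[of k S] by (simp only: Ck_on.simps) blast
    have dif: "s differentiable at x" if "x \<in> S" for x
      using diff[OF that, of b s] Ck0[OF G1] Ck0[OF b1] sol by blast
    have sk: "Ck_on k S s" using Ck_on_Suc_imp[OF G1] Ck_on_Suc_imp[OF b1] sol by (rule Suc.IH)
    \<comment> \<open>Differentiating \<open>G x (s x) u = b x u\<close> in direction
      \<open>v\<close> gives a system for the derivative of \<open>s\<close> with the same
      \<open>G\<close>. Its new right-hand side contains \<open>s\<close> itself, which is why
      \<open>sk\<close> comes first, and the induction has to range over all \<open>b\<close> and
      \<open>s\<close>.\<close>
    have "Ck_on k S (\<lambda>x. frechet_derivative s (at x) v)" for v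
    proof (rule Suc.IH)
      show "Ck_on k S (\<lambda>x. G x u v)" for u v by (rule Ck_on_Suc_imp[OF G1])
      show "Ck_on k S (\<lambda>x. frechet_derivative (\<lambda>x. b x u) (at x) v -
          (\<Sum>j\<in>Basis. (s x \<bullet> j) *\<^sub>R frechet_derivative (\<lambda>x. G x j u) (at x) v))" for u
        using G1 b1
        by (intro Ck_on_diff Ck_on_sum Ck_on_scaleR \<open>open S\<close>
            Ck_on_bounded_linear[where L="\<lambda>u. u \<bullet> i" for i, OF bounded_linear_inner_left _ sk]) simp_all
      show "G x (frechet_derivative s (at x) v) u = frechet_derivative (\<lambda>x. b x u) (at x) v -
          (\<Sum>j\<in>Basis. (s x \<bullet> j) *\<^sub>R frechet_derivative (\<lambda>x. G x j u) (at x) v)" if "x \<in> S" for x u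
      proof -
        have eq: "(\<Sum>j\<in>Basis. (s y \<bullet> j) * G y j u) = b y u" if "y \<in> S" for y
          using expand[OF that, of "s y" u] sol[OF that, of u] by (rule trans[OF sym])
        have "(s has_derivative frechet_derivative s (at x)) (at x)"
          using dif[OF that] frechet_derivative_works by blast
        then have "((\<lambda>x. \<Sum>j\<in>Basis. (s x \<bullet> j) * G x j u) has_derivative
           (\<lambda>v. \<Sum>j\<in>Basis. (s x \<bullet> j) * frechet_derivative (\<lambda>x. G x j u) (at x) v
             + (frechet_derivative s (at x) v \<bullet> j) * G x j u)) (at x)"
          by (intro has_derivative_sum has_derivative_mult has_derivative_inner_left
              Ck_on_Suc_has_derivative[OF G1 that])
        then have "((\<lambda>x. b x u) has_derivative
           (\<lambda>v. \<Sum>j\<in>Basis. (s x \<bullet> j) * frechet_derivative (\<lambda>x. G x j u) (at x) v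
             + (frechet_derivative s (at x) v \<bullet> j) * G x j u)) (at x)"
          by (rule has_derivative_transform_within_open[OF _ \<open>open S\<close> that])
            (rule eq)
        from frechet_derivative_eqI[OF this] show ?thesis
          by (simp add: expand[OF that, of "frechet_derivative s (at x) v" u] sum.distrib)
      qed
    qed
    then show ?case using dif by simp
  qed
qed

section \<open>Symmetry of second derivatives\<close>

lemma frechet_derivative_bounded_linear:
  assumes "bounded_linear L" "f differentiable at x"
  shows "frechet_derivative (\<lambda>x. L (f x)) (at x) v = L (frechet_derivative f (at x) v)"
  using frechet_derivative_eqI[OF bounded_linear.has_derivative[OF assms(1)
      assms(2)[unfolded frechet_derivative_works]]] by simp

lemma has_derivative_imp_DERIV_line:
  fixes h :: "'a::real_normed_vector \<Rightarrow> real"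
  assumes "(h has_derivative h') (at (a + s *\<^sub>R u))"
  shows "((\<lambda>s. h (a + s *\<^sub>R u)) has_real_derivative h' u) (at s)"
proof -
  interpret bounded_linear h' using assms by (rule has_derivative_bounded_linear)
  have "((\<lambda>s. a + s *\<^sub>R u) has_derivative (\<lambda>t. t *\<^sub>R u)) (at s)"
    by (auto intro!: derivative_eq_intros)
  from diff_chain_at[OF this assms]
  have "((\<lambda>s. h (a + s *\<^sub>R u)) has_derivative (\<lambda>t. h' (t *\<^sub>R u))) (at s)" by (simp add: o_def)
  moreover have "(\<lambda>t. h' (t *\<^sub>R u)) = (*) (h' u)" by (simp add: fun_eq_iff scaleR)
  ultimately show ?thesis by (simp add: has_field_derivative_def)
qed

text \<open>The mean value theorem is used twice: along \<open>u\<close> for the difference of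
  \<open>f\<close> between two opposite edges of the parallelogram, then along \<open>v\<close> for
  the first derivative so obtained.\<close>

lemma second_difference_mean_value:
  fixes f :: "'a::euclidean_space \<Rightarrow> real"
  assumes C2: "Ck_on (Suc (Suc 0)) S f" and "t > 0"
    and S: "\<And>s r. 0 \<le> s \<Longrightarrow> s \<le> t \<Longrightarrow> 0 \<le> r \<Longrightarrow> r \<le> t \<Longrightarrow> x + s *\<^sub>R u + r *\<^sub>R v \<in> S"
  shows "\<exists>s r. 0 < s \<and> s < t \<and> 0 < r \<and> r < t \<and>
    f (x + t *\<^sub>R u + t *\<^sub>R v) - f (x + t *\<^sub>R u) - f (x + t *\<^sub>R v) + f x =
    t * t * frechet_derivative (\<lambda>y. frechet_derivative f (at y) u) (at (x + s *\<^sub>R u + r *\<^sub>R v)) v"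
proof -
  let ?D = "\<lambda>y. frechet_derivative f (at y) u"
  have 1: "((\<lambda>s. f (x + r *\<^sub>R v + s *\<^sub>R u)) has_real_derivative ?D (x + r *\<^sub>R v + s *\<^sub>R u)) (at s)"
    if "0 \<le> s" "s \<le> t" "0 \<le> r" "r \<le> t" for s r
    using S[OF that] by (intro has_derivative_imp_DERIV_line Ck_on_Suc_has_derivative[OF C2]) (simp add: algebra_simps)
  have "\<exists>s>0. s < t \<and> (f (x + t *\<^sub>R v + t *\<^sub>R u) - f (x + 0 *\<^sub>R v + t *\<^sub>R u)) - (f (x + t *\<^sub>R v + 0 *\<^sub>R u) - f (x + 0 *\<^sub>R v + 0 *\<^sub>R u))
      = (t - 0) * (?D (x + t *\<^sub>R v + s *\<^sub>R u) - ?D (x + 0 *\<^sub>R v + s *\<^sub>R u))"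
    by (rule MVT2[OF \<open>t > 0\<close>]) (intro DERIV_diff 1, use \<open>t > 0\<close> in auto)
  then obtain s where s: "0 < s" "s < t"
    and eq: "f (x + t *\<^sub>R v + t *\<^sub>R u) - f (x + t *\<^sub>R u) - (f (x + t *\<^sub>R v) - f x)
      = t * (?D (x + t *\<^sub>R v + s *\<^sub>R u) - ?D (x + s *\<^sub>R u))" by auto
  have D: "Ck_on (Suc 0) S ?D" using C2 by simp
  have 2: "((\<lambda>r. ?D (x + s *\<^sub>R u + r *\<^sub>R v)) has_real_derivative
      frechet_derivative ?D (at (x + s *\<^sub>R u + r *\<^sub>R v)) v) (at r)" if "0 \<le> r" "r \<le> t" for r
    using S[of s r] that s by (intro has_derivative_imp_DERIV_line Ck_on_Suc_has_derivative[OF D]) auto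
  have "\<exists>r>0. r < t \<and> ?D (x + s *\<^sub>R u + t *\<^sub>R v) - ?D (x + s *\<^sub>R u + 0 *\<^sub>R v)
      = (t - 0) * frechet_derivative ?D (at (x + s *\<^sub>R u + r *\<^sub>R v)) v"
    by (rule MVT2[OF \<open>t > 0\<close>]) (intro 2, auto)
  then obtain r where r: "0 < r" "r < t" "?D (x + s *\<^sub>R u + t *\<^sub>R v) - ?D (x + s *\<^sub>R u)
      = t * frechet_derivative ?D (at (x + s *\<^sub>R u + r *\<^sub>R v)) v" by auto
  have "x + t *\<^sub>R v + s *\<^sub>R u = x + s *\<^sub>R u + t *\<^sub>R v" "x + t *\<^sub>R v + t *\<^sub>R u = x + t *\<^sub>R u + t *\<^sub>R v"
    by simp_all
  with eq r(3) have "f (x + t *\<^sub>R u + t *\<^sub>R v) - f (x + t *\<^sub>R u) - f (x + t *\<^sub>R v) + f x =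
    t * t * frechet_derivative ?D (at (x + s *\<^sub>R u + r *\<^sub>R v)) v" by (simp add: mult.assoc)
  with s r show ?thesis by blast
qed

text \<open>The second difference over a parallelogram is symmetric in \<open>u\<close> and
  \<open>v\<close>. Hence the two mixed derivatives agree at some pair of points of each small
  parallelogram at \<open>x\<close>, and continuity carries this to \<open>x\<close>.\<close>

lemma second_derivative_commute_real:
  fixes f :: "'a::euclidean_space \<Rightarrow> real"
  assumes "open S" and C2: "Ck_on (Suc (Suc 0)) S f" and "x \<in> S"
  shows "frechet_derivative (\<lambda>y. frechet_derivative f (at y) u) (at x) v =
    frechet_derivative (\<lambda>y. frechet_derivative f (at y) v) (at x) u"
proof -
  define P where "P u v y = frechet_derivative (\<lambda>y. frechet_derivative f (at y) u) (at y) v" for u v y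
  have "continuous_on S (P u v)" for u v using C2 unfolding P_def by simp
  then have cont: "isCont (P u v) x" for u v
    using \<open>open S\<close> \<open>x \<in> S\<close> continuous_on_eq_continuous_at by blast
  have "dist (P u v x) (P v u x) \<le> e" if "e > 0" for e
  proof -
    obtain d1 where d1: "d1 > 0" "\<And>y. dist y x < d1 \<Longrightarrow> dist (P u v y) (P u v x) < e / 2"
      using cont[of u v] \<open>e > 0\<close> unfolding continuous_at_eps_delta by (metis half_gt_zero)
    obtain d2 where d2: "d2 > 0" "\<And>y. dist y x < d2 \<Longrightarrow> dist (P v u y) (P v u x) < e / 2"
      using cont[of v u] \<open>e > 0\<close> unfolding continuous_at_eps_delta by (metis half_gt_zero)
    obtain d3 where d3: "d3 > 0" "\<And>y. dist y x < d3 \<Longrightarrow> y \<in> S"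
      using \<open>open S\<close> \<open>x \<in> S\<close> unfolding open_dist by meson
    define d where "d = min d1 (min d2 d3)"
    \<comment> \<open>With this scale the whole parallelogram lies within distance \<open>d\<close>
      of \<open>x\<close>; the summand 1 keeps the denominator positive when \<open>u\<close> and
      \<open>v\<close> vanish.\<close>
    define t where "t = d / (norm u + norm v + 1)"
    have "d > 0" using d1 d2 d3 by (simp add: d_def)
    have pos: "norm u + norm v + 1 > 0" using norm_ge_zero[of u] norm_ge_zero[of v] by linarith
    then have "t > 0" using \<open>d > 0\<close> by (simp add: t_def)
    have near: "dist (x + s *\<^sub>R u + r *\<^sub>R v) x < d" if "0 \<le> s" "s \<le> t" "0 \<le> r" "r \<le> t" for s r
    proof -
      have "dist (x + s *\<^sub>R u + r *\<^sub>R v) x = norm (s *\<^sub>R u + r *\<^sub>R v)" by (simp add: dist_norm)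
      also have "\<dots> \<le> s * norm u + r * norm v" using norm_triangle_ineq[of "s *\<^sub>R u" "r *\<^sub>R v"] that by simp
      also have "\<dots> \<le> t * norm u + t * norm v" by (intro add_mono mult_right_mono that) auto
      also have "\<dots> < t * (norm u + norm v + 1)" using \<open>t > 0\<close> by (simp add: algebra_simps)
      also have "\<dots> = d" using pos by (simp add: t_def)
      finally show ?thesis .
    qed
    have nearS: "x + s *\<^sub>R u + r *\<^sub>R v \<in> S" "x + s *\<^sub>R v + r *\<^sub>R u \<in> S"
      if "0 \<le> s" "s \<le> t" "0 \<le> r" "r \<le> t" for s r
      using near[of s r] near[of r s] that by (auto intro!: d3(2) simp: d_def add_ac)
    have "\<exists>s r. 0 < s \<and> s < t \<and> 0 < r \<and> r < t \<and>
      f (x + t *\<^sub>R u + t *\<^sub>R v) - f (x + t *\<^sub>R u) - f (x + t *\<^sub>R v) + f x = t * t * P u v (x + s *\<^sub>R u + r *\<^sub>R v)"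
      unfolding P_def by (rule second_difference_mean_value[OF C2 \<open>t > 0\<close>]) (rule nearS(1))
    then obtain s r where 1: "0 < s" "s < t" "0 < r" "r < t"
      "f (x + t *\<^sub>R u + t *\<^sub>R v) - f (x + t *\<^sub>R u) - f (x + t *\<^sub>R v) + f x = t * t * P u v (x + s *\<^sub>R u + r *\<^sub>R v)"
      by blast
    have "\<exists>s r. 0 < s \<and> s < t \<and> 0 < r \<and> r < t \<and>
      f (x + t *\<^sub>R v + t *\<^sub>R u) - f (x + t *\<^sub>R v) - f (x + t *\<^sub>R u) + f x = t * t * P v u (x + s *\<^sub>R v + r *\<^sub>R u)"
      unfolding P_def by (rule second_difference_mean_value[OF C2 \<open>t > 0\<close>]) (rule nearS(2))
    then obtain s' r' where 2: "0 < s'" "s' < t" "0 < r'" "r' < t"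
      "f (x + t *\<^sub>R v + t *\<^sub>R u) - f (x + t *\<^sub>R v) - f (x + t *\<^sub>R u) + f x = t * t * P v u (x + s' *\<^sub>R v + r' *\<^sub>R u)"
      by blast
    have sw: "x + t *\<^sub>R v + t *\<^sub>R u = x + t *\<^sub>R u + t *\<^sub>R v" "x + s' *\<^sub>R v + r' *\<^sub>R u = x + r' *\<^sub>R u + s' *\<^sub>R v"
      by simp_all
    have "t * t * P u v (x + s *\<^sub>R u + r *\<^sub>R v) = t * t * P v u (x + r' *\<^sub>R u + s' *\<^sub>R v)"
      using 1(5) 2(5) unfolding sw by linarith
    moreover have "t * t \<noteq> 0" using \<open>t > 0\<close> by simp
    ultimately have eq: "P u v (x + s *\<^sub>R u + r *\<^sub>R v) = P v u (x + r' *\<^sub>R u + s' *\<^sub>R v)"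
      using mult_left_cancel by blast
    have "dist (P u v (x + s *\<^sub>R u + r *\<^sub>R v)) (P u v x) < e / 2"
      using near[of s r] 1 unfolding d_def by (intro d1(2)) linarith
    moreover have "dist (P v u (x + r' *\<^sub>R u + s' *\<^sub>R v)) (P v u x) < e / 2"
      using near[of r' s'] 2 unfolding d_def by (intro d2(2)) linarith
    ultimately show ?thesis unfolding eq using dist_triangle_half_r less_imp_le by blast
  qed
  then have "dist (P u v x) (P v u x) \<le> 0" by (rule field_le_epsilon) simp
  then show ?thesis by (simp add: P_def)
qed

lemma second_derivative_commute:
  fixes f :: "'a::euclidean_space \<Rightarrow> 'b::euclidean_space"
  assumes "open S" and C2: "Ck_on (Suc (Suc 0)) S f" and "x \<in> S"
  shows "frechet_derivative (\<lambda>y. frechet_derivative f (at y) u) (at x) v =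
    frechet_derivative (\<lambda>y. frechet_derivative f (at y) v) (at x) u"
proof (rule euclidean_eqI)
  fix i :: 'b
  have comp: "frechet_derivative (\<lambda>y. frechet_derivative f (at y) u) (at x) v \<bullet> i =
    frechet_derivative (\<lambda>y. frechet_derivative (\<lambda>z. f z \<bullet> i) (at y) u) (at x) v" for u v
  proof -
    let ?D = "\<lambda>y. frechet_derivative f (at y) u"
    have D: "?D differentiable at x" using C2 \<open>x \<in> S\<close> by simp
    have "(\<lambda>y. ?D y \<bullet> i) differentiable at x"
      using D unfolding differentiable_def by (elim exE) (rule exI, erule has_derivative_inner_left)
    moreover have "frechet_derivative (\<lambda>z. f z \<bullet> i) (at y) u = ?D y \<bullet> i" if "y \<in> S" for y
      using C2 that by (intro frechet_derivative_bounded_linear bounded_linear_inner_left) simp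
    ultimately have "frechet_derivative (\<lambda>y. ?D y \<bullet> i) (at x) =
        frechet_derivative (\<lambda>y. frechet_derivative (\<lambda>z. f z \<bullet> i) (at y) u) (at x)"
      by (intro frechet_derivative_transform_within_open[OF _ \<open>open S\<close> \<open>x \<in> S\<close>]) simp_all
    then show ?thesis
      using frechet_derivative_bounded_linear[OF bounded_linear_inner_left[of i] D, of v] by simp
  qed
  show "frechet_derivative (\<lambda>y. frechet_derivative f (at y) u) (at x) v \<bullet> i =
    frechet_derivative (\<lambda>y. frechet_derivative f (at y) v) (at x) u \<bullet> i"
    unfolding comp
    by (intro second_derivative_commute_real[OF \<open>open S\<close> _ \<open>x \<in> S\<close>]
        Ck_on_bounded_linear[OF bounded_linear_inner_left \<open>open S\<close> C2])
qed


subsection \<open>Bilinear forms\<close>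

lemma bilinear_sum_scale:
  assumes "bilinear b"
  shows "b (\<Sum>i\<in>I. c i *\<^sub>R x i) (\<Sum>j\<in>J. d j *\<^sub>R y j) = (\<Sum>i\<in>I. \<Sum>j\<in>J. (c i * d j) *\<^sub>R b (x i) (y j))"
proof -
  have l: "linear (\<lambda>x. b x y)" and r: "linear (b x)" for x y
    using assms by (auto simp: bilinear_def)
  have "b (\<Sum>i\<in>I. c i *\<^sub>R x i) z = (\<Sum>i\<in>I. c i *\<^sub>R b (x i) z)" for z
    by (simp add: linear_sum[OF l] linear_scale[OF l])
  moreover have "b (x i) (\<Sum>j\<in>J. d j *\<^sub>R y j) = (\<Sum>j\<in>J. d j *\<^sub>R b (x i) (y j))" for i
    by (simp add: linear_sum[OF r] linear_scale[OF r])
  ultimately show ?thesis by (simp only: scaleR_sum_right scaleR_scaleR)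
qed

text \<open>Polarization: the value on \<open>x + y\<close> determines twice the mixed term.\<close>

lemma symmetric_bilinear_eqI:
  assumes b: "bilinear b" "\<And>x y. b x y = b y x" and c: "bilinear c" "\<And>x y. c x y = c y x"
    and diag: "\<And>x. b x x = c x x"
  shows "b x y = c x y"
proof -
  have "b (x + y) (x + y) = b x x + 2 *\<^sub>R b x y + b y y"
    by (simp add: bilinear_ladd[OF b(1)] bilinear_radd[OF b(1)] b(2)[of y x] scaleR_2)
  moreover have "c (x + y) (x + y) = c x x + 2 *\<^sub>R c x y + c y y"
    by (simp add: bilinear_ladd[OF c(1)] bilinear_radd[OF c(1)] c(2)[of y x] scaleR_2)
  ultimately have "2 *\<^sub>R b x y = 2 *\<^sub>R c x y" using diag by simp
  then show ?thesis by simp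
qed

text \<open>Real polynomials have no zero divisors: \<open>a \<noteq> 0\<close> makes the first
  factor a nonzero polynomial, so the second one is zero. Its top coefficient is singled out because
  it is the value at \<open>y\<close> of a quadratic form restricted to the line
  \<open>x + t *\<^sub>R y\<close>.\<close>

lemma real_quadratic_product_zero:
  fixes a b c d e f :: real
  assumes "\<And>t. (a + b * t + c * t\<^sup>2) * (d + e * t + f * t\<^sup>2) = 0" and "a \<noteq> 0"
  shows "f = 0"
proof -
  have "poly ([:a, b, c:] * [:d, e, f:]) t = 0" for t
    using assms(1)[of t] by (simp add: algebra_simps power2_eq_square)
  then have "[:a, b, c:] * [:d, e, f:] = 0" using poly_all_0_iff_0 by blast
  then show ?thesis using \<open>a \<noteq> 0\<close> by auto
qed

text \<open>If \<open>a x x\<close> and \<open>b y y\<close> were both nonzero, restriction to the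
  line through \<open>x\<close> in direction \<open>y\<close> would give two quadratic polynomials
  with product zero, one with constant coefficient \<open>a x x\<close>, the other with leading
  coefficient \<open>b y y\<close>.\<close>

lemma quadratic_form_product_zero:
  fixes a b :: "'e::real_vector \<Rightarrow> 'e \<Rightarrow> real"
  assumes a: "bilinear a" "\<And>x y. a x y = a y x" and b: "bilinear b" "\<And>x y. b x y = b y x"
    and prod: "\<And>x. a x x * b x x = 0"
  shows "(\<forall>x. a x x = 0) \<or> (\<forall>x. b x x = 0)"
proof (rule ccontr)
  assume "\<not> ?thesis"
  then obtain x y where "a x x \<noteq> 0" "b y y \<noteq> 0" by blast
  have expand: "c (x + t *\<^sub>R y) (x + t *\<^sub>R y) = c x x + (2 * c x y) * t + c y y * t\<^sup>2"
    if "bilinear c" "\<And>x y. c x y = c y x" for c :: "'e \<Rightarrow> 'e \<Rightarrow> real" and t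
    by (simp add: bilinear_ladd[OF that(1)] bilinear_radd[OF that(1)] bilinear_lmul[OF that(1)]
        bilinear_rmul[OF that(1)] that(2)[of y x] power2_eq_square algebra_simps)
  have "b y y = 0"
    using prod[of "x + t *\<^sub>R y" for t] unfolding expand[OF a] expand[OF b]
    by (rule real_quadratic_product_zero) (fact \<open>a x x \<noteq> 0\<close>)
  then show False using \<open>b y y \<noteq> 0\<close> by simp
qed

section \<open>Positive definite forms: orthonormal bases, traces, null vectors of trace-free
  forms\<close>

locale inner_form =
  fixes h :: "'e::euclidean_space \<Rightarrow> 'e \<Rightarrow> real"
  assumes bil_h: "bilinear h" and sym_h: "h x y = h y x" and pos_h: "x \<noteq> 0 \<Longrightarrow> h x x > 0"
begin

text \<open>Indexed by \<open>Basis\<close>, to match the quantification over bases in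
  \<open>metric_trace\<close>.\<close>

definition onb :: "('e \<Rightarrow> 'e) \<Rightarrow> bool" where
  "onb e \<longleftrightarrow> (\<forall>i\<in>Basis. \<forall>j\<in>Basis. h (e i) (e j) = (if i = j then 1 else 0))"

lemmas h_simps = bilinear_ladd[OF bil_h] bilinear_radd[OF bil_h] bilinear_lmul[OF bil_h]
  bilinear_rmul[OF bil_h] bilinear_lzero[OF bil_h] bilinear_rzero[OF bil_h]
  bilinear_lsub[OF bil_h] bilinear_rsub[OF bil_h] bilinear_lneg[OF bil_h] bilinear_rneg[OF bil_h]

lemma h_nondegenerate: "(\<And>y. h x y = 0) \<Longrightarrow> x = 0"
  using pos_h[of x] by force

lemma linear_h: "linear (h x)" "linear (\<lambda>x. h x y)"
  using bil_h by (auto simp: bilinear_def)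

text \<open>Gram-Schmidt. Indexing by natural numbers permits induction on the length;
  \<open>onb_exists\<close> transfers the result to \<open>Basis\<close>.\<close>

lemma orthonormal_family:
  assumes "n \<le> DIM('e)"
  shows "\<exists>f :: nat \<Rightarrow> 'e. \<forall>i<n. \<forall>j<n. h (f i) (f j) = (if i = j then 1 else 0)"
  using assms
proof (induction n)
  case 0
  then show ?case by simp
next
  case (Suc n)
  then obtain f :: "nat \<Rightarrow> 'e" where f: "\<And>i j. i < n \<Longrightarrow> j < n \<Longrightarrow> h (f i) (f j) = (if i = j then 1 else 0)"
    by force
  have "dim (f ` {..<n}) \<le> card (f ` {..<n})" by (intro dim_le_card') simp
  also have "\<dots> \<le> n" using card_image_le[of "{..<n}" f] by simp
  finally have "dim (f ` {..<n}) < DIM('e)" using Suc.prems by simp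
  then have "span (f ` {..<n}) \<noteq> UNIV" using dim_eq_full[of "f ` {..<n}"] by auto
  then obtain v where v: "v \<notin> span (f ` {..<n})" by blast
  define w where "w = v - (\<Sum>i<n. h v (f i) *\<^sub>R f i)"
  have "(\<Sum>i<n. h v (f i) *\<^sub>R f i) \<in> span (f ` {..<n})"
    by (intro span_sum span_scale span_base) auto
  then have "w \<noteq> 0" using v unfolding w_def by auto
  then have "h w w > 0" by (rule pos_h)
  have wf: "h w (f j) = 0" if "j < n" for j
  proof -
    have "h (\<Sum>i<n. h v (f i) *\<^sub>R f i) (f j) = (\<Sum>i<n. h v (f i) * h (f i) (f j))"
      by (simp add: linear_sum[OF linear_h(2)] h_simps)
    also have "\<dots> = (\<Sum>i<n. if i = j then h v (f j) else 0)"
      using f that by (intro sum.cong) auto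
    also have "\<dots> = h v (f j)" using that by simp
    finally show ?thesis unfolding w_def by (simp add: h_simps)
  qed
  define w' where "w' = (1 / sqrt (h w w)) *\<^sub>R w"
  have "h w' w' = 1" using \<open>h w w > 0\<close> unfolding w'_def by (simp add: h_simps)
  moreover have "h w' (f j) = 0" "h (f j) w' = 0" if "j < n" for j
    using wf[OF that] sym_h[of "f j" w] unfolding w'_def by (simp_all add: h_simps)
  ultimately show ?case
    using f by (intro exI[of _ "f(n := w')"]) (auto simp: less_Suc_eq)
qed

lemma onb_exists: "\<exists>e. onb e"
proof -
  obtain f :: "nat \<Rightarrow> 'e" where f: "\<And>i j. i < DIM('e) \<Longrightarrow> j < DIM('e) \<Longrightarrow> h (f i) (f j) = (if i = j then 1 else 0)"
    using orthonormal_family by blast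
  obtain k where k: "bij_betw k (Basis :: 'e set) {0..<DIM('e)}"
    using ex_bij_betw_finite_nat[OF finite_Basis] by blast
  have "k i < DIM('e)" if "i \<in> Basis" for i using bij_betwE[OF k] that by auto
  moreover have "k i = k j \<longleftrightarrow> i = j" if "i \<in> Basis" "j \<in> Basis" for i j
    using bij_betw_imp_inj_on[OF k] that by (auto dest: inj_onD)
  ultimately have "onb (\<lambda>i. f (k i))" unfolding onb_def using f by auto
  then show ?thesis by blast
qed

text \<open>The linear map \<open>E\<close> taking the standard basis to \<open>e\<close> is
  injective by orthonormality, hence surjective for reasons of dimension, so every \<open>x\<close>
  has coordinates, and pairing with \<open>e j\<close> reads them off.\<close>

lemma onb_expansion:
  assumes "onb e"
  shows "x = (\<Sum>i\<in>Basis. h x (e i) *\<^sub>R e i)"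
proof -
  define E where "E v = (\<Sum>i\<in>Basis. (v \<bullet> i) *\<^sub>R e i)" for v
  have lin: "linear E" unfolding E_def
    by (rule linearI) (simp_all add: inner_left_distrib scaleR_left_distrib sum.distrib scaleR_sum_right)
  have hE: "h (E v) (e j) = v \<bullet> j" if "j \<in> Basis" for v j
  proof -
    have "h (E v) (e j) = (\<Sum>i\<in>Basis. (v \<bullet> i) * h (e i) (e j))"
      unfolding E_def by (simp add: linear_sum[OF linear_h(2)] h_simps)
    also have "\<dots> = (\<Sum>i\<in>Basis. if i = j then v \<bullet> j else 0)"
      using assms that unfolding onb_def by (intro sum.cong) auto
    finally show ?thesis using that by simp
  qed
  have "v = 0" if "E v = 0" for v
  proof (rule euclidean_eqI)
    fix j :: 'e assume "j \<in> Basis"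
    then show "v \<bullet> j = 0 \<bullet> j" using hE[of j v] bilinear_lzero[OF bil_h, of "e j"] unfolding \<open>E v = 0\<close> by simp
  qed
  then have "inj E" using linear_injective_0[OF lin] by blast
  then have "surj E" using linear_injective_imp_surjective[OF lin] by blast
  then obtain v where "x = E v" by blast
  then show ?thesis using hE unfolding E_def by simp
qed

text \<open>The matrix between two orthonormal bases is orthogonal, which is the
  \<open>parseval\<close> identity. This independence of the basis is what gives the definite
  description in \<open>metric_trace\<close> a value.\<close>

lemma onb_trace_eq:
  assumes "onb e" "onb f" "bilinear b"
  shows "(\<Sum>i\<in>Basis. b (f i) (f i)) = (\<Sum>i\<in>Basis. b (e i) (e i))"
proof -
  have parseval: "(\<Sum>j\<in>Basis. h (f j) (e i) * h (f j) (e k)) = (if i = k then 1 else 0)"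
    if "i \<in> Basis" "k \<in> Basis" for i k
  proof -
    have "h (e i) (e k) = h (\<Sum>j\<in>Basis. h (e i) (f j) *\<^sub>R f j) (e k)"
      using onb_expansion[OF assms(2)] by simp
    also have "\<dots> = (\<Sum>j\<in>Basis. h (f j) (e i) * h (f j) (e k))"
      by (simp add: linear_sum[OF linear_h(2)] h_simps sym_h[of "e i"])
    finally show ?thesis using assms(1) that unfolding onb_def by simp
  qed
  have "(\<Sum>j\<in>Basis. b (f j) (f j)) =
    (\<Sum>j\<in>Basis. \<Sum>i\<in>Basis. \<Sum>k\<in>Basis. (h (f j) (e i) * h (f j) (e k)) *\<^sub>R b (e i) (e k))"
    by (intro sum.cong refl) (metis onb_expansion[OF assms(1)] bilinear_sum_scale[OF assms(3)])
  also have "\<dots> = (\<Sum>i\<in>Basis. \<Sum>j\<in>Basis. \<Sum>k\<in>Basis. (h (f j) (e i) * h (f j) (e k)) *\<^sub>R b (e i) (e k))"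
    by (rule sum.swap)
  also have "\<dots> = (\<Sum>i\<in>Basis. \<Sum>k\<in>Basis. \<Sum>j\<in>Basis. (h (f j) (e i) * h (f j) (e k)) *\<^sub>R b (e i) (e k))"
    by (intro sum.cong refl sum.swap)
  also have "\<dots> = (\<Sum>i\<in>Basis. \<Sum>k\<in>Basis. (if i = k then 1 else 0) *\<^sub>R b (e i) (e k))"
    by (intro sum.cong refl) (simp add: parseval[symmetric] scaleR_sum_left)
  also have "\<dots> = (\<Sum>i\<in>Basis. \<Sum>k\<in>Basis. if i = k then b (e i) (e i) else 0)"
    by (intro sum.cong refl) auto
  also have "\<dots> = (\<Sum>i\<in>Basis. b (e i) (e i))" by simp
  finally show ?thesis .
qed

lemma metric_trace_eq:
  fixes b :: "'e \<Rightarrow> 'e \<Rightarrow> 'f::real_vector"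
  assumes "onb e" "bilinear b"
  shows "metric_trace h b = (\<Sum>i\<in>Basis. b (e i) (e i))"
  unfolding metric_trace_def
proof (rule the_equality)
  show "\<forall>ea :: 'e \<Rightarrow> 'e. (\<forall>i\<in>Basis. \<forall>j\<in>Basis. h (ea i) (ea j) = (if i = j then 1 else 0)) \<longrightarrow>
      (\<Sum>i\<in>Basis. b (e i) (e i)) = (\<Sum>i\<in>Basis. b (ea i) (ea i))"
  proof (intro allI impI)
    fix f :: "'e \<Rightarrow> 'e" assume "\<forall>i\<in>Basis. \<forall>j\<in>Basis. h (f i) (f j) = (if i = j then 1 else 0)"
    then have "onb f" by (simp add: onb_def)
    from onb_trace_eq[OF this assms] show "(\<Sum>i\<in>Basis. b (e i) (e i)) = (\<Sum>i\<in>Basis. b (f i) (f i))" .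
  qed
  show "t = (\<Sum>i\<in>Basis. b (e i) (e i))"
    if "\<forall>ea :: 'e \<Rightarrow> 'e. (\<forall>i\<in>Basis. \<forall>j\<in>Basis. h (ea i) (ea j) = (if i = j then 1 else 0)) \<longrightarrow>
      t = (\<Sum>i\<in>Basis. b (ea i) (ea i))" for t
    using that assms(1) unfolding onb_def by blast
qed

lemma riesz:
  assumes "linear \<phi>"
  shows "\<exists>a. \<forall>y. h a y = \<phi> y"
proof -
  obtain e where e: "onb e" using onb_exists by blast
  have "h (\<Sum>i\<in>Basis. \<phi> (e i) *\<^sub>R e i) y = \<phi> y" for y
  proof -
    have "h (\<Sum>i\<in>Basis. \<phi> (e i) *\<^sub>R e i) y = (\<Sum>i\<in>Basis. h y (e i) * \<phi> (e i))"
      by (simp add: linear_sum[OF linear_h(2)] h_simps sym_h[of y] mult.commute)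
    also have "\<dots> = \<phi> (\<Sum>i\<in>Basis. h y (e i) *\<^sub>R e i)"
      by (simp add: linear_sum[OF assms] linear_scale[OF assms])
    finally show ?thesis using onb_expansion[OF e, of y] by simp
  qed
  then show ?thesis by blast
qed

lemma h_eqI: "(\<And>y. h a y = h b y) \<Longrightarrow> a = b"
  using h_nondegenerate[of "a - b"] by (simp add: h_simps)

text \<open>Diagonal entries that sum to zero are either zero somewhere or take both signs. In the
  latter case the quadratic form changes sign along the segment from \<open>e i\<close> to
  \<open>e j\<close>, and this segment avoids the origin. In dimension one the first case
  applies.\<close>

lemma traceless_null_vector:
  fixes a :: "'e \<Rightarrow> 'e \<Rightarrow> real"
  assumes a: "bilinear a" "\<And>x y. a x y = a y x" and e: "onb e" and tr: "(\<Sum>i\<in>Basis. a (e i) (e i)) = 0"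
  shows "\<exists>x. x \<noteq> 0 \<and> a x x = 0"
proof (cases "\<exists>i\<in>Basis. a (e i) (e i) = 0")
  case True
  then obtain i where "i \<in> Basis" "a (e i) (e i) = 0" by blast
  moreover have "e i \<noteq> 0" using e \<open>i \<in> Basis\<close> unfolding onb_def by (metis bilinear_lzero[OF bil_h] zero_neq_one)
  ultimately show ?thesis by blast
next
  case False
  have "\<exists>i\<in>Basis. a (e i) (e i) < 0"
  proof (rule ccontr)
    assume "\<not> ?thesis"
    then have "\<forall>i\<in>Basis. a (e i) (e i) > 0" using False by force
    then have "(\<Sum>i\<in>Basis. a (e i) (e i)) > 0" by (intro sum_pos) auto
    then show False using tr by simp
  qed
  then obtain i where i: "i \<in> Basis" "a (e i) (e i) < 0" by blast
  have "\<exists>j\<in>Basis. a (e j) (e j) > 0"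
  proof (rule ccontr)
    assume "\<not> ?thesis"
    then have "\<forall>i\<in>Basis. - a (e i) (e i) > 0" using False by force
    then have "(\<Sum>i\<in>Basis. - a (e i) (e i)) > 0" by (intro sum_pos) auto
    then show False using tr by (simp add: sum_negf)
  qed
  then obtain j where j: "j \<in> Basis" "a (e j) (e j) > 0" by blast
  \<comment> \<open>\<open>p t\<close> is the value of the quadratic form at
    \<open>(1 - t) *\<^sub>R e i + t *\<^sub>R e j\<close>, negative at 0 and positive at 1.\<close>
  define p where "p t = (1 - t)\<^sup>2 * a (e i) (e i) + 2 * (t * (1 - t)) * a (e i) (e j) + t\<^sup>2 * a (e j) (e j)" for t
  have "\<exists>t\<ge>0. t \<le> 1 \<and> p t = 0"
    by (rule IVT) (use i j in \<open>auto simp: p_def intro!: continuous_intros\<close>)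
  then obtain t where t: "p t = 0" by blast
  define x where "x = (1 - t) *\<^sub>R e i + t *\<^sub>R e j"
  have "i \<noteq> j" using i j by force
  have "a x x = p t" unfolding x_def p_def
    by (simp add: bilinear_ladd[OF a(1)] bilinear_radd[OF a(1)] bilinear_lmul[OF a(1)]
        bilinear_rmul[OF a(1)] a(2)[of "e j" "e i"] power2_eq_square) (simp add: algebra_simps)
  \<comment> \<open>The two components add up to 1, so \<open>x\<close> cannot vanish.\<close>
  moreover have "h x (e i) = 1 - t" "h x (e j) = t"
    using e i(1) j(1) \<open>i \<noteq> j\<close> unfolding x_def onb_def by (simp_all add: h_simps)
  then have "x \<noteq> 0" using h_simps(5) by (metis diff_zero zero_neq_one)
  ultimately show ?thesis using t by auto
qed

end


subsection \<open>The normal space of a spacelike subspace of codimension two\<close>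

text \<open>The orthogonal complement of a timelike vector is spacelike. All later arguments receive
  the Lorentzian signature in this form; nondegeneracy of the metric is derived from it as
  well.\<close>

lemma lorentz_orthogonal_timelike_pos:
  fixes G :: "'f::euclidean_space \<Rightarrow> 'f \<Rightarrow> real" and e :: "'f \<Rightarrow> 'f" and i0 :: 'f
  assumes bil: "bilinear G" and i0: "i0 \<in> Basis"
    and e: "\<And>i j. i \<in> Basis \<Longrightarrow> j \<in> Basis \<Longrightarrow>
      G (e i) (e j) = (if i \<noteq> j then 0 else if i = i0 then -1 else 1)"
    and u: "G u u < 0" and uv: "G u v = 0" and v: "v \<noteq> 0"
  shows "G v v > 0"
proof -
  define E where "E x = (\<Sum>i\<in>Basis. (x \<bullet> i) *\<^sub>R e i)" for x
  have lin: "linear E" unfolding E_def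
    by (rule linearI) (simp_all add: inner_left_distrib scaleR_left_distrib sum.distrib scaleR_sum_right)
  have GE: "G (E x) (E y) = x \<bullet> y - 2 * (x \<bullet> i0) * (y \<bullet> i0)" for x y
  proof -
    have "G (E x) (E y) = (\<Sum>i\<in>Basis. \<Sum>j\<in>Basis. (x \<bullet> i) * (y \<bullet> j) * G (e i) (e j))"
      unfolding E_def using bilinear_sum_scale[OF bil] by simp
    also have "\<dots> = (\<Sum>i\<in>Basis. \<Sum>j\<in>Basis. if j = i then (x \<bullet> i) * (y \<bullet> i) * (if i = i0 then -1 else 1) else 0)"
      using e by (intro sum.cong refl) auto
    also have "\<dots> = (\<Sum>i\<in>Basis. (x \<bullet> i) * (y \<bullet> i) * (if i = i0 then -1 else 1))" by simp
    also have "\<dots> = (\<Sum>i\<in>Basis. (x \<bullet> i) * (y \<bullet> i) - (if i = i0 then 2 * (x \<bullet> i0) * (y \<bullet> i0) else 0))"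
      by (intro sum.cong refl) auto
    also have "\<dots> = x \<bullet> y - 2 * (x \<bullet> i0) * (y \<bullet> i0)"
      using i0 by (simp add: sum_subtractf euclidean_inner[of x y])
    finally show ?thesis .
  qed
  have "x = 0" if "E x = 0" for x
  proof -
    have 0: "x \<bullet> y - 2 * (x \<bullet> i0) * (y \<bullet> i0) = 0" for y
      using GE[of x y] bilinear_lzero[OF bil] unfolding \<open>E x = 0\<close> by simp
    have "x \<bullet> i0 = 0" using 0[of i0] i0 by simp
    then have "x \<bullet> x = 0" using 0[of x] by simp
    then show ?thesis by simp
  qed
  then have "inj E" using linear_injective_0[OF lin] by blast
  then have "surj E" using linear_injective_imp_surjective[OF lin] by blast
  then obtain x y where xy: "u = E x" "v = E y" by (metis surjD)
  \<comment> \<open>Spatial parts: in the coordinates given by \<open>E\<close>, the form is the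
    Euclidean product of spatial parts minus the product of the \<open>i0\<close>
    components.\<close>
  define x' y' where "x' = x - (x \<bullet> i0) *\<^sub>R i0" and "y' = y - (y \<bullet> i0) *\<^sub>R i0"
  have split: "x \<bullet> x = x' \<bullet> x' + (x \<bullet> i0)\<^sup>2" "y \<bullet> y = y' \<bullet> y' + (y \<bullet> i0)\<^sup>2"
    "x \<bullet> y = x' \<bullet> y' + (x \<bullet> i0) * (y \<bullet> i0)"
    unfolding x'_def y'_def using i0
    by (simp_all add: inner_diff_left inner_diff_right power2_eq_square inner_commute[of i0 x] inner_commute[of i0 y])
  have 1: "x' \<bullet> x' < (x \<bullet> i0)\<^sup>2" using u GE[of x x] unfolding xy split by (simp add: power2_eq_square)
  have 2: "x' \<bullet> y' = (x \<bullet> i0) * (y \<bullet> i0)" using uv GE[of x y] unfolding xy split by simp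
  show ?thesis
  proof (rule ccontr)
    assume "\<not> ?thesis"
    then have 3: "y' \<bullet> y' \<le> (y \<bullet> i0)\<^sup>2" using GE[of y y] unfolding xy split by (simp add: power2_eq_square)
    \<comment> \<open>Cauchy-Schwarz for the spatial parts. As the spatial part of \<open>x\<close>
      is strictly shorter than its time component, the time component of \<open>y\<close> must be 0,
      and then \<open>3\<close> makes its spatial part 0 too.\<close>
    have "((x \<bullet> i0) * (y \<bullet> i0))\<^sup>2 \<le> (x' \<bullet> x') * (y' \<bullet> y')"
      using Cauchy_Schwarz_ineq[of x' y'] unfolding 2 .
    also have "\<dots> \<le> (x' \<bullet> x') * (y \<bullet> i0)\<^sup>2" using 3 by (intro mult_left_mono) auto
    finally have "(x \<bullet> i0)\<^sup>2 * (y \<bullet> i0)\<^sup>2 \<le> (x' \<bullet> x') * (y \<bullet> i0)\<^sup>2" by (simp add: power_mult_distrib)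
    then have "y \<bullet> i0 = 0" using 1 by (metis mult_le_cancel_right_pos not_le zero_less_power2)
    then have "y' \<bullet> y' = 0" using 3 inner_ge_zero[of y'] by simp
    then have "y' = 0" by simp
    then have "y = 0" using \<open>y \<bullet> i0 = 0\<close> by (simp add: y'_def)
    then show False using v xy linear_0[OF lin] by simp
  qed
qed

text \<open>The linear algebra at a single point: \<open>D\<close> stands for the differential of
  the immersion and \<open>T\<close> for the time orientation there. The signature is represented by
  \<open>orth_pos\<close>.\<close>

locale spacelike_subspace =
  fixes G :: "'f::euclidean_space \<Rightarrow> 'f \<Rightarrow> real" and D :: "'e::euclidean_space \<Rightarrow> 'f" and T :: 'f
  assumes bil_G: "bilinear G" and sym_G: "G u v = G v u"
    and orth_pos: "G u u < 0 \<Longrightarrow> G u v = 0 \<Longrightarrow> v \<noteq> 0 \<Longrightarrow> G v v > 0"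
    and timelike_T: "G T T < 0"
    and lin_D: "linear D" and pos_D: "x \<noteq> 0 \<Longrightarrow> G (D x) (D x) > 0"
    and codim: "DIM('f) = DIM('e) + 2"
begin

lemmas G_simps = bilinear_ladd[OF bil_G] bilinear_radd[OF bil_G] bilinear_lmul[OF bil_G]
  bilinear_rmul[OF bil_G] bilinear_lzero[OF bil_G] bilinear_rzero[OF bil_G]
  bilinear_lsub[OF bil_G] bilinear_rsub[OF bil_G] bilinear_lneg[OF bil_G] bilinear_rneg[OF bil_G]

lemma bilinear_pullback: "bilinear (\<lambda>x y. G (D x) (D y))"
  unfolding bilinear_def
  by (auto intro!: linearI simp: linear_add[OF lin_D] linear_scale[OF lin_D] G_simps)

sublocale inner_form "\<lambda>x y. G (D x) (D y)"
  by unfold_locales (auto simp: bilinear_pullback sym_G pos_D)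

abbreviation h :: "'e \<Rightarrow> 'e \<Rightarrow> real" where "h x y \<equiv> G (D x) (D y)"

definition normal :: "'f set" where "normal = {v. \<forall>x. G v (D x) = 0}"

lemma subspace_normal: "subspace normal"
  unfolding normal_def subspace_def by (auto simp: G_simps)

lemma normal_simps [simp]: "v \<in> normal \<Longrightarrow> G v (D x) = 0" "v \<in> normal \<Longrightarrow> G (D x) v = 0"
  using sym_G[of v "D x"] by (auto simp: normal_def)

lemma D_eq_0: "D x \<in> normal \<Longrightarrow> x = 0"
  using pos_D[of x] by force

text \<open>The tangential part is the Riesz representative, for the positive definite induced form,
  of pairing \<open>v\<close> with tangent vectors.\<close>

lemma normal_projection: "\<exists>a. v - D a \<in> normal"
proof -
  have "linear (\<lambda>y. G v (D y))"
    by (rule linearI) (simp_all add: linear_add[OF lin_D] linear_scale[OF lin_D] G_simps)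
  then obtain a where "\<And>y. h a y = G v (D y)" using riesz by blast
  then have "v - D a \<in> normal" unfolding normal_def by (simp add: G_simps)
  then show ?thesis by blast
qed

lemma normal_projection_unique:
  assumes "w \<in> normal" "w' \<in> normal" "v - w \<in> range D" "v - w' \<in> range D"
  shows "w = w'"
proof -
  obtain a b where ab: "v - w = D a" "v - w' = D b" using assms by blast
  have "w - w' = D (b - a)" using ab by (simp add: linear_diff[OF lin_D] algebra_simps)
  moreover have "w - w' \<in> normal" using assms(1,2) subspace_normal by (rule subspace_diff[rotated])
  ultimately have "b - a = 0" using D_eq_0[of "b - a"] by simp
  then show ?thesis using \<open>w - w' = D (b - a)\<close> linear_0[OF lin_D] by simp
qed

text \<open>\<open>u\<close> is the normalized normal part of \<open>T\<close>; \<open>s\<close> is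
  a unit normal vector orthogonal to \<open>u\<close>, supplied by the codimension. The minus sign
  in the expansion reflects \<open>G u u = -1\<close>.\<close>

lemma normal_frame:
  "\<exists>u s. u \<in> normal \<and> s \<in> normal \<and> G u u = -1 \<and> G s s = 1 \<and> G u s = 0 \<and>
     (\<forall>w\<in>normal. w = G w s *\<^sub>R s - G w u *\<^sub>R u)"
proof -
  obtain a where a: "T - D a \<in> normal" using normal_projection by blast
  define u0 where "u0 = T - D a"
  have T: "T = u0 + D a" by (simp add: u0_def)
  \<comment> \<open>The tangential part of \<open>T\<close> has nonnegative square, so removing it
    leaves a vector that is still timelike.\<close>
  have "G T T = G u0 u0 + G (D a) (D a)" using a unfolding T u0_def[symmetric] by (simp add: G_simps)
  moreover have "G (D a) (D a) \<ge> 0" using pos_D[of a] by (cases "a = 0") (auto simp: linear_0[OF lin_D] G_simps)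
  ultimately have u0: "G u0 u0 < 0" using timelike_T by simp
  define u where "u = (1 / sqrt (- G u0 u0)) *\<^sub>R u0"
  have uN: "u \<in> normal" using a subspace_normal unfolding u_def u0_def[symmetric] by (simp add: subspace_scale)
  have uu: "G u u = -1"
    using u0 unfolding u_def by (simp add: G_simps field_simps)
  have "dim (range D) \<le> DIM('e)" using dim_image_le[OF lin_D, of UNIV] by simp
  then have dD: "dim (insert v (range D)) \<le> DIM('e) + 1" for v by (simp add: dim_insert)
  \<comment> \<open>In codimension two, the tangent space together with \<open>u\<close> is not
    everything; a vector outside, made normal and orthogonal to \<open>u\<close>, gives the second
    frame vector.\<close>
  have "dim (insert u (range D)) < DIM('f)" using dD[of u] codim by linarith
  then have "span (insert u (range D)) \<noteq> UNIV" using dim_eq_full[of "insert u (range D)"] by auto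
  then obtain v where v: "v \<notin> span (insert u (range D))" by blast
  obtain b where b: "v - D b \<in> normal" using normal_projection by blast
  define s0 where "s0 = (v - D b) + G (v - D b) u *\<^sub>R u"
  have s0N: "s0 \<in> normal" unfolding s0_def using b uN subspace_normal
    by (simp add: subspace_add subspace_scale)
  have "G u s0 = G u (v - D b) + G (v - D b) u * G u u"
    unfolding s0_def bilinear_radd[OF bil_G] bilinear_rmul[OF bil_G] by simp
  then have us0: "G u s0 = 0" unfolding uu sym_G[of u "v - D b"] by simp
  have "s0 \<noteq> 0"
  proof
    assume "s0 = 0"
    then have "v = D b - G (v - D b) u *\<^sub>R u" unfolding s0_def
      by (metis add.commute add_diff_cancel_left' diff_add_eq diff_diff_eq2 diff_0_right)
    also have "\<dots> \<in> span (insert u (range D))" by (intro span_diff span_scale span_base) auto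
    finally show False using v by blast
  qed
  then have ss0: "G s0 s0 > 0" using orth_pos[of u s0] uu us0 by simp
  define s where "s = (1 / sqrt (G s0 s0)) *\<^sub>R s0"
  have sN: "s \<in> normal" using s0N subspace_normal unfolding s_def by (simp add: subspace_scale)
  have ss: "G s s = 1" using ss0 unfolding s_def by (simp add: G_simps)
  have us: "G u s = 0" using us0 unfolding s_def by (simp add: G_simps)
  have "w = G w s *\<^sub>R s - G w u *\<^sub>R u" if "w \<in> normal" for w
  proof -
    define w' where "w' = w - (G w s *\<^sub>R s - G w u *\<^sub>R u)"
    have w'N: "w' \<in> normal" unfolding w'_def using that uN sN subspace_normal
      by (simp add: subspace_diff subspace_scale)
    have w'u: "G w' u = 0" and w's: "G w' s = 0"
      unfolding w'_def using uu ss us sym_G[of s u] by (simp_all add: G_simps)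
    \<comment> \<open>By dimension the tangent space, \<open>u\<close> and \<open>s\<close> span the
      whole space, so \<open>w'\<close> is orthogonal to everything, itself included. A nonzero
      \<open>w'\<close> would however have positive square, being orthogonal to the timelike
      \<open>u\<close>.\<close>
    have "w' = 0"
    proof (rule ccontr)
      assume "w' \<noteq> 0"
      then have "G w' w' > 0" using orth_pos[of u w'] uu w'u sym_G[of u w'] by simp
      have ind_u: "u \<notin> span (range D)"
      proof
        assume "u \<in> span (range D)"
        moreover have "span (range D) = range D"
          using linear_subspace_image[OF lin_D subspace_UNIV] by (simp only: span_eq_iff)
        ultimately have "u \<in> range D" by simp
        then show False using D_eq_0 uN uu linear_0[OF lin_D] by (auto simp: G_simps)
      qed
      have "inj D" using D_eq_0 linear_injective_0[OF lin_D] subspace_0[OF subspace_normal] by metis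
      then have "dim (range D) = DIM('e)" using dim_image_eq[OF lin_D, of UNIV] by simp
      then have d1: "dim (insert u (range D)) = DIM('e) + 1" using ind_u by (simp add: dim_insert)
      have s_notin: "s \<notin> span (insert u (range D))"
      proof
        assume "s \<in> span (insert u (range D))"
        moreover have "subspace {z. G s z = 0}" unfolding subspace_def by (auto simp: G_simps)
        moreover have "insert u (range D) \<subseteq> {z. G s z = 0}" using us sN sym_G[of s u] by auto
        ultimately have "G s s = 0" using span_minimal by blast
        then show False using ss by simp
      qed
      have d2: "dim (insert s (insert u (range D))) = DIM('f)"
        using d1 s_notin codim by (simp add: dim_insert)
      then have "span (insert s (insert u (range D))) = UNIV" using dim_eq_full by blast
      moreover have "subspace {z. G w' z = 0}" unfolding subspace_def by (auto simp: G_simps)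
      moreover have "insert s (insert u (range D)) \<subseteq> {z. G w' z = 0}" using w'u w's w'N by auto
      ultimately have "G w' w' = 0" using span_minimal by blast
      then show False using \<open>G w' w' > 0\<close> by simp
    qed
    then show ?thesis by (simp add: w'_def)
  qed
  then show ?thesis using uN sN uu ss us by blast
qed

end


section \<open>The null line singled out by an isotropic shear\<close>

context spacelike_subspace
begin

lemma null_direction_of_isotropic_shear:
  fixes II S :: "'e \<Rightarrow> 'e \<Rightarrow> 'f"
  assumes bil: "bilinear II" and sym: "\<And>x y. II x y = II y x" and norm: "\<And>x y. II x y \<in> normal"
    and S: "\<And>x y. S x y = II x y - h x y *\<^sub>R ((1 / real DIM('e)) *\<^sub>R metric_trace h II)"
    and iso: "\<And>x y. h x x = 1 \<Longrightarrow> h y y = 1 \<Longrightarrow> G (S x x) (S x x) = G (S y y) (S y y)"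
  shows "\<exists>l\<in>normal. G l l = 0 \<and> l \<noteq> 0 \<and> (\<forall>x. \<exists>c. S x x = c *\<^sub>R l) \<and>
    (\<forall>\<zeta>\<in>normal. G \<zeta> l = 0 \<longrightarrow> (\<exists>c. \<zeta> = c *\<^sub>R l))"
proof -
  obtain e where e: "onb e" using onb_exists by blast
  define H where "H = (1 / real DIM('e)) *\<^sub>R metric_trace h II"
  have tr: "metric_trace h II = (\<Sum>i\<in>Basis. II (e i) (e i))" by (rule metric_trace_eq[OF e bil])
  have SN: "S x y \<in> normal" for x y
    unfolding S tr using norm subspace_normal
    by (intro subspace_diff subspace_scale subspace_sum) auto
  have bilS: "bilinear S"
    unfolding bilinear_def S H_def[symmetric]
    by (auto intro!: linearI simp: bilinear_ladd[OF bil] bilinear_radd[OF bil] bilinear_lmul[OF bil]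
        bilinear_rmul[OF bil] h_simps algebra_simps)
  have symS: "S x y = S y x" for x y unfolding S by (simp add: sym[of x y] sym_h[of x y])
  have trS: "(\<Sum>i\<in>Basis. S (e i) (e i)) = 0"
  proof -
    have "(\<Sum>i\<in>Basis. S (e i) (e i)) = (\<Sum>i\<in>Basis. II (e i) (e i)) - (\<Sum>i\<in>Basis. h (e i) (e i)) *\<^sub>R H"
      unfolding S H_def[symmetric] by (simp add: sum_subtractf scaleR_sum_left)
    also have "(\<Sum>i\<in>Basis. h (e i) (e i)) = (\<Sum>i\<in>(Basis :: 'e set). 1)"
      using e unfolding onb_def by (intro sum.cong) auto
    finally show ?thesis by (simp add: H_def tr)
  qed
  obtain u s where uN: "u \<in> normal" and sN: "s \<in> normal" and uu: "G u u = -1" and ss: "G s s = 1"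
    and us: "G u s = 0" and frame: "\<And>w. w \<in> normal \<Longrightarrow> w = G w s *\<^sub>R s - G w u *\<^sub>R u"
    using normal_frame by blast
  have su: "G s u = 0" using us sym_G[of s u] by simp
  have sq: "G w w = (G w s + G w u) * (G w s - G w u)" if "w \<in> normal" for w
  proof -
    have "G w w = G w (G w s *\<^sub>R s - G w u *\<^sub>R u)" using frame[OF that] by simp
    then show ?thesis by (simp add: G_simps algebra_simps)
  qed
  \<comment> \<open>The factors in \<open>sq\<close> are the pairings with the null vectors
    \<open>s + u\<close> and \<open>s - u\<close>. Thus \<open>a x x * b x x\<close> is the square
    of \<open>S x x\<close>, and isotropy becomes a condition on a product of two quadratic
    forms.\<close>
  define a where "a x y = G (S x y) s + G (S x y) u" for x y
  define b where "b x y = G (S x y) s - G (S x y) u" for x y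
  have a: "bilinear a" "a x y = a y x" and b: "bilinear b" "b x y = b y x" for x y
    unfolding bilinear_def a_def b_def
    by (auto intro!: linearI simp: bilinear_ladd[OF bilS] bilinear_radd[OF bilS] bilinear_lmul[OF bilS]
        bilinear_rmul[OF bilS] G_simps algebra_simps symS[of x y])
  have tra: "(\<Sum>i\<in>Basis. a (e i) (e i)) = 0"
  proof -
    have lin: "linear (\<lambda>w. G w s + G w u)" by (rule linearI) (simp_all add: G_simps algebra_simps)
    show ?thesis unfolding a_def using linear_sum[OF lin, of "\<lambda>i. S (e i) (e i)" Basis] trS
      by (simp add: G_simps)
  qed
  obtain i :: 'e where "i \<in> Basis" using nonempty_Basis by blast
  then have ei: "h (e i) (e i) = 1" using e unfolding onb_def by simp
  define c where "c = a (e i) (e i) * b (e i) (e i)"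
  have prod: "a x x * b x x = c * (h x x)\<^sup>2" for x
  proof (cases "x = 0")
    case True
    then show ?thesis using bilinear_lzero[OF a(1)] h_simps(5) by simp
  next
    case False
    then have hx: "h x x > 0" by (rule pos_h)
    define y where "y = (1 / sqrt (h x x)) *\<^sub>R x"
    have x: "x = sqrt (h x x) *\<^sub>R y" using hx by (simp add: y_def)
    have "h y y = 1" unfolding y_def using hx by (simp add: bilinear_lmul[OF bil_h] bilinear_rmul[OF bil_h])
    then have "a y y * b y y = c"
      using iso[OF _ ei, of y] sq[OF SN] unfolding c_def a_def b_def by simp
    moreover have "a x x = h x x * a y y" "b x x = h x x * b y y"
      using hx bilinear_lmul[OF a(1)] bilinear_rmul[OF a(1)] bilinear_lmul[OF b(1)] bilinear_rmul[OF b(1)]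
      by (subst (1 2) x, simp)+
    ultimately show ?thesis by (simp add: power2_eq_square)
  qed
  obtain x0 where "x0 \<noteq> 0" "a x0 x0 = 0" using traceless_null_vector[OF a e tra] by blast
  then have "c = 0" using prod[of x0] pos_h[of x0] by simp
  then have "a x x * b x x = 0" for x using prod[of x] by simp
  then have disj: "(\<forall>x. a x x = 0) \<or> (\<forall>x. b x x = 0)"
    by (rule quadratic_form_product_zero[OF a b])
  \<comment> \<open>The sign \<open>k\<close> records which of the two forms vanishes. It thereby
    decides which null vector, \<open>s + u\<close> or \<open>s - u\<close>, spans the values
    \<open>S x x\<close>.\<close>
  have "\<exists>k::real. k * k = 1 \<and> (\<forall>x. G (S x x) u = - k * G (S x x) s)"
  proof (cases "\<forall>x. a x x = 0")
    case True
    then have "G (S x x) u = - 1 * G (S x x) s" for x unfolding a_def by (simp add: add_eq_0_iff)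
    then show ?thesis by (intro exI[of _ 1]) auto
  next
    case False
    then have "b x x = 0" for x using disj by blast
    then have "G (S x x) u = - (-1) * G (S x x) s" for x unfolding b_def by simp
    then show ?thesis by (intro exI[of _ "-1"]) auto
  qed
  then obtain k :: real where kk: "k * k = 1" and k: "\<And>x. G (S x x) u = - k * G (S x x) s" by blast
  define l where "l = s + k *\<^sub>R u"
  have "l \<in> normal" unfolding l_def using uN sN subspace_normal by (simp add: subspace_add subspace_scale)
  moreover have "G l l = 0" unfolding l_def using uu ss us su kk by (simp add: G_simps)
  moreover have "G l s = 1" unfolding l_def using ss us by (simp add: G_simps)
  then have "l \<noteq> 0" using bilinear_lzero[OF bil_G] by auto
  moreover have "S x x = G (S x x) s *\<^sub>R l" for x
    using frame[OF SN[of x x]] unfolding l_def k by (simp add: algebra_simps)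
  \<comment> \<open>In a Lorentzian plane a null line is its own orthogonal complement.\<close>
  moreover have "\<zeta> = G \<zeta> s *\<^sub>R l" if "\<zeta> \<in> normal" "G \<zeta> l = 0" for \<zeta>
  proof -
    have "G \<zeta> s + k * G \<zeta> u = 0" using that(2) unfolding l_def by (simp add: G_simps)
    then have "k * (k * G \<zeta> u) = - k * G \<zeta> s" by (simp add: add_eq_0_iff)
    then have "G \<zeta> u = - k * G \<zeta> s" using kk by (simp add: mult.assoc[symmetric])
    then show ?thesis using frame[OF that(1)] unfolding l_def by (simp add: algebra_simps)
  qed
  ultimately show ?thesis by blast
qed

text \<open>The pointwise result in the form needed for globalization: the null vector is fixed by
  its product with \<open>T\<close>, and its line is detected by differences built from
  \<open>h\<close> and \<open>II\<close> alone.\<close>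

lemma normalized_null_direction:
  fixes II :: "'e \<Rightarrow> 'e \<Rightarrow> 'f"
  assumes bil: "bilinear II" and sym: "\<And>x y. II x y = II y x" and norm: "\<And>x y. II x y \<in> normal"
    and S: "\<And>x y. S x y = II x y - h x y *\<^sub>R ((1 / real DIM('e)) *\<^sub>R metric_trace h II)"
    and iso: "\<And>x y. h x x = 1 \<Longrightarrow> h y y = 1 \<Longrightarrow> G (S x x) (S x x) = G (S y y) (S y y)"
    and nonumb: "\<not> (\<exists>\<zeta>\<in>normal. \<forall>x y. II x y = h x y *\<^sub>R \<zeta>)"
  obtains l \<rho> where "l \<in> normal" "G l l = 0" "G T l = -1"
    "\<And>x y. \<exists>c. h y y *\<^sub>R II x x - h x x *\<^sub>R II y y = c *\<^sub>R l"
    "\<exists>x y. h y y *\<^sub>R II x x - h x x *\<^sub>R II y y \<noteq> 0"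
    "\<And>x y. G (II x y) l = \<rho> * h x y"
    "\<And>\<zeta>. \<zeta> \<in> normal \<Longrightarrow> G \<zeta> l = 0 \<Longrightarrow> \<exists>c. \<zeta> = c *\<^sub>R l"
proof -
  obtain l0 where l0: "l0 \<in> normal" "G l0 l0 = 0" "l0 \<noteq> 0" "\<And>x. \<exists>c. S x x = c *\<^sub>R l0"
    "\<And>\<zeta>. \<zeta> \<in> normal \<Longrightarrow> G \<zeta> l0 = 0 \<Longrightarrow> \<exists>c. \<zeta> = c *\<^sub>R l0"
    using null_direction_of_isotropic_shear[OF bil sym norm S iso] by blast
  \<comment> \<open>A nonzero vector orthogonal to the timelike \<open>T\<close> would be spacelike,
    not null.\<close>
  have Tl0: "G T l0 \<noteq> 0" using orth_pos[OF timelike_T, of l0] l0(2,3) by auto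
  define l where "l = (- 1 / G T l0) *\<^sub>R l0"
  have l0_l: "l0 = (- G T l0) *\<^sub>R l" using Tl0 by (simp add: l_def)
  have lN: "l \<in> normal" unfolding l_def by (rule subspace_scale[OF subspace_normal l0(1)])
  have ll: "G l l = 0" using l0(2) by (simp add: l_def G_simps)
  have Tl: "G T l = -1" using Tl0 by (simp add: l_def G_simps)
  have span: "\<exists>c. h y y *\<^sub>R II x x - h x x *\<^sub>R II y y = c *\<^sub>R l" for x y
  proof -
    obtain c d where c: "S x x = c *\<^sub>R l0" and d: "S y y = d *\<^sub>R l0" using l0(4) by meson
    \<comment> \<open>Passing from \<open>II\<close> to the shear subtracts
      \<open>(h y y * h x x)\<close> times the mean curvature from both terms, and these
      contributions cancel.\<close>
    have "h y y *\<^sub>R II x x - h x x *\<^sub>R II y y = h y y *\<^sub>R S x x - h x x *\<^sub>R S y y"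
      unfolding S by (simp add: algebra_simps)
    also have "\<dots> = (h y y * c - h x x * d) *\<^sub>R l0" unfolding c d by (simp add: algebra_simps)
    also have "\<dots> = ((h y y * c - h x x * d) * (- G T l0)) *\<^sub>R l" by (subst l0_l) simp
    finally show ?thesis by blast
  qed
  obtain e where e: "onb e" using onb_exists by blast
  obtain i :: 'e where "i \<in> Basis" using nonempty_Basis by blast
  then have ei: "h (e i) (e i) = 1" using e unfolding onb_def by simp
  \<comment> \<open>If all differences vanished, comparison with the unit vector \<open>e i\<close>
    would give \<open>II x x\<close> as a multiple of \<open>II (e i) (e i)\<close>. Polarization
    then makes the point umbilical.\<close>
  have nonzero: "\<exists>x y. h y y *\<^sub>R II x x - h x x *\<^sub>R II y y \<noteq> 0"
  proof (rule ccontr)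
    assume "\<not> ?thesis"
    then have diag: "II x x = h x x *\<^sub>R II (e i) (e i)" for x
      using ei by (metis right_minus_eq scaleR_one)
    have bc: "bilinear (\<lambda>x y. h x y *\<^sub>R II (e i) (e i))"
      unfolding bilinear_def by (auto intro!: linearI simp: h_simps algebra_simps)
    have "II x y = h x y *\<^sub>R II (e i) (e i)" for x y
      by (rule symmetric_bilinear_eqI[OF bil sym bc]) (metis sym_h, rule diag)
    then show False using nonumb norm by blast
  qed
  define \<rho> where "\<rho> = G (II (e i) (e i)) l"
  have bil1: "bilinear (\<lambda>x y. G (II x y) l)" and bil2: "bilinear (\<lambda>x y. \<rho> * h x y)"
    unfolding bilinear_def
    by (auto intro!: linearI simp: bilinear_ladd[OF bil] bilinear_radd[OF bil] bilinear_lmul[OF bil]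
        bilinear_rmul[OF bil] h_simps G_simps algebra_simps)
  \<comment> \<open>Up to the factor \<open>h x x\<close>, \<open>II x x\<close> differs from
    \<open>II (e i) (e i)\<close> by a multiple of \<open>l\<close>, and \<open>l\<close> is
    orthogonal to itself.\<close>
  have diag: "G (II x x) l = \<rho> * h x x" for x
  proof -
    obtain c where "h (e i) (e i) *\<^sub>R II x x - h x x *\<^sub>R II (e i) (e i) = c *\<^sub>R l" using span by blast
    then have "G (II x x - h x x *\<^sub>R II (e i) (e i)) l = G (c *\<^sub>R l) l" using ei by simp
    then show ?thesis using ll by (simp add: G_simps \<rho>_def)
  qed
  have umb: "G (II x y) l = \<rho> * h x y" for x y
    by (rule symmetric_bilinear_eqI[OF bil1 _ bil2]) (metis sym, metis sym_h, rule diag)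
  have perp: "\<exists>c. \<zeta> = c *\<^sub>R l" if "\<zeta> \<in> normal" "G \<zeta> l = 0" for \<zeta>
  proof -
    have "G \<zeta> l0 = 0" using that(2) by (subst l0_l) (simp add: G_simps)
    then obtain c where "\<zeta> = c *\<^sub>R l0" using l0(5) \<open>\<zeta> \<in> normal\<close> by blast
    then have "\<zeta> = (c * (- G T l0)) *\<^sub>R l" by (subst (asm) l0_l) simp
    then show ?thesis by blast
  qed
  show ?thesis using that[OF lN ll Tl span nonzero umb perp] .
qed

end


subsection \<open>Smooth maps and their second derivatives\<close>

lemma smooth_on_cong:
  "open S \<Longrightarrow> (\<And>x. x \<in> S \<Longrightarrow> f x = g x) \<Longrightarrow> smooth_on S f \<longleftrightarrow> smooth_on S g"
  unfolding smooth_on_def using Ck_on_cong by blast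

lemma smooth_on_local:
  assumes "\<And>x. x \<in> S \<Longrightarrow> \<exists>U. open U \<and> x \<in> U \<and> smooth_on U f"
  shows "smooth_on S f"
  unfolding smooth_on_def
proof
  fix k show "Ck_on k S f"
    by (rule Ck_on_local) (use assms in \<open>force simp: smooth_on_def\<close>)
qed

lemma smooth_on_subset: "smooth_on S f \<Longrightarrow> S' \<subseteq> S \<Longrightarrow> smooth_on S' f"
  unfolding smooth_on_def using Ck_on_subset by blast

lemma smooth_on_const: "smooth_on S (\<lambda>x. c)"
  by (simp add: smooth_on_def)

lemma smooth_on_bounded_linear:
  "bounded_linear L \<Longrightarrow> open S \<Longrightarrow> smooth_on S f \<Longrightarrow> smooth_on S (\<lambda>x. L (f x))"
  by (simp add: smooth_on_def Ck_on_bounded_linear)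

lemma smooth_on_add: "open S \<Longrightarrow> smooth_on S f \<Longrightarrow> smooth_on S g \<Longrightarrow> smooth_on S (\<lambda>x. f x + g x)"
  by (simp add: smooth_on_def Ck_on_add)

lemma smooth_on_diff: "open S \<Longrightarrow> smooth_on S f \<Longrightarrow> smooth_on S g \<Longrightarrow> smooth_on S (\<lambda>x. f x - g x)"
  by (simp add: smooth_on_def Ck_on_diff)

lemma smooth_on_scaleR: "open S \<Longrightarrow> smooth_on S f \<Longrightarrow> smooth_on S g \<Longrightarrow> smooth_on S (\<lambda>x. f x *\<^sub>R g x)"
  by (simp add: smooth_on_def Ck_on_scaleR)

lemma smooth_on_mult:
  fixes f g :: "'a::euclidean_space \<Rightarrow> real"
  shows "open S \<Longrightarrow> smooth_on S f \<Longrightarrow> smooth_on S g \<Longrightarrow> smooth_on S (\<lambda>x. f x * g x)"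
  using smooth_on_scaleR[of S f g] by simp

lemma smooth_on_sum:
  "open S \<Longrightarrow> (\<And>i. i \<in> I \<Longrightarrow> smooth_on S (f i)) \<Longrightarrow> smooth_on S (\<lambda>x. \<Sum>i\<in>I. f i x)"
  by (simp add: smooth_on_def Ck_on_sum)

lemma smooth_on_compose:
  fixes f :: "'a::euclidean_space \<Rightarrow> 'b::euclidean_space"
  shows "open S \<Longrightarrow> open U \<Longrightarrow> smooth_on S f \<Longrightarrow> smooth_on U g \<Longrightarrow> f ` S \<subseteq> U \<Longrightarrow>
    smooth_on S (\<lambda>x. g (f x))"
  unfolding smooth_on_def using Ck_on_compose by blast

lemma smooth_on_inverse:
  fixes f :: "'a::euclidean_space \<Rightarrow> real"
  shows "open S \<Longrightarrow> smooth_on S f \<Longrightarrow> (\<And>x. x \<in> S \<Longrightarrow> f x \<noteq> 0) \<Longrightarrow> smooth_on S (\<lambda>x. inverse (f x))"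
  by (simp add: smooth_on_def Ck_on_inverse)

lemma smooth_on_frechet_derivative:
  "smooth_on S f \<Longrightarrow> smooth_on S (\<lambda>x. frechet_derivative f (at x) v)"
  unfolding smooth_on_def using Ck_on.simps(2) by blast

lemma smooth_on_imp_has_derivative:
  "smooth_on S f \<Longrightarrow> x \<in> S \<Longrightarrow> (f has_derivative frechet_derivative f (at x)) (at x)"
  unfolding smooth_on_def using Ck_on_Suc_has_derivative by blast

lemma smooth_on_imp_continuous_on: "smooth_on S f \<Longrightarrow> continuous_on S f"
  unfolding smooth_on_def using Ck_on_imp_continuous_on by blast

lemma smooth_on_linear_derivative:
  "smooth_on S f \<Longrightarrow> x \<in> S \<Longrightarrow> linear (frechet_derivative f (at x))"
  using smooth_on_imp_has_derivative has_derivative_linear by blast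

text \<open>Smoothness for constant arguments extends to smoothly varying ones, since linearity
  permits expansion in \<open>Basis\<close>.\<close>

lemma smooth_on_linear_family:
  fixes u :: "'a::euclidean_space \<Rightarrow> 'v::euclidean_space"
  assumes "open S" "\<And>x. x \<in> S \<Longrightarrow> linear (L x)" "\<And>v. smooth_on S (\<lambda>x. L x v)" "smooth_on S u"
  shows "smooth_on S (\<lambda>x. L x (u x))"
proof -
  have "smooth_on S (\<lambda>x. \<Sum>i\<in>Basis. (u x \<bullet> i) *\<^sub>R L x i)"
    by (intro smooth_on_sum smooth_on_scaleR assms smooth_on_bounded_linear[OF bounded_linear_inner_left])
  moreover have "L x (u x) = (\<Sum>i\<in>Basis. (u x \<bullet> i) *\<^sub>R L x i)" if "x \<in> S" for x
    by (rule linear_eq_sum_Basis[OF assms(2)[OF that]])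
  ultimately show ?thesis by (subst smooth_on_cong[OF assms(1)])
qed

lemma smooth_on_bilinear_family:
  fixes u :: "'a::euclidean_space \<Rightarrow> 'v::euclidean_space" and v :: "'a::euclidean_space \<Rightarrow> 'w::euclidean_space"
  assumes "open S" "\<And>x. x \<in> S \<Longrightarrow> bilinear (b x)" "\<And>u v. smooth_on S (\<lambda>x. b x u v)"
    "smooth_on S u" "smooth_on S v"
  shows "smooth_on S (\<lambda>x. b x (u x) (v x))"
proof (rule smooth_on_linear_family[OF assms(1) _ _ assms(5)])
  show "linear (b x (u x))" if "x \<in> S" for x using assms(2)[OF that] by (simp add: bilinear_def)
  show "smooth_on S (\<lambda>x. b x (u x) w)" for w
    by (rule smooth_on_linear_family[OF assms(1) _ _ assms(4)])
      (use assms(2,3) in \<open>auto simp: bilinear_def\<close>)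
qed

text \<open>Serves for vectors known only through a linear equation: the Christoffel symbols and the
  tangential coefficients in charts.\<close>

lemma smooth_on_nondegenerate_solution:
  fixes G :: "'a::euclidean_space \<Rightarrow> 'v::euclidean_space \<Rightarrow> 'v \<Rightarrow> real"
  assumes "open S" "\<And>x. x \<in> S \<Longrightarrow> bilinear (G x)"
    "\<And>x u. x \<in> S \<Longrightarrow> (\<And>v. G x u v = 0) \<Longrightarrow> u = 0"
    "\<And>u v. smooth_on S (\<lambda>x. G x u v)" "\<And>v. smooth_on S (\<lambda>x. b x v)"
    "\<And>x v. x \<in> S \<Longrightarrow> G x (s x) v = b x v"
  shows "smooth_on S s"
  unfolding smooth_on_def
proof
  fix k
  show "Ck_on k S s"
    by (rule Ck_on_nondegenerate_solution[OF assms(1-3) _ _ assms(6)])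
      (use assms(4,5) in \<open>auto simp: smooth_on_def\<close>)
qed

definition second_derivative ::
  "('a::euclidean_space \<Rightarrow> 'b::euclidean_space) \<Rightarrow> 'a \<Rightarrow> 'a \<Rightarrow> 'a \<Rightarrow> 'b" where
  "second_derivative f x u v = frechet_derivative (\<lambda>y. frechet_derivative f (at y) v) (at x) u"

context
  fixes S :: "'a::euclidean_space set" and f :: "'a \<Rightarrow> 'b::euclidean_space"
  assumes S: "open S" and f: "smooth_on S f"
begin

lemma second_derivative_commute':
  "x \<in> S \<Longrightarrow> second_derivative f x u v = second_derivative f x v u"
  unfolding second_derivative_def
  using second_derivative_commute[OF S, of f x] f smooth_on_def by blast

lemma has_second_derivative:
  "x \<in> S \<Longrightarrow> ((\<lambda>y. frechet_derivative f (at y) v) has_derivative (\<lambda>u. second_derivative f x u v)) (at x)"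
  unfolding second_derivative_def
  using smooth_on_imp_has_derivative[OF smooth_on_frechet_derivative[OF f]] .

text \<open>Linearity in the outer direction is that of a derivative; symmetry transfers it to the
  inner direction.\<close>

lemma bilinear_second_derivative:
  assumes "x \<in> S" shows "bilinear (second_derivative f x)"
proof -
  have l: "linear (\<lambda>u. second_derivative f x u v)" for v
    using has_second_derivative[OF assms] has_derivative_linear by blast
  have eq: "second_derivative f x u = (\<lambda>v. second_derivative f x v u)" for u
    using second_derivative_commute'[OF assms] by blast
  show ?thesis unfolding bilinear_def
  proof (intro conjI allI)
    show "linear (second_derivative f x u)" for u unfolding eq[of u] by (rule l)
    show "linear (\<lambda>u. second_derivative f x u v)" for v by (rule l)
  qed
qed

lemma smooth_on_second_derivative: "smooth_on S (\<lambda>x. second_derivative f x u v)"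
  unfolding second_derivative_def by (intro smooth_on_frechet_derivative f)

text \<open>Base point and direction both vary; expanding the direction in \<open>Basis\<close>
  separates the chain rule for \<open>t\<close> from the product rule for \<open>s\<close>.\<close>

lemma has_derivative_derivative_apply:
  fixes s :: "'c::euclidean_space \<Rightarrow> 'a" and t :: "'c \<Rightarrow> 'a"
  assumes "open U" "x \<in> U" "t ` U \<subseteq> S" and t: "(t has_derivative t') (at x)" and s: "(s has_derivative s') (at x)"
  shows "((\<lambda>y. frechet_derivative f (at (t y)) (s y)) has_derivative
    (\<lambda>u. second_derivative f (t x) (t' u) (s x) + frechet_derivative f (at (t x)) (s' u))) (at x)"
proof -
  have tS: "t y \<in> S" if "y \<in> U" for y using assms(3) that by auto
  have lin: "linear (frechet_derivative f (at (t y)))" if "y \<in> U" for y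
    using smooth_on_linear_derivative[OF f tS[OF that]] .
  have lin2: "linear (second_derivative f (t x) u)" for u
    using bilinear_second_derivative[OF tS[OF assms(2)]] by (simp add: bilinear_def)
  have "((\<lambda>y. frechet_derivative f (at (t y)) i) has_derivative (\<lambda>u. second_derivative f (t x) (t' u) i)) (at x)" for i
    using diff_chain_at[OF t has_second_derivative[OF tS[OF assms(2)]], of i] by (simp add: o_def)
  then have "((\<lambda>y. \<Sum>i\<in>Basis. (s y \<bullet> i) *\<^sub>R frechet_derivative f (at (t y)) i) has_derivative
      (\<lambda>u. \<Sum>i\<in>Basis. (s x \<bullet> i) *\<^sub>R second_derivative f (t x) (t' u) i
        + (s' u \<bullet> i) *\<^sub>R frechet_derivative f (at (t x)) i)) (at x)"
    by (intro has_derivative_sum has_derivative_scaleR has_derivative_inner_left s)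
  moreover have "(\<lambda>u. \<Sum>i\<in>Basis. (s x \<bullet> i) *\<^sub>R second_derivative f (t x) (t' u) i
        + (s' u \<bullet> i) *\<^sub>R frechet_derivative f (at (t x)) i) =
      (\<lambda>u. second_derivative f (t x) (t' u) (s x) + frechet_derivative f (at (t x)) (s' u))"
    by (rule ext)
      (simp only: sum.distrib linear_eq_sum_Basis[OF lin2, symmetric] linear_eq_sum_Basis[OF lin[OF assms(2)], symmetric])
  ultimately have "((\<lambda>y. \<Sum>i\<in>Basis. (s y \<bullet> i) *\<^sub>R frechet_derivative f (at (t y)) i) has_derivative
      (\<lambda>u. second_derivative f (t x) (t' u) (s x) + frechet_derivative f (at (t x)) (s' u))) (at x)"
    by simp
  then show ?thesis
    by (rule has_derivative_transform_within_open[OF _ assms(1,2)])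
      (simp only: linear_eq_sum_Basis[OF lin, symmetric])
qed

end

lemma frechet_derivative_compose_smooth:
  assumes "smooth_on S f" "smooth_on V g" "f x \<in> V" "x \<in> S"
  shows "frechet_derivative (\<lambda>x. g (f x)) (at x) v =
    frechet_derivative g (at (f x)) (frechet_derivative f (at x) v)"
proof -
  have "((\<lambda>x. g (f x)) has_derivative
      (\<lambda>v. frechet_derivative g (at (f x)) (frechet_derivative f (at x) v))) (at x)"
    using diff_chain_at[OF smooth_on_imp_has_derivative[OF assms(1,4)]
        smooth_on_imp_has_derivative[OF assms(2,3)]] by (simp add: o_def)
  from frechet_derivative_eqI[OF this] show ?thesis by simp
qed

lemma second_derivative_compose:
  fixes f :: "'a::euclidean_space \<Rightarrow> 'b::euclidean_space" and g :: "'b \<Rightarrow> 'c::euclidean_space"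
  assumes "open S" "open V" "smooth_on S f" "smooth_on V g" "f ` S \<subseteq> V" "x \<in> S"
  shows "second_derivative (\<lambda>x. g (f x)) x u v =
    second_derivative g (f x) (frechet_derivative f (at x) u) (frechet_derivative f (at x) v)
    + frechet_derivative g (at (f x)) (second_derivative f x u v)"
proof -
  have "((\<lambda>y. frechet_derivative g (at (f y)) (frechet_derivative f (at y) v)) has_derivative
    (\<lambda>u. second_derivative g (f x) (frechet_derivative f (at x) u) (frechet_derivative f (at x) v)
      + frechet_derivative g (at (f x)) (second_derivative f x u v))) (at x)"
    by (rule has_derivative_derivative_apply[OF assms(2,4,1,6,5)
        smooth_on_imp_has_derivative[OF assms(3,6)] has_second_derivative[OF assms(1,3,6)]])
  then have "((\<lambda>y. frechet_derivative (\<lambda>x. g (f x)) (at y) v) has_derivative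
    (\<lambda>u. second_derivative g (f x) (frechet_derivative f (at x) u) (frechet_derivative f (at x) v)
      + frechet_derivative g (at (f x)) (second_derivative f x u v))) (at x)"
    by (rule has_derivative_transform_within_open[OF _ assms(1,6)])
      (use assms(5) in \<open>auto simp: frechet_derivative_compose_smooth[OF assms(3,4)]\<close>)
  from frechet_derivative_eqI[OF this] show ?thesis unfolding second_derivative_def by simp
qed

lemma derivatives_cong:
  assumes "open S" "x \<in> S" "\<And>y. y \<in> S \<Longrightarrow> f y = g y" "smooth_on S f"
  shows "frechet_derivative f (at x) = frechet_derivative g (at x)"
    and "second_derivative f x u v = second_derivative g x u v"
proof -
  have 1: "frechet_derivative f (at y) = frechet_derivative g (at y)" if "y \<in> S" for y
    using frechet_derivative_transform_within_open[OF _ assms(1) that, of f g] assms(3)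
      smooth_on_imp_has_derivative[OF assms(4) that] differentiable_def by blast
  then show "frechet_derivative f (at x) = frechet_derivative g (at x)" using assms(2) by blast
  have "((\<lambda>y. frechet_derivative f (at y) v) has_derivative (\<lambda>u. second_derivative f x u v)) (at x)"
    by (rule has_second_derivative[OF assms(1,4,2)])
  then have "((\<lambda>y. frechet_derivative g (at y) v) has_derivative (\<lambda>u. second_derivative f x u v)) (at x)"
    by (rule has_derivative_transform_within_open[OF _ assms(1,2)]) (simp add: 1)
  from frechet_derivative_eqI[OF this]
  show "second_derivative f x u v = second_derivative g x u v"
    unfolding second_derivative_def[of g] by simp
qed


subsection \<open>The Koszul formula\<close>

lemma has_derivative_bilinear_family:
  fixes G :: "'a::euclidean_space \<Rightarrow> 'v::euclidean_space \<Rightarrow> 'v \<Rightarrow> real"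
  assumes "open S" "x \<in> S" and bil: "\<And>y. y \<in> S \<Longrightarrow> bilinear (G y)"
    and G: "\<And>u v. smooth_on S (\<lambda>y. G y u v)"
    and u: "(u has_derivative u') (at x)" and v: "(v has_derivative v') (at x)"
  shows "((\<lambda>y. G y (u y) (v y)) has_derivative
    (\<lambda>h. frechet_derivative (\<lambda>y. G y (u x) (v x)) (at x) h + G x (u' h) (v x) + G x (u x) (v' h))) (at x)"
proof -
  have expand: "G y a b = (\<Sum>i\<in>Basis. \<Sum>j\<in>Basis. ((a \<bullet> i) * (b \<bullet> j)) * G y i j)" if "y \<in> S" for y a b
  proof -
    have "G y a b = G y (\<Sum>i\<in>Basis. (a \<bullet> i) *\<^sub>R i) (\<Sum>j\<in>Basis. (b \<bullet> j) *\<^sub>R j)"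
      by (simp add: euclidean_representation)
    then show ?thesis unfolding bilinear_sum_scale[OF bil[OF that]] by simp
  qed
  have dG: "((\<lambda>y. G y i j) has_derivative frechet_derivative (\<lambda>y. G y i j) (at x)) (at x)" for i j
    by (rule smooth_on_imp_has_derivative[OF G \<open>x \<in> S\<close>])
  have "((\<lambda>y. G y a b) has_derivative
     (\<lambda>h. \<Sum>i\<in>Basis. \<Sum>j\<in>Basis. ((a \<bullet> i) * (b \<bullet> j)) * frechet_derivative (\<lambda>y. G y i j) (at x) h)) (at x)" for a b
    by (rule has_derivative_transform_within_open[OF _ \<open>open S\<close> \<open>x \<in> S\<close>, rotated])
      (rule expand[symmetric], assumption, intro has_derivative_sum has_derivative_mult_right dG)
  from fun_cong[OF frechet_derivative_eqI[OF this]]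
  have const: "frechet_derivative (\<lambda>y. G y a b) (at x) h =
      (\<Sum>i\<in>Basis. \<Sum>j\<in>Basis. ((a \<bullet> i) * (b \<bullet> j)) * frechet_derivative (\<lambda>y. G y i j) (at x) h)" for a b h .
  have "((\<lambda>y. \<Sum>i\<in>Basis. \<Sum>j\<in>Basis. ((u y \<bullet> i) * (v y \<bullet> j)) * G y i j) has_derivative
    (\<lambda>h. \<Sum>i\<in>Basis. \<Sum>j\<in>Basis. ((u x \<bullet> i) * (v x \<bullet> j)) * frechet_derivative (\<lambda>y. G y i j) (at x) h
      + ((u x \<bullet> i) * (v' h \<bullet> j) + (u' h \<bullet> i) * (v x \<bullet> j)) * G x i j)) (at x)"
    by (intro has_derivative_sum has_derivative_mult has_derivative_inner_left u v dG)
  moreover have "(\<Sum>i\<in>Basis. \<Sum>j\<in>Basis. ((u x \<bullet> i) * (v x \<bullet> j)) * frechet_derivative (\<lambda>y. G y i j) (at x) h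
      + ((u x \<bullet> i) * (v' h \<bullet> j) + (u' h \<bullet> i) * (v x \<bullet> j)) * G x i j) =
      frechet_derivative (\<lambda>y. G y (u x) (v x)) (at x) h + G x (u' h) (v x) + G x (u x) (v' h)" for h
    unfolding const[of "u x" "v x"] expand[OF \<open>x \<in> S\<close>, of "u' h"] expand[OF \<open>x \<in> S\<close>, of "u x"]
    by (simp add: sum.distrib distrib_right)
  ultimately have "((\<lambda>y. \<Sum>i\<in>Basis. \<Sum>j\<in>Basis. ((u y \<bullet> i) * (v y \<bullet> j)) * G y i j) has_derivative
    (\<lambda>h. frechet_derivative (\<lambda>y. G y (u x) (v x)) (at x) h + G x (u' h) (v x) + G x (u x) (v' h))) (at x)"
    by simp
  then show ?thesis
    by (rule has_derivative_transform_within_open[OF _ \<open>open S\<close> \<open>x \<in> S\<close>]) (rule expand[symmetric])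
qed

text \<open>The right-hand side of the equation that defines \<open>christoffel\<close>, detached
  from charts so that its transformation can be computed for any family of forms.\<close>

definition koszul :: "('a::euclidean_space \<Rightarrow> 'a \<Rightarrow> 'a \<Rightarrow> real) \<Rightarrow> 'a \<Rightarrow> 'a \<Rightarrow> 'a \<Rightarrow> 'a \<Rightarrow> real" where
  "koszul G y u w v =
     (frechet_derivative (\<lambda>y'. G y' w v) (at y) u
      + frechet_derivative (\<lambda>y'. G y' u v) (at y) w
      - frechet_derivative (\<lambda>y'. G y' u w) (at y) v) / 2"

lemma koszul_commute:
  assumes "\<And>y u v. G y u v = G y v u"
  shows "koszul G y u w v = koszul G y w u v"
proof -
  have "(\<lambda>y'. G y' u w) = (\<lambda>y'. G y' w u)" using assms by blast
  then show ?thesis unfolding koszul_def by simp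
qed

lemma koszul_linear:
  assumes "open S" "y \<in> S" and bil: "\<And>y. y \<in> S \<Longrightarrow> bilinear (G y)"
    and G: "\<And>u v. smooth_on S (\<lambda>y. G y u v)"
  shows "linear (\<lambda>v. koszul G y u w v)" "linear (\<lambda>u. koszul G y u w v)" "linear (\<lambda>w. koszul G y u w v)"
proof -
  let ?D = "\<lambda>a b h. frechet_derivative (\<lambda>y. G y a b) (at y) h"
  have d: "((\<lambda>y. G y a b) has_derivative ?D a b) (at y)" for a b
    by (rule smooth_on_imp_has_derivative[OF G \<open>y \<in> S\<close>])
  have h: "?D a b (s + t) = ?D a b s + ?D a b t" "?D a b (c *\<^sub>R s) = c * ?D a b s" for a b s t c
    using linear_add[OF has_derivative_linear[OF d]] linear_scale[OF has_derivative_linear[OF d]] by simp_all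
  have a: "?D (a + a') b = (\<lambda>h. ?D a b h + ?D a' b h)" "?D (c *\<^sub>R a) b = (\<lambda>h. c * ?D a b h)"
    "?D b (a + a') = (\<lambda>h. ?D b a h + ?D b a' h)" "?D b (c *\<^sub>R a) = (\<lambda>h. c * ?D b a h)" for a a' b c
    by (rule frechet_derivative_eqI, rule has_derivative_transform_within_open[OF _ \<open>open S\<close> \<open>y \<in> S\<close>],
        (rule has_derivative_add[OF d d] has_derivative_mult_right[OF d]),
        simp add: bilinear_ladd[OF bil] bilinear_radd[OF bil] bilinear_lmul[OF bil] bilinear_rmul[OF bil])+
  show "linear (\<lambda>v. koszul G y u w v)" "linear (\<lambda>u. koszul G y u w v)" "linear (\<lambda>w. koszul G y u w v)"
    unfolding koszul_def by (auto intro!: linearI simp: h a field_simps)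
qed

text \<open>Each of the three derivatives of the pulled-back form produces two terms with a second
  derivative of \<phi>. By symmetry four of the six cancel, and the remaining two are equal and are
  halved.\<close>

lemma koszul_transform:
  fixes G G' :: "'a::euclidean_space \<Rightarrow> 'a \<Rightarrow> 'a \<Rightarrow> real"
  assumes "open S" "open V" "y \<in> S" and \<phi>: "smooth_on S \<phi>" "\<phi> ` S \<subseteq> V"
    and bil: "\<And>z. z \<in> V \<Longrightarrow> bilinear (G' z)" and sym: "\<And>z u v. G' z u v = G' z v u"
    and G': "\<And>u v. smooth_on V (\<lambda>z. G' z u v)"
    and pull: "\<And>x u v. x \<in> S \<Longrightarrow>
      G x u v = G' (\<phi> x) (frechet_derivative \<phi> (at x) u) (frechet_derivative \<phi> (at x) v)"
  defines "d \<equiv> frechet_derivative \<phi> (at y)"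
  shows "koszul G y u w v = koszul G' (\<phi> y) (d u) (d w) (d v) + G' (\<phi> y) (second_derivative \<phi> y u w) (d v)"
proof -
  have yV: "\<phi> x \<in> V" if "x \<in> S" for x using \<phi>(2) that by auto
  have comp: "smooth_on S (\<lambda>x. G' (\<phi> x) a b)" for a b
    by (rule smooth_on_compose[OF assms(1,2) \<phi>(1) G' \<phi>(2)])
  have D: "frechet_derivative (\<lambda>x. G x a b) (at y) h =
      frechet_derivative (\<lambda>z. G' z (d a) (d b)) (at (\<phi> y)) (d h)
      + G' (\<phi> y) (second_derivative \<phi> y h a) (d b) + G' (\<phi> y) (d a) (second_derivative \<phi> y h b)" for a b h
  proof -
    have "((\<lambda>x. G' (\<phi> x) (frechet_derivative \<phi> (at x) a) (frechet_derivative \<phi> (at x) b)) has_derivative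
      (\<lambda>h. frechet_derivative (\<lambda>x. G' (\<phi> x) (d a) (d b)) (at y) h
        + G' (\<phi> y) (second_derivative \<phi> y h a) (d b) + G' (\<phi> y) (d a) (second_derivative \<phi> y h b))) (at y)"
      unfolding d_def
      by (rule has_derivative_bilinear_family[OF assms(1,3), where G="\<lambda>x. G' (\<phi> x)"])
        (use bil yV comp has_second_derivative[OF assms(1) \<phi>(1) assms(3)] in auto)
    then have "((\<lambda>x. G x a b) has_derivative
      (\<lambda>h. frechet_derivative (\<lambda>x. G' (\<phi> x) (d a) (d b)) (at y) h
        + G' (\<phi> y) (second_derivative \<phi> y h a) (d b) + G' (\<phi> y) (d a) (second_derivative \<phi> y h b))) (at y)"
      by (rule has_derivative_transform_within_open[OF _ assms(1,3)]) (simp add: pull)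
    from frechet_derivative_eqI[OF this]
    show ?thesis
      using frechet_derivative_compose_smooth[OF \<phi>(1) G' yV[OF assms(3)] assms(3)] by (simp add: d_def)
  qed
  note comm = second_derivative_commute'[OF assms(1) \<phi>(1) assms(3)]
  show ?thesis
    unfolding koszul_def D comm[of w u] comm[of v u] comm[of v w]
      sym[of _ "d w" "second_derivative \<phi> y u v"] sym[of _ "d u" "second_derivative \<phi> y w v"]
    by (simp add: field_simps sym)
qed


subsection \<open>Coordinate changes\<close>

locale smooth_atlas =
  fixes A :: "('a::{t2_space,second_countable_topology}, 'e::euclidean_space) chart set"
  assumes atlas: "smooth_manifold A"
begin

lemma homeo: "c \<in> A \<Longrightarrow> homeomorphism (fst c) (snd c ` fst c) (snd c) (chart_inv c)"
  and open_dom_chart: "c \<in> A \<Longrightarrow> open (fst c)" "c \<in> A \<Longrightarrow> open (snd c ` fst c)"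
  using atlas unfolding smooth_manifold_def is_chart_def by blast+

lemma chart_inv_chart [simp]: "c \<in> A \<Longrightarrow> p \<in> fst c \<Longrightarrow> chart_inv c (snd c p) = p"
  using homeo unfolding homeomorphism_def by blast

lemma open_chart_image:
  assumes "c \<in> A" "open W" shows "open (snd c ` (fst c \<inter> W))"
proof -
  have "open (snd c ` fst c \<inter> chart_inv c -` W)"
    using homeo[OF assms(1)] open_dom_chart(2)[OF assms(1)] assms(2)
    by (intro continuous_open_preimage) (auto simp: homeomorphism_def)
  moreover have "snd c ` fst c \<inter> chart_inv c -` W = snd c ` (fst c \<inter> W)"
    using assms(1) by auto
  ultimately show ?thesis by simp
qed

lemma chart_at_in: "chart_at A p \<in> A" "p \<in> fst (chart_at A p)"
proof -
  have "\<exists>c. c \<in> A \<and> p \<in> fst c" using atlas unfolding smooth_manifold_def by blast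
  from someI_ex[OF this] show "chart_at A p \<in> A" "p \<in> fst (chart_at A p)"
    unfolding chart_at_def by auto
qed

lemma smooth_transition:
  "c \<in> A \<Longrightarrow> c' \<in> A \<Longrightarrow> smooth_on (snd c ` (fst c \<inter> fst c')) (snd c' \<circ> chart_inv c)"
  using atlas unfolding smooth_manifold_def by blast

lemma linear_coord_change:
  assumes "c \<in> A" "c' \<in> A" "p \<in> fst c" "p \<in> fst c'"
  shows "linear (coord_change c c' p)"
  unfolding coord_change_def
  by (rule smooth_on_linear_derivative[OF smooth_transition[OF assms(1,2)]]) (use assms in auto)

lemma coord_change_refl:
  assumes "c \<in> A" "p \<in> fst c" shows "coord_change c c p v = v"
proof -
  have "((\<lambda>y. y) has_derivative (\<lambda>v. v)) (at (snd c p))" by (rule has_derivative_ident)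
  then have "((snd c \<circ> chart_inv c) has_derivative (\<lambda>v. v)) (at (snd c p))"
    by (rule has_derivative_transform_within_open[OF _ open_dom_chart(2)[OF assms(1)]]) (use assms in auto)
  from frechet_derivative_eqI[OF this] show ?thesis unfolding coord_change_def by simp
qed

lemma coord_change_trans:
  assumes c: "c1 \<in> A" "c2 \<in> A" "c3 \<in> A" and p: "p \<in> fst c1" "p \<in> fst c2" "p \<in> fst c3"
  shows "coord_change c2 c3 p (coord_change c1 c2 p v) = coord_change c1 c3 p v"
proof -
  define W where "W = snd c1 ` (fst c1 \<inter> (fst c2 \<inter> fst c3))"
  have W: "open W" "snd c1 p \<in> W" unfolding W_def using c p by (auto intro!: open_chart_image open_dom_chart open_Int)
  have sm: "smooth_on W (snd c2 \<circ> chart_inv c1)"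
    by (rule smooth_on_subset[OF smooth_transition[OF c(1,2)]]) (auto simp: W_def)
  have p2: "(snd c2 \<circ> chart_inv c1) (snd c1 p) = snd c2 p" using c p by simp
  have "frechet_derivative (\<lambda>y. (snd c3 \<circ> chart_inv c2) ((snd c2 \<circ> chart_inv c1) y)) (at (snd c1 p)) v =
    coord_change c2 c3 p (coord_change c1 c2 p v)"
    using frechet_derivative_compose_smooth[OF sm smooth_transition[OF c(2,3)] _ W(2)] c p
    unfolding coord_change_def by auto
  moreover have "frechet_derivative (snd c3 \<circ> chart_inv c1) (at (snd c1 p)) =
     frechet_derivative (\<lambda>y. (snd c3 \<circ> chart_inv c2) ((snd c2 \<circ> chart_inv c1) y)) (at (snd c1 p))"
    by (rule derivatives_cong(1)[OF W _ smooth_on_subset[OF smooth_transition[OF c(1,3)]]])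
      (use c p in \<open>auto simp: W_def\<close>)
  ultimately show ?thesis unfolding coord_change_def[of c1 c3] by simp
qed

lemma in_chart_from_chart [simp]:
  "c \<in> A \<Longrightarrow> p \<in> fst c \<Longrightarrow> in_chart A c p (from_chart A c p v) = v"
  and from_chart_in_chart [simp]:
  "c \<in> A \<Longrightarrow> p \<in> fst c \<Longrightarrow> from_chart A c p (in_chart A c p v) = v"
  unfolding in_chart_def from_chart_def
  by (simp_all add: coord_change_trans coord_change_refl chart_at_in)

lemma coord_change_in_chart:
  "c \<in> A \<Longrightarrow> p \<in> fst c \<Longrightarrow> c' \<in> A \<Longrightarrow> p \<in> fst c' \<Longrightarrow>
    coord_change c c' p (in_chart A c p v) = in_chart A c' p v"
  unfolding in_chart_def by (simp add: coord_change_trans chart_at_in)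

lemma linear_in_chart: "c \<in> A \<Longrightarrow> p \<in> fst c \<Longrightarrow> linear (in_chart A c p)"
  and linear_from_chart: "c \<in> A \<Longrightarrow> p \<in> fst c \<Longrightarrow> linear (from_chart A c p)"
  unfolding in_chart_def from_chart_def by (auto intro!: linear_coord_change chart_at_in)

lemma in_chart_chart_at: "in_chart A (chart_at A p) p v = v"
  unfolding in_chart_def by (simp add: coord_change_refl chart_at_in)

end

section \<open>Chart representatives of a map and their behaviour under changes of charts\<close>

locale smooth_mapping = A: smooth_atlas A + B: smooth_atlas B
  for A :: "('a::{t2_space,second_countable_topology}, 'e::euclidean_space) chart set"
    and B :: "('b::{t2_space,second_countable_topology}, 'f::euclidean_space) chart set" +
  fixes \<psi> :: "'a \<Rightarrow> 'b"
  assumes smooth_psi: "smooth_map A B \<psi>"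
begin

definition rep :: "('a, 'e) chart \<Rightarrow> ('b, 'f) chart \<Rightarrow> 'e \<Rightarrow> 'f" where
  "rep c d = snd d \<circ> \<psi> \<circ> chart_inv c"

definition dom :: "('a, 'e) chart \<Rightarrow> ('b, 'f) chart \<Rightarrow> 'e set" where
  "dom c d = snd c ` (fst c \<inter> \<psi> -` fst d)"

lemma open_vimage: "open W \<Longrightarrow> open (\<psi> -` W)"
  using smooth_psi unfolding smooth_map_def by (simp add: continuous_on_open_vimage open_vimage)

lemma open_dom: "c \<in> A \<Longrightarrow> d \<in> B \<Longrightarrow> open (dom c d)"
  unfolding dom_def by (intro A.open_chart_image open_vimage B.open_dom_chart)

lemma smooth_rep: "c \<in> A \<Longrightarrow> d \<in> B \<Longrightarrow> smooth_on (dom c d) (rep c d)"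
  using smooth_psi unfolding smooth_map_def dom_def rep_def by blast

lemma in_dom: "p \<in> fst c \<Longrightarrow> \<psi> p \<in> fst d \<Longrightarrow> snd c p \<in> dom c d"
  unfolding dom_def by blast

lemma rep_chart [simp]: "c \<in> A \<Longrightarrow> p \<in> fst c \<Longrightarrow> rep c d (snd c p) = snd d (\<psi> p)"
  unfolding rep_def by simp

lemma domE:
  assumes "y \<in> dom c d"
  obtains p where "y = snd c p" "p \<in> fst c" "\<psi> p \<in> fst d"
  using assms unfolding dom_def by blast

text \<open>Both formulas come from one identity, representative after source transition equals
  target transition after representative, differentiated once and twice.\<close>

lemma rep_change:
  assumes "c \<in> A" "c' \<in> A" "d \<in> B" "d' \<in> B" "p \<in> fst c" "p \<in> fst c'" "\<psi> p \<in> fst d" "\<psi> p \<in> fst d'"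
  shows "frechet_derivative (rep c' d') (at (snd c' p)) (coord_change c c' p v) =
      coord_change d d' (\<psi> p) (frechet_derivative (rep c d) (at (snd c p)) v)"
    and "second_derivative (rep c' d') (snd c' p) (coord_change c c' p u) (coord_change c c' p v)
      + frechet_derivative (rep c' d') (at (snd c' p)) (second_derivative (snd c' \<circ> chart_inv c) (snd c p) u v) =
      second_derivative (snd d' \<circ> chart_inv d) (snd d (\<psi> p))
        (frechet_derivative (rep c d) (at (snd c p)) u) (frechet_derivative (rep c d) (at (snd c p)) v)
      + coord_change d d' (\<psi> p) (second_derivative (rep c d) (snd c p) u v)"
proof -
  define \<tau> where "\<tau> = snd c' \<circ> chart_inv c"
  define \<sigma> where "\<sigma> = snd d' \<circ> chart_inv d"
  define W where "W = snd c ` (fst c \<inter> (fst c' \<inter> \<psi> -` (fst d \<inter> fst d')))"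
  have W: "open W" "snd c p \<in> W"
    unfolding W_def using assms
    by (auto intro!: A.open_chart_image open_vimage A.open_dom_chart B.open_dom_chart open_Int
        simp del: vimage_Int)
  have sm_t: "smooth_on W \<tau>"
    unfolding \<tau>_def by (rule smooth_on_subset[OF A.smooth_transition[OF assms(1,2)]]) (auto simp: W_def)
  have sm_r: "smooth_on W (rep c d)"
    by (rule smooth_on_subset[OF smooth_rep[OF assms(1,3)]]) (auto simp: W_def dom_def)
  have sm_s: "smooth_on (snd d ` (fst d \<inter> fst d')) \<sigma>"
    unfolding \<sigma>_def by (rule B.smooth_transition[OF assms(3,4)])
  have op: "open (snd d ` (fst d \<inter> fst d'))"
    by (intro B.open_chart_image B.open_dom_chart assms)
  have sm_r': "smooth_on (dom c' d') (rep c' d')" by (rule smooth_rep[OF assms(2,4)])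
  have imt: "\<tau> ` W \<subseteq> dom c' d'" unfolding W_def \<tau>_def dom_def using assms by auto
  have imr: "rep c d ` W \<subseteq> snd d ` (fst d \<inter> fst d')" unfolding W_def using assms by auto
  have eq: "rep c' d' (\<tau> y) = \<sigma> (rep c d y)" if "y \<in> W" for y
    using that assms unfolding W_def \<tau>_def \<sigma>_def by (auto simp: rep_def)
  have sm1: "smooth_on W (\<lambda>y. rep c' d' (\<tau> y))"
    by (rule smooth_on_compose[OF W(1) open_dom[OF assms(2,4)] sm_t sm_r' imt])
  have tp: "\<tau> (snd c p) = snd c' p" using assms by (simp add: \<tau>_def)
  have rp: "rep c d (snd c p) = snd d (\<psi> p)" using assms by simp
  have dt: "coord_change c c' p = frechet_derivative \<tau> (at (snd c p))"
    by (simp add: coord_change_def \<tau>_def)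
  have ds: "coord_change d d' (\<psi> p) = frechet_derivative \<sigma> (at (snd d (\<psi> p)))"
    by (simp add: coord_change_def \<sigma>_def)
  have "frechet_derivative (\<lambda>y. rep c' d' (\<tau> y)) (at (snd c p)) v =
      frechet_derivative (rep c' d') (at (snd c' p)) (coord_change c c' p v)"
    using frechet_derivative_compose_smooth[OF sm_t sm_r' _ W(2), of v] imt W(2)
    unfolding tp dt by (auto simp: tp)
  moreover have "frechet_derivative (\<lambda>y. \<sigma> (rep c d y)) (at (snd c p)) v =
      coord_change d d' (\<psi> p) (frechet_derivative (rep c d) (at (snd c p)) v)"
    using frechet_derivative_compose_smooth[OF sm_r sm_s _ W(2), of v] imr W(2)
    unfolding rp ds by (auto simp: rp)
  moreover have "frechet_derivative (\<lambda>y. rep c' d' (\<tau> y)) (at (snd c p)) =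
      frechet_derivative (\<lambda>y. \<sigma> (rep c d y)) (at (snd c p))"
    by (rule derivatives_cong(1)[OF W eq sm1])
  ultimately show "frechet_derivative (rep c' d') (at (snd c' p)) (coord_change c c' p v) =
      coord_change d d' (\<psi> p) (frechet_derivative (rep c d) (at (snd c p)) v)" by simp
  have "second_derivative (\<lambda>y. rep c' d' (\<tau> y)) (snd c p) u v =
      second_derivative (\<lambda>y. \<sigma> (rep c d y)) (snd c p) u v"
    by (rule derivatives_cong(2)[OF W eq sm1])
  then show "second_derivative (rep c' d') (snd c' p) (coord_change c c' p u) (coord_change c c' p v)
      + frechet_derivative (rep c' d') (at (snd c' p)) (second_derivative (snd c' \<circ> chart_inv c) (snd c p) u v) =
      second_derivative (snd d' \<circ> chart_inv d) (snd d (\<psi> p))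
        (frechet_derivative (rep c d) (at (snd c p)) u) (frechet_derivative (rep c d) (at (snd c p)) v)
      + coord_change d d' (\<psi> p) (second_derivative (rep c d) (snd c p) u v)"
    unfolding second_derivative_compose[OF W(1) open_dom[OF assms(2,4)] sm_t sm_r' imt W(2)]
      second_derivative_compose[OF W(1) op sm_r sm_s imr W(2)] tp rp dt ds \<tau>_def[symmetric] \<sigma>_def[symmetric] .
qed

lemma differential_rep:
  "differential A B \<psi> p = frechet_derivative (rep (chart_at A p) (chart_at B (\<psi> p))) (at (snd (chart_at A p) p))"
  unfolding differential_def rep_def ..

lemma in_chart_differential:
  assumes "c \<in> A" "d \<in> B" "p \<in> fst c" "\<psi> p \<in> fst d"
  shows "in_chart B d (\<psi> p) (differential A B \<psi> p x) =
    frechet_derivative (rep c d) (at (snd c p)) (in_chart A c p x)"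
  unfolding differential_rep in_chart_def
  by (rule rep_change(1)[OF A.chart_at_in(1) assms(1) B.chart_at_in(1) assms(2) A.chart_at_in(2) assms(3)
      B.chart_at_in(2) assms(4), symmetric])

lemma linear_rep_derivative:
  "c \<in> A \<Longrightarrow> d \<in> B \<Longrightarrow> p \<in> fst c \<Longrightarrow> \<psi> p \<in> fst d \<Longrightarrow> linear (frechet_derivative (rep c d) (at (snd c p)))"
  by (intro smooth_on_linear_derivative[OF smooth_rep] in_dom)

lemma linear_differential: "linear (differential A B \<psi> p)"
  unfolding differential_rep by (intro linear_rep_derivative A.chart_at_in B.chart_at_in)

end


subsection \<open>The Levi-Civita connection in charts\<close>

text \<open>Covers indefinite forms as well. Existence together with uniqueness is what the definite
  descriptions of \<open>christoffel\<close> and \<open>chart_tangent_part\<close> require.\<close>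

lemma nondegenerate_riesz:
  fixes G :: "'a::euclidean_space \<Rightarrow> 'a \<Rightarrow> real"
  assumes "bilinear G" and nondeg: "\<And>u. (\<And>v. G u v = 0) \<Longrightarrow> u = 0" and "linear \<phi>"
  shows "\<exists>!z. \<forall>v. G z v = \<phi> v"
proof -
  have expand: "\<psi> v = (\<Sum>i\<in>Basis. (v \<bullet> i) * \<psi> i)" if "linear \<psi>" for \<psi> :: "'a \<Rightarrow> real" and v
    using linear_eq_sum_Basis[OF that, of v] by (simp only: real_scaleR_def)
  have linG: "linear (G u)" "linear (\<lambda>u. G u v)" for u v using assms(1) by (auto simp: bilinear_def)
  define L where "L u = (\<Sum>i\<in>Basis. G u i *\<^sub>R i)" for u
  have linL: "linear L"
    unfolding L_def by (rule linearI)
      (simp_all add: linear_add[OF linG(2)] linear_scale[OF linG(2)] scaleR_left_distrib sum.distrib scaleR_sum_right)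
  have Li: "L u \<bullet> i = G u i" if "i \<in> Basis" for u i
    using that unfolding L_def by (simp add: inner_sum_left inner_Basis if_distrib cong: if_cong)
  have eq0: "u = 0" if "L u = 0" for u
  proof (rule nondeg)
    fix v show "G u v = 0" using Li[of _ u] that expand[OF linG(1), of u v] by simp
  qed
  then have "inj L" using linear_injective_0[OF linL] by blast
  then have "surj L" using linear_injective_imp_surjective[OF linL] by blast
  then obtain z where z: "L z = (\<Sum>i\<in>Basis. \<phi> i *\<^sub>R i)" by (metis surjD)
  have "G z i = \<phi> i" if "i \<in> Basis" for i
    using Li[OF that, of z] that unfolding z by (simp add: inner_sum_left inner_Basis if_distrib cong: if_cong)
  then have "G z v = \<phi> v" for v using expand[OF linG(1), of z v] expand[OF assms(3), of v] by simp
  moreover have "z' = z" if "\<forall>v. G z' v = \<phi> v" for z'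
  proof -
    have "G (z' - z) v = 0" for v using that calculation by (simp add: linear_diff[OF linG(2)])
    then show ?thesis using nondeg by (metis eq_iff_diff_eq_0)
  qed
  ultimately show ?thesis by blast
qed

locale spacetime_manifold =
  fixes B :: "('b::{t2_space,second_countable_topology}, 'f::euclidean_space) chart set"
    and g :: "'b \<Rightarrow> 'f \<Rightarrow> 'f \<Rightarrow> real" and T :: "'b \<Rightarrow> 'f"
  assumes st: "spacetime B g T"
begin

sublocale smooth_atlas B
  using st by unfold_locales (simp add: spacetime_def)

abbreviation "gc \<equiv> metric_in_chart B g"
abbreviation "\<Gamma> \<equiv> christoffel B g"

lemma bilinear_g: "bilinear (g q)" and g_commute: "g q u v = g q v u"
  using st unfolding spacetime_def lorentzian_metric_def by blast+

lemma g_orth_pos: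
  assumes "g q u u < 0" "g q u v = 0" "v \<noteq> 0" shows "g q v v > 0"
proof -
  have "\<exists>e :: 'f \<Rightarrow> 'f. \<exists>i0\<in>Basis. \<forall>i\<in>Basis. \<forall>j\<in>Basis.
      g q (e i) (e j) = (if i \<noteq> j then 0 else if i = i0 then -1 else 1)"
    using st unfolding spacetime_def lorentzian_metric_def by blast
  then obtain e :: "'f \<Rightarrow> 'f" and i0 where "i0 \<in> Basis" and "\<And>i j. i \<in> Basis \<Longrightarrow> j \<in> Basis \<Longrightarrow>
      g q (e i) (e j) = (if i \<noteq> j then 0 else if i = i0 then -1 else 1)" by blast
  from lorentz_orthogonal_timelike_pos[OF bilinear_g this assms] show ?thesis .
qed

lemma timelike: "g q (T q) (T q) < 0"
  using st unfolding spacetime_def by blast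

lemma g_nondegenerate:
  assumes "\<And>v. g q u v = 0" shows "u = 0"
proof (rule ccontr)
  assume "u \<noteq> 0"
  then have "g q u u > 0" using g_orth_pos[OF timelike, of q u] assms[of "T q"] g_commute[of q u "T q"] by simp
  then show False using assms[of u] by simp
qed

lemma g_in_chart:
  "d \<in> B \<Longrightarrow> q \<in> fst d \<Longrightarrow> g q u v = gc d (snd d q) (in_chart B d q u) (in_chart B d q v)"
  unfolding metric_in_chart_def by simp

lemma gc_chart:
  "d \<in> B \<Longrightarrow> q \<in> fst d \<Longrightarrow> gc d (snd d q) u v = g q (from_chart B d q u) (from_chart B d q v)"
  unfolding metric_in_chart_def by simp

lemma gc_commute: "gc d y u v = gc d y v u"
  unfolding metric_in_chart_def by (rule g_commute)

lemma bilinear_gc: "d \<in> B \<Longrightarrow> y \<in> snd d ` fst d \<Longrightarrow> bilinear (gc d y)"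
  unfolding bilinear_def
  by (auto intro!: linearI simp: gc_chart linear_add[OF linear_from_chart] linear_scale[OF linear_from_chart]
      bilinear_ladd[OF bilinear_g] bilinear_radd[OF bilinear_g] bilinear_lmul[OF bilinear_g] bilinear_rmul[OF bilinear_g])

lemma gc_nondegenerate:
  assumes "d \<in> B" "y \<in> snd d ` fst d" "\<And>v. gc d y u v = 0" shows "u = 0"
proof -
  obtain q where q: "q \<in> fst d" "y = snd d q" using assms(2) by blast
  have "g q (from_chart B d q u) v = 0" for v
    using assms(3)[of "in_chart B d q v"] gc_chart[OF assms(1) q(1)] from_chart_in_chart[OF assms(1) q(1)]
    unfolding q(2) by simp
  then have "from_chart B d q u = 0" by (rule g_nondegenerate)
  then show ?thesis
    using in_chart_from_chart[OF assms(1) q(1), of u] linear_0[OF linear_in_chart[OF assms(1) q(1)]] by simp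
qed

lemma gc_eqI:
  assumes "d \<in> B" "y \<in> snd d ` fst d" "\<And>v. gc d y a v = gc d y b v" shows "a = b"
  using gc_nondegenerate[OF assms(1,2), of "a - b"] assms(3) bilinear_lsub[OF bilinear_gc[OF assms(1,2)]] by simp

lemma smooth_gc: "d \<in> B \<Longrightarrow> smooth_on (snd d ` fst d) (\<lambda>y. gc d y u v)"
  using st unfolding spacetime_def lorentzian_metric_def by blast

text \<open>Unique solvability turns the definite description of the Christoffel symbols into an
  equation; symmetry, bilinearity, smoothness and the transformation law are all read off from
  it.\<close>

lemma koszul_christoffel:
  assumes d: "d \<in> B" "y \<in> snd d ` fst d"
  shows "gc d y (\<Gamma> d y u w) v = koszul (gc d) y u w v"
proof -
  have "linear (koszul (gc d) y u w)"
    by (rule koszul_linear(1)[OF open_dom_chart(2)[OF d(1)] d(2) bilinear_gc[OF d(1)] smooth_gc[OF d(1)]])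
  then have "\<exists>!z. \<forall>v. gc d y z v = koszul (gc d) y u w v"
    by (intro nondegenerate_riesz bilinear_gc d) (rule gc_nondegenerate[OF d])
  from theI'[OF this] show ?thesis unfolding christoffel_def koszul_def by blast
qed

lemma christoffel_commute: "d \<in> B \<Longrightarrow> y \<in> snd d ` fst d \<Longrightarrow> \<Gamma> d y u w = \<Gamma> d y w u"
  by (rule gc_eqI) (auto simp: koszul_christoffel koszul_commute[OF gc_commute])

lemma bilinear_christoffel:
  assumes d: "d \<in> B" "y \<in> snd d ` fst d" shows "bilinear (\<Gamma> d y)"
proof -
  note k = koszul_linear(2)[OF open_dom_chart(2)[OF d(1)] d(2) bilinear_gc[OF d(1)] smooth_gc[OF d(1)]]
  have l: "linear (\<lambda>u. \<Gamma> d y u w)" for w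
  proof (rule linearI)
    show "\<Gamma> d y (a + b) w = \<Gamma> d y a w + \<Gamma> d y b w" for a b
      by (rule gc_eqI[OF d])
        (simp add: koszul_christoffel[OF d] bilinear_ladd[OF bilinear_gc[OF d]] linear_add[OF k])
    show "\<Gamma> d y (c *\<^sub>R a) w = c *\<^sub>R \<Gamma> d y a w" for a c
      by (rule gc_eqI[OF d])
        (simp add: koszul_christoffel[OF d] bilinear_lmul[OF bilinear_gc[OF d]] linear_scale[OF k])
  qed
  have eq: "\<Gamma> d y u = (\<lambda>w. \<Gamma> d y w u)" for u using christoffel_commute[OF d] by blast
  show ?thesis unfolding bilinear_def
  proof (intro conjI allI)
    show "linear (\<Gamma> d y u)" for u unfolding eq[of u] by (rule l)
    show "linear (\<lambda>u. \<Gamma> d y u w)" for w by (rule l)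
  qed
qed

lemma smooth_christoffel:
  assumes d: "d \<in> B" shows "smooth_on (snd d ` fst d) (\<lambda>y. \<Gamma> d y u w)"
proof (rule smooth_on_nondegenerate_solution[OF open_dom_chart(2)[OF d] bilinear_gc[OF d]
      gc_nondegenerate[OF d] smooth_gc[OF d] _ koszul_christoffel[OF d]])
  fix v
  have "smooth_on (snd d ` fst d) (\<lambda>y. (1/2) *\<^sub>R
     (frechet_derivative (\<lambda>y'. gc d y' w v) (at y) u
      + frechet_derivative (\<lambda>y'. gc d y' u v) (at y) w
      - frechet_derivative (\<lambda>y'. gc d y' u w) (at y) v))"
    by (intro smooth_on_scaleR smooth_on_const smooth_on_add smooth_on_diff smooth_on_frechet_derivative
        smooth_gc open_dom_chart d)
  then show "smooth_on (snd d ` fst d) (\<lambda>y. koszul (gc d) y u w v)" unfolding koszul_def by simp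
qed

text \<open>The metric in one chart is the pullback of that in the other by the transition map, so
  the inhomogeneous term is the one in \<open>koszul_transform\<close>.\<close>

lemma christoffel_transform:
  assumes "d \<in> B" "d' \<in> B" "q \<in> fst d" "q \<in> fst d'"
  shows "coord_change d d' q (\<Gamma> d (snd d q) a b) =
    \<Gamma> d' (snd d' q) (coord_change d d' q a) (coord_change d d' q b)
    + second_derivative (snd d' \<circ> chart_inv d) (snd d q) a b"
proof (rule gc_eqI[OF assms(2)])
  show y': "snd d' q \<in> snd d' ` fst d'" using assms by simp
  have y: "snd d q \<in> snd d ` fst d" using assms by simp
  define \<sigma> where "\<sigma> = snd d' \<circ> chart_inv d"
  have cc: "coord_change d d' q' = frechet_derivative \<sigma> (at (snd d q'))" for q'
    by (simp add: coord_change_def \<sigma>_def)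
  have pull: "gc d (snd d q') u v = gc d' (snd d' q') (coord_change d d' q' u) (coord_change d d' q' v)"
    if "q' \<in> fst d" "q' \<in> fst d'" for q' u v
  proof -
    have "in_chart B d' q' (from_chart B d q' w) = coord_change d d' q' w" for w
      using coord_change_in_chart[OF assms(1) that(1) assms(2) that(2), of "from_chart B d q' w"] assms(1) that by simp
    then show ?thesis
      using g_in_chart[OF assms(2) that(2)] gc_chart[OF assms(1) that(1)] by simp
  qed
  fix v
  \<comment> \<open>Coordinate changes are invertible, so every test vector is the image of some
    \<open>v'\<close>, to which the pullback formula applies.\<close>
  define v' where "v' = coord_change d' d q v"
  have v: "v = coord_change d d' q v'"
    unfolding v'_def using assms by (simp add: coord_change_trans coord_change_refl)
  have "gc d' (snd d' q) (coord_change d d' q (\<Gamma> d (snd d q) a b)) v = gc d (snd d q) (\<Gamma> d (snd d q) a b) v'"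
    unfolding v using pull[OF assms(3,4)] by simp
  also have "\<dots> = koszul (gc d) (snd d q) a b v'" by (rule koszul_christoffel[OF assms(1) y])
  also have "\<dots> = koszul (gc d') (\<sigma> (snd d q)) (frechet_derivative \<sigma> (at (snd d q)) a)
      (frechet_derivative \<sigma> (at (snd d q)) b) (frechet_derivative \<sigma> (at (snd d q)) v')
      + gc d' (\<sigma> (snd d q)) (second_derivative \<sigma> (snd d q) a b) (frechet_derivative \<sigma> (at (snd d q)) v')"
  proof (rule koszul_transform[where S="snd d ` (fst d \<inter> fst d')" and V="snd d' ` fst d'"])
    show "open (snd d ` (fst d \<inter> fst d'))" by (intro open_chart_image open_dom_chart assms)
    show "open (snd d' ` fst d')" by (intro open_dom_chart assms)
    show "snd d q \<in> snd d ` (fst d \<inter> fst d')" using assms by blast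
    show "smooth_on (snd d ` (fst d \<inter> fst d')) \<sigma>" unfolding \<sigma>_def by (rule smooth_transition[OF assms(1,2)])
    show "\<sigma> ` snd d ` (fst d \<inter> fst d') \<subseteq> snd d' ` fst d'" unfolding \<sigma>_def using assms(1) by auto
    show "bilinear (gc d' z)" if "z \<in> snd d' ` fst d'" for z by (rule bilinear_gc[OF assms(2) that])
    show "gc d' z u v = gc d' z v u" for z u v by (rule gc_commute)
    show "smooth_on (snd d' ` fst d') (\<lambda>z. gc d' z u v)" for u v by (rule smooth_gc[OF assms(2)])
    show "gc d x u v = gc d' (\<sigma> x) (frechet_derivative \<sigma> (at x) u) (frechet_derivative \<sigma> (at x) v)"
      if x: "x \<in> snd d ` (fst d \<inter> fst d')" for x u v
    proof -
      obtain q' where q': "x = snd d q'" "q' \<in> fst d" "q' \<in> fst d'" using x by blast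
      have "\<sigma> x = snd d' q'" using q' assms(1) by (simp add: \<sigma>_def)
      then show ?thesis using pull[OF q'(2,3), of u v] unfolding cc q'(1) by simp
    qed
  qed
  also have "\<sigma> (snd d q) = snd d' q" using assms by (simp add: \<sigma>_def)
  also have "koszul (gc d') (snd d' q) (frechet_derivative \<sigma> (at (snd d q)) a)
      (frechet_derivative \<sigma> (at (snd d q)) b) (frechet_derivative \<sigma> (at (snd d q)) v') =
      gc d' (snd d' q) (\<Gamma> d' (snd d' q) (coord_change d d' q a) (coord_change d d' q b)) v"
    unfolding v cc by (rule koszul_christoffel[OF assms(2) y', symmetric])
  also have "frechet_derivative \<sigma> (at (snd d q)) v' = v" unfolding v cc ..
  finally show "gc d' (snd d' q) (coord_change d d' q (\<Gamma> d (snd d q) a b)) v =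
    gc d' (snd d' q) (\<Gamma> d' (snd d' q) (coord_change d d' q a) (coord_change d d' q b)
    + second_derivative (snd d' \<circ> chart_inv d) (snd d q) a b) v"
    unfolding bilinear_ladd[OF bilinear_gc[OF assms(2) y']] \<sigma>_def[symmetric] .
qed

end


subsection \<open>The second fundamental form in charts\<close>

locale spacelike_immersion = spacetime_manifold B g T
  for B :: "('b::{t2_space,second_countable_topology}, 'f::euclidean_space) chart set"
    and g :: "'b \<Rightarrow> 'f \<Rightarrow> 'f \<Rightarrow> real" and T :: "'b \<Rightarrow> 'f" +
  fixes A :: "('a::{t2_space,second_countable_topology}, 'e::euclidean_space) chart set"
    and \<psi> :: "'a \<Rightarrow> 'b"
  assumes spacelike: "spacelike_submanifold A B g \<psi>" and codim_two: "DIM('f) = DIM('e) + 2"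
begin

sublocale M: smooth_mapping A B \<psi>
  using spacelike atlas by unfold_locales (auto simp: spacelike_submanifold_def)

abbreviation dif :: "'a \<Rightarrow> 'e \<Rightarrow> 'f" where "dif \<equiv> differential A B \<psi>"

sublocale P: spacelike_subspace "g (\<psi> p)" "dif p" "T (\<psi> p)" for p
proof (rule spacelike_subspace.intro)
  show "bilinear (g (\<psi> p))" by (rule bilinear_g)
  show "g (\<psi> p) u v = g (\<psi> p) v u" for u v by (rule g_commute)
  show "g (\<psi> p) u u < 0 \<Longrightarrow> g (\<psi> p) u v = 0 \<Longrightarrow> v \<noteq> 0 \<Longrightarrow> g (\<psi> p) v v > 0" for u v
    by (rule g_orth_pos)
  show "g (\<psi> p) (T (\<psi> p)) (T (\<psi> p)) < 0" by (rule timelike)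
  show "linear (dif p)" by (rule M.linear_differential)
  show "g (\<psi> p) (dif p x) (dif p x) > 0" if "x \<noteq> 0" for x
    using spacelike that unfolding spacelike_submanifold_def induced_metric_def by blast
  show "DIM('f) = DIM('e) + 2" by (rule codim_two)
qed

lemma normal_space_eq: "normal_space A B g \<psi> p = P.normal p"
  unfolding normal_space_def P.normal_def ..

lemma normal_part_eqI:
  assumes "w \<in> normal_space A B g \<psi> p" "v - w \<in> range (dif p)"
  shows "normal_part A B g \<psi> p v = w"
  unfolding normal_part_def
proof (rule the_equality)
  show "w \<in> normal_space A B g \<psi> p \<and> v - w \<in> range (dif p)" using assms by blast
  show "w' = w" if "w' \<in> normal_space A B g \<psi> p \<and> v - w' \<in> range (dif p)" for w'
    by (rule P.normal_projection_unique[of w' p w v]) (use that assms normal_space_eq in blast)+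
qed

lemma normal_part_decomp:
  obtains a where "v = normal_part A B g \<psi> p v + dif p a"
  and "normal_part A B g \<psi> p v \<in> normal_space A B g \<psi> p"
proof -
  obtain a where a: "v - dif p a \<in> normal_space A B g \<psi> p"
    using P.normal_projection[of v p] by (auto simp: normal_space_eq)
  have "normal_part A B g \<psi> p v = v - dif p a" by (rule normal_part_eqI[OF a]) simp
  then show thesis using a that[of a] by simp
qed

lemma linear_normal_part: "linear (normal_part A B g \<psi> p)"
proof (rule linearI)
  fix u v :: 'f and c :: real
  obtain a where a: "u = normal_part A B g \<psi> p u + dif p a" "normal_part A B g \<psi> p u \<in> normal_space A B g \<psi> p"
    by (rule normal_part_decomp)
  obtain b where b: "v = normal_part A B g \<psi> p v + dif p b" "normal_part A B g \<psi> p v \<in> normal_space A B g \<psi> p"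
    by (rule normal_part_decomp)
  have "u + v - (normal_part A B g \<psi> p u + normal_part A B g \<psi> p v) = dif p (a + b)"
    unfolding linear_add[OF M.linear_differential] using a(1) b(1) by (metis add_diff_add add_diff_cancel_left')
  then show "normal_part A B g \<psi> p (u + v) = normal_part A B g \<psi> p u + normal_part A B g \<psi> p v"
    using a(2) b(2) P.subspace_normal by (intro normal_part_eqI) (auto simp: normal_space_eq subspace_add)
  have "c *\<^sub>R u - c *\<^sub>R normal_part A B g \<psi> p u = dif p (c *\<^sub>R a)"
    unfolding linear_scale[OF M.linear_differential] using a(1) by (metis add_diff_cancel_left' scaleR_diff_right)
  then show "normal_part A B g \<psi> p (c *\<^sub>R u) = c *\<^sub>R normal_part A B g \<psi> p u"
    using a(2) P.subspace_normal by (intro normal_part_eqI) (auto simp: normal_space_eq subspace_scale)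
qed

lemma normal_part_differential: "normal_part A B g \<psi> p (dif p a) = 0"
  by (rule normal_part_eqI) (auto simp: normal_space_eq subspace_0[OF P.subspace_normal])

text \<open>The covariant derivative of the coordinate field v in the direction u, along the submanifold
  and in the charts c and d. It depends on c only up to tangential vectors.\<close>

definition chart_form :: "('a, 'e) chart \<Rightarrow> ('b, 'f) chart \<Rightarrow> 'e \<Rightarrow> 'e \<Rightarrow> 'e \<Rightarrow> 'f" where
  "chart_form c d y u v = second_derivative (M.rep c d) y u v
     + \<Gamma> d (M.rep c d y) (frechet_derivative (M.rep c d) (at y) u) (frechet_derivative (M.rep c d) (at y) v)"

lemma rep_in: "d \<in> B \<Longrightarrow> c \<in> A \<Longrightarrow> y \<in> M.dom c d \<Longrightarrow> M.rep c d y \<in> snd d ` fst d"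
  unfolding M.dom_def by auto

lemma linear_Drep: "c \<in> A \<Longrightarrow> d \<in> B \<Longrightarrow> y \<in> M.dom c d \<Longrightarrow> linear (frechet_derivative (M.rep c d) (at y))"
  by (rule smooth_on_linear_derivative[OF M.smooth_rep])

lemma smooth_Drep: "c \<in> A \<Longrightarrow> d \<in> B \<Longrightarrow> smooth_on (M.dom c d) (\<lambda>y. frechet_derivative (M.rep c d) (at y) u)"
  by (rule smooth_on_frechet_derivative[OF M.smooth_rep])

lemma smooth_along_rep:
  assumes "c \<in> A" "d \<in> B" "smooth_on (snd d ` fst d) f"
  shows "smooth_on (M.dom c d) (\<lambda>y. f (M.rep c d y))"
  by (rule smooth_on_compose[OF M.open_dom[OF assms(1,2)] open_dom_chart(2)[OF assms(2)] M.smooth_rep[OF assms(1,2)] assms(3)])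
    (use rep_in assms in blast)

lemma bilinear_chart_form:
  assumes "c \<in> A" "d \<in> B" "y \<in> M.dom c d"
  shows "bilinear (chart_form c d y)" and "chart_form c d y u v = chart_form c d y v u"
proof -
  note b1 = bilinear_second_derivative[OF M.open_dom[OF assms(1,2)] M.smooth_rep[OF assms(1,2)] assms(3)]
  note b2 = bilinear_christoffel[OF assms(2) rep_in[OF assms(2,1,3)]]
  note l = linear_Drep[OF assms]
  show "bilinear (chart_form c d y)"
    unfolding bilinear_def chart_form_def
    by (auto intro!: linearI simp: bilinear_ladd[OF b1] bilinear_radd[OF b1] bilinear_lmul[OF b1] bilinear_rmul[OF b1]
        bilinear_ladd[OF b2] bilinear_radd[OF b2] bilinear_lmul[OF b2] bilinear_rmul[OF b2]
        linear_add[OF l] linear_scale[OF l] scaleR_add_right)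
  show "chart_form c d y u v = chart_form c d y v u"
    unfolding chart_form_def
    using second_derivative_commute'[OF M.open_dom[OF assms(1,2)] M.smooth_rep[OF assms(1,2)] assms(3)]
      christoffel_commute[OF assms(2) rep_in[OF assms(2,1,3)]] by metis
qed

lemma smooth_chart_form:
  assumes "c \<in> A" "d \<in> B"
  shows "smooth_on (M.dom c d) (\<lambda>y. chart_form c d y u v)"
  unfolding chart_form_def
proof (rule smooth_on_add[OF M.open_dom[OF assms]])
  show "smooth_on (M.dom c d) (\<lambda>y. second_derivative (M.rep c d) y u v)"
    by (rule smooth_on_second_derivative[OF M.open_dom[OF assms] M.smooth_rep[OF assms]])
  show "smooth_on (M.dom c d) (\<lambda>y. \<Gamma> d (M.rep c d y) (frechet_derivative (M.rep c d) (at y) u)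
      (frechet_derivative (M.rep c d) (at y) v))"
    by (rule smooth_on_bilinear_family[OF M.open_dom[OF assms] _ _ smooth_Drep[OF assms] smooth_Drep[OF assms]])
      (auto intro!: bilinear_christoffel rep_in smooth_along_rep smooth_christoffel assms)
qed

text \<open>The second derivative of the target transition map occurs both in
  \<open>M.rep_change(2)\<close> and in \<open>christoffel_transform\<close>, and cancels. The
  leftover \<open>s\<close> is the second derivative of the source transition map, and it enters
  through a tangent vector only.\<close>

lemma chart_form_change:
  assumes "c \<in> A" "c' \<in> A" "d \<in> B" "d' \<in> B" "p \<in> fst c" "p \<in> fst c'" "\<psi> p \<in> fst d" "\<psi> p \<in> fst d'"
  shows "\<exists>s. coord_change d d' (\<psi> p) (chart_form c d (snd c p) u v) =
    chart_form c' d' (snd c' p) (coord_change c c' p u) (coord_change c c' p v)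
    + frechet_derivative (M.rep c' d') (at (snd c' p)) s"
proof -
  have lin: "linear (coord_change d d' (\<psi> p))" by (rule linear_coord_change) (use assms in auto)
  have "coord_change d d' (\<psi> p) (chart_form c d (snd c p) u v) =
    chart_form c' d' (snd c' p) (coord_change c c' p u) (coord_change c c' p v)
    + frechet_derivative (M.rep c' d') (at (snd c' p)) (second_derivative (snd c' \<circ> chart_inv c) (snd c p) u v)"
    using M.rep_change(2)[OF assms, of u v]
      christoffel_transform[OF assms(3,4,7,8), of "frechet_derivative (M.rep c d) (at (snd c p)) u"
        "frechet_derivative (M.rep c d) (at (snd c p)) v"]
    unfolding chart_form_def M.rep_change(1)[OF assms] linear_add[OF lin]
      M.rep_chart[OF assms(1,5)] M.rep_chart[OF assms(2,6)]
    by (simp add: algebra_simps)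
  then show ?thesis by blast
qed

text \<open>Provides an admissible extension of a tangent vector. Without one, the condition in
  \<open>second_fundamental_form\<close> would be vacuous and would determine no value.\<close>

lemma constant_extension:
  assumes "c \<in> A"
  shows "smooth_vector_field A (fst c) (\<lambda>q. from_chart A c q v)"
  unfolding smooth_vector_field_def smooth_field_along_def
proof (intro ballI)
  fix c1 c2 assume c: "c1 \<in> A" "c2 \<in> A"
  define W where "W = snd c1 ` (fst c1 \<inter> (fst c \<inter> fst c2))"
  have W: "open W" unfolding W_def by (intro M.A.open_chart_image open_Int M.A.open_dom_chart c assms)
  have "smooth_on W (\<lambda>z. frechet_derivative (snd c2 \<circ> chart_inv c) (at ((snd c \<circ> chart_inv c1) z)) v)"
  proof (rule smooth_on_compose[OF W, where f="snd c \<circ> chart_inv c1" and U="snd c ` (fst c \<inter> fst c2)"])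
    show "open (snd c ` (fst c \<inter> fst c2))" by (intro M.A.open_chart_image M.A.open_dom_chart c assms)
    show "smooth_on W (snd c \<circ> chart_inv c1)"
      by (rule smooth_on_subset[OF M.A.smooth_transition[OF c(1) assms]]) (auto simp: W_def)
    show "smooth_on (snd c ` (fst c \<inter> fst c2)) (\<lambda>z. frechet_derivative (snd c2 \<circ> chart_inv c) (at z) v)"
      by (rule smooth_on_frechet_derivative[OF M.A.smooth_transition[OF assms c(2)]])
    show "(snd c \<circ> chart_inv c1) ` W \<subseteq> snd c ` (fst c \<inter> fst c2)" unfolding W_def using c by auto
  qed
  moreover have "in_chart A c2 (id (chart_inv c1 z)) (from_chart A c (chart_inv c1 z) v) =
      frechet_derivative (snd c2 \<circ> chart_inv c) (at ((snd c \<circ> chart_inv c1) z)) v" if "z \<in> W" for z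
  proof -
    obtain q where q: "z = snd c1 q" "q \<in> fst c1" "q \<in> fst c" "q \<in> fst c2" using \<open>z \<in> W\<close> unfolding W_def by blast
    have "in_chart A c2 q (from_chart A c q v) = coord_change c c2 q v"
      using M.A.coord_change_in_chart[OF assms q(3) c(2) q(4), of "from_chart A c q v"]
        M.A.in_chart_from_chart[OF assms q(3)] by simp
    then show ?thesis using q c by (simp add: coord_change_def)
  qed
  moreover have "snd c1 ` (fst c1 \<inter> fst c \<inter> id -` fst c2) = W" unfolding W_def by auto
  ultimately show "smooth_on (snd c1 ` (fst c1 \<inter> fst c \<inter> id -` fst c2))
    (\<lambda>y. in_chart A c2 (id (chart_inv c1 y)) (from_chart A c (chart_inv c1 y) v))"
    using smooth_on_cong[OF W] by (metis (no_types, lifting))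
qed

text \<open>The derivative of the components of \<open>Y\<close> enters only through a tangent
  vector, so the normal part depends on \<open>Y p\<close> alone: this is the tensoriality of the
  second fundamental form.\<close>

lemma covariant_derivative_tangent_field:
  assumes "open W" "p \<in> W" and Y: "smooth_vector_field A W Y"
  defines "c \<equiv> chart_at A p" and "d \<equiv> chart_at B (\<psi> p)"
  shows "\<exists>a. covariant_derivative A B g \<psi> p x (\<lambda>q. dif q (Y q)) = chart_form c d (snd c p) x (Y p) + dif p a"
proof -
  have c: "c \<in> A" "p \<in> fst c" and d: "d \<in> B" "\<psi> p \<in> fst d"
    unfolding c_def d_def by (auto intro: M.A.chart_at_in chart_at_in)
  define Y' where "Y' z = in_chart A c (chart_inv c z) (Y (chart_inv c z))" for z
  define V where "V = snd c ` (fst c \<inter> (W \<inter> \<psi> -` fst d))"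
  have V: "open V" "snd c p \<in> V"
    unfolding V_def using assms(1,2) c d
    by (auto intro!: M.A.open_chart_image open_Int M.open_vimage open_dom_chart)
  have "smooth_on (snd c ` (fst c \<inter> W \<inter> id -` fst c)) Y'"
    using Y c(1) unfolding smooth_vector_field_def smooth_field_along_def Y'_def by auto
  then have "(Y' has_derivative frechet_derivative Y' (at (snd c p))) (at (snd c p))"
    by (rule smooth_on_imp_has_derivative) (use assms(2) c in auto)
  then have "((\<lambda>z. frechet_derivative (M.rep c d) (at z) (Y' z)) has_derivative
    (\<lambda>u. second_derivative (M.rep c d) (snd c p) u (Y' (snd c p))
      + frechet_derivative (M.rep c d) (at (snd c p)) (frechet_derivative Y' (at (snd c p)) u))) (at (snd c p))"
    by (intro has_derivative_derivative_apply[OF M.open_dom[OF c(1) d(1)] M.smooth_rep[OF c(1) d(1)] V, where t="\<lambda>z. z"])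
      (auto simp: V_def M.dom_def)
  moreover have "frechet_derivative (M.rep c d) (at z) (Y' z) =
      in_chart B d (\<psi> (chart_inv c z)) (dif (chart_inv c z) (Y (chart_inv c z)))" if "z \<in> V" for z
  proof -
    obtain q where "z = snd c q" "q \<in> fst c" "\<psi> q \<in> fst d" using \<open>z \<in> V\<close> unfolding V_def by auto
    then show ?thesis using M.in_chart_differential[OF c(1) d(1)] c by (simp add: Y'_def)
  qed
  ultimately have "((\<lambda>z. in_chart B d (\<psi> (chart_inv c z)) (dif (chart_inv c z) (Y (chart_inv c z)))) has_derivative
    (\<lambda>u. second_derivative (M.rep c d) (snd c p) u (Y' (snd c p))
      + frechet_derivative (M.rep c d) (at (snd c p)) (frechet_derivative Y' (at (snd c p)) u))) (at (snd c p))"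
    by (rule has_derivative_transform_within_open[OF _ V])
  note D = frechet_derivative_eqI[OF this]
  have Yp: "Y' (snd c p) = Y p" unfolding Y'_def using c M.A.in_chart_chart_at[of p] by (simp add: c_def)
  have dp: "dif p = frechet_derivative (M.rep c d) (at (snd c p))"
    unfolding M.differential_rep c_def d_def ..
  have "covariant_derivative A B g \<psi> p x (\<lambda>q. dif q (Y q)) =
      chart_form c d (snd c p) x (Y p) + dif p (frechet_derivative Y' (at (snd c p)) x)"
    unfolding covariant_derivative_def Let_def c_def[symmetric] d_def[symmetric] D Yp chart_form_def
      M.rep_chart[OF c] dp by simp
  then show ?thesis by blast
qed

lemma second_fundamental_form_eq:
  fixes p
  defines "c \<equiv> chart_at A p" and "d \<equiv> chart_at B (\<psi> p)"
  shows "second_fundamental_form A B g \<psi> p x y = normal_part A B g \<psi> p (chart_form c d (snd c p) x y)"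
proof -
  have eq: "normal_part A B g \<psi> p (covariant_derivative A B g \<psi> p x (\<lambda>q. dif q (Y q))) =
      normal_part A B g \<psi> p (chart_form c d (snd c p) x (Y p))"
    if WY: "open W" "p \<in> W" "smooth_vector_field A W Y" for W Y
  proof -
    obtain a where "covariant_derivative A B g \<psi> p x (\<lambda>q. dif q (Y q)) = chart_form c d (snd c p) x (Y p) + dif p a"
      using covariant_derivative_tangent_field[OF WY] unfolding c_def d_def by blast
    then show ?thesis by (simp add: linear_add[OF linear_normal_part] normal_part_differential)
  qed
  have c: "c \<in> A" "p \<in> fst c" unfolding c_def by (rule M.A.chart_at_in)+
  have "from_chart A c p y = y" unfolding from_chart_def c_def
    by (rule M.A.coord_change_refl[OF M.A.chart_at_in])
  then have ext: "open (fst c) \<and> p \<in> fst c \<and> smooth_vector_field A (fst c) (\<lambda>q. from_chart A c q y) \<and>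
      from_chart A c p y = y"
    using constant_extension[OF c(1)] c M.A.open_dom_chart by blast
  show ?thesis unfolding second_fundamental_form_def
  proof (rule the_equality)
    show "\<forall>W Y. open W \<and> p \<in> W \<and> smooth_vector_field A W Y \<and> Y p = y \<longrightarrow>
        normal_part A B g \<psi> p (chart_form c d (snd c p) x y) =
        normal_part A B g \<psi> p (covariant_derivative A B g \<psi> p x (\<lambda>q. dif q (Y q)))"
      using eq by metis
    fix z assume "\<forall>W Y. open W \<and> p \<in> W \<and> smooth_vector_field A W Y \<and> Y p = y \<longrightarrow>
        z = normal_part A B g \<psi> p (covariant_derivative A B g \<psi> p x (\<lambda>q. dif q (Y q)))"
    then have "z = normal_part A B g \<psi> p (covariant_derivative A B g \<psi> p x (\<lambda>q. dif q (from_chart A c q y)))"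
      using ext by blast
    then show "z = normal_part A B g \<psi> p (chart_form c d (snd c p) x y)"
      using eq[of "fst c" "\<lambda>q. from_chart A c q y"] ext by simp
  qed
qed

abbreviation II :: "'a \<Rightarrow> 'e \<Rightarrow> 'e \<Rightarrow> 'f" where "II \<equiv> second_fundamental_form A B g \<psi>"

lemma II_normal: "II p x y \<in> normal_space A B g \<psi> p"
  unfolding second_fundamental_form_eq by (rule normal_part_decomp)

lemma bilinear_II: "bilinear (II p)" and II_commute: "II p x y = II p y x"
proof -
  let ?c = "chart_at A p" and ?d = "chart_at B (\<psi> p)"
  have y: "?c \<in> A" "?d \<in> B" "snd ?c p \<in> M.dom ?c ?d"
    by (auto intro!: M.A.chart_at_in chart_at_in M.in_dom)
  note b = bilinear_chart_form(1)[OF y]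
  show "bilinear (II p)"
    unfolding bilinear_def second_fundamental_form_eq
    by (auto intro!: linearI simp: bilinear_ladd[OF b] bilinear_radd[OF b] bilinear_lmul[OF b] bilinear_rmul[OF b]
        linear_add[OF linear_normal_part] linear_scale[OF linear_normal_part])
  show "II p x y = II p y x"
    unfolding second_fundamental_form_eq using bilinear_chart_form(2)[OF y] by metis
qed

section \<open>The second fundamental form in an arbitrary fixed pair of charts\<close>

definition chart_metric :: "('a, 'e) chart \<Rightarrow> ('b, 'f) chart \<Rightarrow> 'e \<Rightarrow> 'e \<Rightarrow> 'e \<Rightarrow> real" where
  "chart_metric c d y u v =
     gc d (M.rep c d y) (frechet_derivative (M.rep c d) (at y) u) (frechet_derivative (M.rep c d) (at y) v)"

text \<open>Coefficients, in the coordinate fields of \<open>c\<close>, of the tangential part of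
  \<open>chart_form\<close>. Their defining linear system has the induced metric as its matrix,
  hence coefficients that are smooth in \<open>y\<close>.\<close>

definition chart_tangent_part :: "('a, 'e) chart \<Rightarrow> ('b, 'f) chart \<Rightarrow> 'e \<Rightarrow> 'e \<Rightarrow> 'e \<Rightarrow> 'e" where
  "chart_tangent_part c d y u v = (THE s. \<forall>w. chart_metric c d y s w =
     gc d (M.rep c d y) (chart_form c d y u v) (frechet_derivative (M.rep c d) (at y) w))"

definition chart_II :: "('a, 'e) chart \<Rightarrow> ('b, 'f) chart \<Rightarrow> 'e \<Rightarrow> 'e \<Rightarrow> 'e \<Rightarrow> 'f" where
  "chart_II c d y u v = chart_form c d y u v
     - frechet_derivative (M.rep c d) (at y) (chart_tangent_part c d y u v)"

context
  fixes c d
  assumes c: "c \<in> A" and d: "d \<in> B"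
begin

lemma chart_metric_eq:
  assumes "p \<in> fst c" "\<psi> p \<in> fst d"
  shows "chart_metric c d (snd c p) u v = P.h p (from_chart A c p u) (from_chart A c p v)"
  using M.in_chart_differential[OF c d assms] assms c
  by (simp add: chart_metric_def g_in_chart[OF d assms(2)])

lemma bilinear_chart_metric: "y \<in> M.dom c d \<Longrightarrow> bilinear (chart_metric c d y)"
  unfolding bilinear_def chart_metric_def
  using bilinear_gc[OF d rep_in[OF d c]] linear_Drep[OF c d]
  by (auto intro!: linearI simp: linear_add[OF linear_Drep[OF c d]] linear_scale[OF linear_Drep[OF c d]]
      bilinear_ladd[OF bilinear_gc[OF d rep_in[OF d c]]] bilinear_radd[OF bilinear_gc[OF d rep_in[OF d c]]]
      bilinear_lmul[OF bilinear_gc[OF d rep_in[OF d c]]] bilinear_rmul[OF bilinear_gc[OF d rep_in[OF d c]]])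

lemma chart_metric_pos:
  assumes "y \<in> M.dom c d" "u \<noteq> 0" shows "chart_metric c d y u u > 0"
proof -
  obtain p where p: "y = snd c p" "p \<in> fst c" "\<psi> p \<in> fst d" using assms(1) by (rule M.domE)
  have "from_chart A c p u \<noteq> 0"
    using M.A.in_chart_from_chart[OF c p(2), of u] linear_0[OF M.A.linear_in_chart[OF c p(2)]] assms(2) by metis
  then show ?thesis unfolding p(1) chart_metric_eq[OF p(2,3)] by (rule P.pos_D)
qed

lemma chart_metric_nondegenerate:
  "y \<in> M.dom c d \<Longrightarrow> (\<And>v. chart_metric c d y u v = 0) \<Longrightarrow> u = 0"
  using chart_metric_pos[of y u] by force

lemma smooth_chart_metric: "smooth_on (M.dom c d) (\<lambda>y. chart_metric c d y u v)"
  unfolding chart_metric_def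
  by (rule smooth_on_bilinear_family[OF M.open_dom[OF c d] _ _ smooth_Drep[OF c d] smooth_Drep[OF c d]])
    (auto intro!: bilinear_gc rep_in smooth_along_rep smooth_gc c d)

lemma chart_tangent_part:
  assumes "y \<in> M.dom c d"
  shows "chart_metric c d y (chart_tangent_part c d y u v) w =
    gc d (M.rep c d y) (chart_form c d y u v) (frechet_derivative (M.rep c d) (at y) w)"
proof -
  note b = bilinear_gc[OF d rep_in[OF d c assms]]
  have "linear (\<lambda>w. gc d (M.rep c d y) (chart_form c d y u v) (frechet_derivative (M.rep c d) (at y) w))"
    by (rule linearI) (simp_all add: linear_add[OF linear_Drep[OF c d assms]]
        linear_scale[OF linear_Drep[OF c d assms]] bilinear_radd[OF b] bilinear_rmul[OF b])
  then have "\<exists>!s. \<forall>w. chart_metric c d y s w =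
      gc d (M.rep c d y) (chart_form c d y u v) (frechet_derivative (M.rep c d) (at y) w)"
    by (intro nondegenerate_riesz bilinear_chart_metric assms) (rule chart_metric_nondegenerate[OF assms])
  from theI'[OF this] show ?thesis unfolding chart_tangent_part_def by blast
qed

lemma smooth_gc_along:
  assumes "open U" "U \<subseteq> M.dom c d" "smooth_on U a" "smooth_on U b"
  shows "smooth_on U (\<lambda>y. gc d (M.rep c d y) (a y) (b y))"
proof (rule smooth_on_bilinear_family[OF assms(1) _ _ assms(3,4)])
  show "bilinear (gc d (M.rep c d x))" if "x \<in> U" for x
    using that assms(2) by (intro bilinear_gc d rep_in c) auto
  show "smooth_on U (\<lambda>x. gc d (M.rep c d x) u v)" for u v
    by (rule smooth_on_subset[OF smooth_along_rep[OF c d smooth_gc[OF d]] assms(2)])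
qed

lemma smooth_chart_II: "smooth_on (M.dom c d) (\<lambda>y. chart_II c d y u v)"
proof -
  have "smooth_on (M.dom c d) (\<lambda>y. chart_tangent_part c d y u v)"
  proof (rule smooth_on_nondegenerate_solution[OF M.open_dom[OF c d] bilinear_chart_metric
        chart_metric_nondegenerate smooth_chart_metric _ chart_tangent_part])
    show "smooth_on (M.dom c d) (\<lambda>y. gc d (M.rep c d y) (chart_form c d y u v)
        (frechet_derivative (M.rep c d) (at y) w))" for w
      by (rule smooth_gc_along[OF M.open_dom[OF c d] order_refl smooth_chart_form[OF c d] smooth_Drep[OF c d]])
  qed
  then have "smooth_on (M.dom c d) (\<lambda>y. frechet_derivative (M.rep c d) (at y) (chart_tangent_part c d y u v))"
    using smooth_on_linear_family[where L="\<lambda>y. frechet_derivative (M.rep c d) (at y)"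
        and u="\<lambda>y. chart_tangent_part c d y u v" and S="M.dom c d"]
      M.open_dom[OF c d] linear_Drep[OF c d] smooth_Drep[OF c d] by blast
  then show ?thesis unfolding chart_II_def
    by (intro smooth_on_diff M.open_dom c d smooth_chart_form)
qed

text \<open>The link between the preferred charts, in which \<open>II\<close> is defined and which
  jump from point to point, and fixed charts, in which \<open>chart_II\<close> is smooth.\<close>

lemma in_chart_II:
  assumes p: "p \<in> fst c" "\<psi> p \<in> fst d"
  shows "in_chart B d (\<psi> p) (II p x y) = chart_II c d (snd c p) (in_chart A c p x) (in_chart A c p y)"
proof -
  let ?c = "chart_at A p" and ?d = "chart_at B (\<psi> p)"
  let ?D = "frechet_derivative (M.rep c d) (at (snd c p))"
  let ?u = "in_chart A c p x" and ?v = "in_chart A c p y"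
  have dom: "snd c p \<in> M.dom c d" by (rule M.in_dom[OF p])
  note lin = linear_Drep[OF c d dom]
  note b = bilinear_gc[OF d rep_in[OF d c dom]]
  define s where "s = chart_tangent_part c d (snd c p) ?u ?v"
  \<comment> \<open>The candidate for \<open>II p x y\<close>. It suffices that \<open>n\<close> is
    normal and differs from \<open>chart_form\<close> in the preferred charts by a tangent
    vector.\<close>
  define n where "n = from_chart B d (\<psi> p) (chart_II c d (snd c p) ?u ?v)"
  have n: "in_chart B d (\<psi> p) n = chart_II c d (snd c p) ?u ?v"
    unfolding n_def by (rule in_chart_from_chart[OF d p(2)])
  have "g (\<psi> p) n (dif p w) = 0" for w
  proof -
    have "g (\<psi> p) n (dif p w) = gc d (snd d (\<psi> p)) (chart_II c d (snd c p) ?u ?v) (?D (in_chart A c p w))"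
      unfolding g_in_chart[OF d p(2)] n M.in_chart_differential[OF c d p] ..
    also have "\<dots> = gc d (snd d (\<psi> p)) (chart_form c d (snd c p) ?u ?v) (?D (in_chart A c p w))
        - gc d (snd d (\<psi> p)) (?D s) (?D (in_chart A c p w))"
      unfolding chart_II_def s_def using bilinear_lsub[OF b] M.rep_chart[OF c p(1)] by simp
    also have "\<dots> = 0"
      using chart_tangent_part[OF dom, of ?u ?v "in_chart A c p w"] M.rep_chart[OF c p(1)]
      unfolding chart_metric_def s_def by simp
    finally show ?thesis .
  qed
  then have nN: "n \<in> normal_space A B g \<psi> p" unfolding normal_space_def by blast
  \<comment> \<open>Moving \<open>chart_form\<close> from the preferred charts to \<open>c\<close>
    and \<open>d\<close> changes it by a tangent vector \<open>?D t\<close> only.\<close>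
  obtain t where t: "coord_change ?d d (\<psi> p) (chart_form ?c ?d (snd ?c p) x y) =
      chart_form c d (snd c p) ?u ?v + ?D t"
    using chart_form_change[OF M.A.chart_at_in(1) c chart_at_in(1) d M.A.chart_at_in(2) p(1) chart_at_in(2) p(2)]
    unfolding in_chart_def by blast
  have "in_chart B d (\<psi> p) (chart_form ?c ?d (snd ?c p) x y - n) = ?D (t + s)"
    unfolding linear_diff[OF linear_in_chart[OF d p(2)]] n linear_add[OF lin]
    unfolding in_chart_def t[unfolded in_chart_def] chart_II_def s_def by (simp add: in_chart_def)
  also have "\<dots> = in_chart B d (\<psi> p) (dif p (from_chart A c p (t + s)))"
    unfolding M.in_chart_differential[OF c d p] M.A.in_chart_from_chart[OF c p(1)] ..
  finally have "chart_form ?c ?d (snd ?c p) x y - n = dif p (from_chart A c p (t + s))"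
    using from_chart_in_chart[OF d p(2)] by metis
  then have "II p x y = n"
    unfolding second_fundamental_form_eq by (intro normal_part_eqI[OF nN]) auto
  then show ?thesis using n by simp
qed

end

end


subsection \<open>The umbilical lightlike direction\<close>

context spacelike_immersion
begin

lemma induced_metric_eq: "induced_metric A B g \<psi> p = P.h p"
  unfolding induced_metric_def by blast

lemma shape_operator_form:
  "P.h p (shape_operator A B g \<psi> p z x) y = g (\<psi> p) (II p x y) z"
proof -
  have "linear (\<lambda>y. g (\<psi> p) (II p x y) z)"
    by (rule linearI) (simp_all add: bilinear_radd[OF bilinear_II] bilinear_rmul[OF bilinear_II]
        bilinear_ladd[OF bilinear_g] bilinear_lmul[OF bilinear_g])
  then obtain a where a: "\<And>y. P.h p a y = g (\<psi> p) (II p x y) z" using P.riesz by blast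
  have "shape_operator A B g \<psi> p z x = a"
    unfolding shape_operator_def induced_metric_eq
  proof (rule the_equality)
    show "\<forall>y. P.h p a y = g (\<psi> p) (II p x y) z" using a by blast
    show "b = a" if "\<forall>y. P.h p b y = g (\<psi> p) (II p x y) z" for b
      by (rule P.h_eqI[of p]) (simp add: a that)
  qed
  then show ?thesis using a by simp
qed

text \<open>The same combination formed with the total shear, as the mean curvature terms
  cancel.\<close>

definition shear_difference :: "'a \<Rightarrow> 'e \<Rightarrow> 'e \<Rightarrow> 'f" where
  "shear_difference p x y = P.h p y y *\<^sub>R II p x x - P.h p x x *\<^sub>R II p y y"

text \<open>All properties are gathered in one existential statement, so that the choice of
  \<open>l\<close> and \<open>r\<close> at every point keeps them together.\<close>

lemma pointwise_null_direction:
  assumes "\<not> umbilical_point A B g \<psi> p" and iso: "shear_isotropic A B g \<psi>"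
  shows "\<exists>l r. l \<in> normal_space A B g \<psi> p \<and> g (\<psi> p) l l = 0 \<and> g (\<psi> p) (T (\<psi> p)) l = -1 \<and>
    (\<forall>x y. \<exists>c. shear_difference p x y = c *\<^sub>R l) \<and> (\<exists>x y. shear_difference p x y \<noteq> 0) \<and>
    (\<forall>x y. g (\<psi> p) (II p x y) l = r * P.h p x y) \<and>
    (\<forall>\<zeta>\<in>normal_space A B g \<psi> p. g (\<psi> p) \<zeta> l = 0 \<longrightarrow> (\<exists>c. \<zeta> = c *\<^sub>R l))"
proof (rule P.normalized_null_direction[where p=p and II="II p" and S="total_shear A B g \<psi> p"])
  show "bilinear (II p)" by (rule bilinear_II)
  show "II p x y = II p y x" for x y by (rule II_commute)
  show "II p x y \<in> P.normal p" for x y using II_normal unfolding normal_space_eq .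
  show "total_shear A B g \<psi> p x y =
      II p x y - P.h p x y *\<^sub>R ((1 / real DIM('e)) *\<^sub>R metric_trace (P.h p) (II p))" for x y
    unfolding total_shear_def mean_curvature_def induced_metric_eq ..
  show "g (\<psi> p) (total_shear A B g \<psi> p x x) (total_shear A B g \<psi> p x x) =
      g (\<psi> p) (total_shear A B g \<psi> p y y) (total_shear A B g \<psi> p y y)"
    if "P.h p x x = 1" "P.h p y y = 1" for x y
    using iso that unfolding shear_isotropic_def induced_metric_eq by blast
  show "\<not> (\<exists>\<zeta>\<in>P.normal p. \<forall>x y. II p x y = P.h p x y *\<^sub>R \<zeta>)"
    using assms(1) unfolding umbilical_point_def induced_metric_eq normal_space_eq .
qed (unfold shear_difference_def normal_space_eq, blast)

definition T_in_chart :: "('b, 'f) chart \<Rightarrow> 'f \<Rightarrow> 'f" where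
  "T_in_chart d y = in_chart B d (chart_inv d y) (T (chart_inv d y))"

lemma smooth_T_in_chart:
  assumes "d \<in> B" shows "smooth_on (snd d ` fst d) (T_in_chart d)"
proof -
  have "smooth_on (snd d ` (fst d \<inter> UNIV \<inter> id -` fst d))
      (\<lambda>y. in_chart B d (id (chart_inv d y)) (T (chart_inv d y)))"
    using st assms unfolding spacetime_def smooth_vector_field_def smooth_field_along_def by blast
  then show ?thesis unfolding T_in_chart_def[abs_def] by simp
qed

definition chart_shear_difference :: "('a, 'e) chart \<Rightarrow> ('b, 'f) chart \<Rightarrow> 'e \<Rightarrow> 'e \<Rightarrow> 'e \<Rightarrow> 'f" where
  "chart_shear_difference c d y u v =
     chart_metric c d y v v *\<^sub>R chart_II c d y u u - chart_metric c d y u u *\<^sub>R chart_II c d y v v"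

context
  fixes c d
  assumes c: "c \<in> A" and d: "d \<in> B"
begin

lemma smooth_chart_shear_difference: "smooth_on (M.dom c d) (\<lambda>y. chart_shear_difference c d y u v)"
  unfolding chart_shear_difference_def
  by (intro smooth_on_diff smooth_on_scaleR M.open_dom smooth_chart_metric smooth_chart_II c d)

lemma in_chart_shear_difference:
  assumes p: "p \<in> fst c" "\<psi> p \<in> fst d"
  shows "chart_shear_difference c d (snd c p) u v =
    in_chart B d (\<psi> p) (shear_difference p (from_chart A c p u) (from_chart A c p v))"
  unfolding shear_difference_def chart_shear_difference_def linear_diff[OF linear_in_chart[OF d p(2)]]
    linear_scale[OF linear_in_chart[OF d p(2)]] in_chart_II[OF c d p] chart_metric_eq[OF c d p]
    M.A.in_chart_from_chart[OF c p(1)] ..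

text \<open>The field \<xi> is chosen pointwise with no continuity built in. Its smoothness results
  from a local formula: a nonzero shear difference of constant coordinate fields is a multiple of
  \<xi>, and pairing with \<open>T\<close> recovers the factor.\<close>

lemma smooth_null_direction:
  assumes T: "\<And>p. g (\<psi> p) (T (\<psi> p)) (\<xi> p) = -1"
    and span: "\<And>p x y. \<exists>a. shear_difference p x y = a *\<^sub>R \<xi> p"
    and nonzero: "\<And>p. \<exists>x y. shear_difference p x y \<noteq> 0"
  shows "smooth_on (M.dom c d) (\<lambda>y. in_chart B d (\<psi> (chart_inv c y)) (\<xi> (chart_inv c y)))"
proof (rule smooth_on_local)
  fix y0 assume "y0 \<in> M.dom c d"
  then obtain p0 where p0: "y0 = snd c p0" "p0 \<in> fst c" "\<psi> p0 \<in> fst d" by (rule M.domE)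
  obtain x1 x2 where "shear_difference p0 x1 x2 \<noteq> 0" using nonzero by blast
  \<comment> \<open>The coordinate components of \<open>x1\<close> and \<open>x2\<close> in
    \<open>c\<close> are held fixed while the point moves, so that \<open>w\<close> is smooth and
    nonzero at \<open>y0\<close>.\<close>
  define u v where "u = in_chart A c p0 x1" and "v = in_chart A c p0 x2"
  define w where "w y = chart_shear_difference c d y u v" for y
  have w: "w (snd c p) = in_chart B d (\<psi> p) (shear_difference p (from_chart A c p u) (from_chart A c p v))"
    if "p \<in> fst c" "\<psi> p \<in> fst d" for p
    unfolding w_def by (rule in_chart_shear_difference[OF that])
  have nz: "in_chart B d (\<psi> p) z = 0 \<longleftrightarrow> z = 0" if "\<psi> p \<in> fst d" for p z
    using from_chart_in_chart[OF d that] linear_0[OF linear_from_chart[OF d that]]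
      linear_0[OF linear_in_chart[OF d that]] by metis
  have smw: "smooth_on (M.dom c d) w" unfolding w_def by (rule smooth_chart_shear_difference)
  define U where "U = M.dom c d \<inter> w -` (- {0})"
  have U: "open U" unfolding U_def
    by (rule continuous_open_preimage[OF smooth_on_imp_continuous_on[OF smw] M.open_dom[OF c d]]) auto
  have UD: "U \<subseteq> M.dom c d" by (auto simp: U_def)
  have y0: "y0 \<in> U"
    unfolding U_def using \<open>y0 \<in> M.dom c d\<close> \<open>shear_difference p0 x1 x2 \<noteq> 0\<close> w[OF p0(2,3)] nz[OF p0(3)]
      M.A.from_chart_in_chart[OF c p0(2)] by (simp add: p0(1) u_def v_def)
  \<comment> \<open>Where \<open>w\<close> represents \<open>a\<close> times \<xi>, the
    normalization gives \<open>t y = - a\<close>; dividing \<open>w\<close> by \<open>- t\<close>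
    therefore isolates \<xi>, and \<open>t\<close> is nonzero wherever \<open>w\<close> is.\<close>
  define t where "t y = gc d (M.rep c d y) (T_in_chart d (M.rep c d y)) (w y)" for y
  have main: "t y \<noteq> 0 \<and> in_chart B d (\<psi> (chart_inv c y)) (\<xi> (chart_inv c y)) = inverse (- t y) *\<^sub>R w y"
    if "y \<in> U" for y
  proof -
    obtain p where p: "y = snd c p" "p \<in> fst c" "\<psi> p \<in> fst d" using \<open>y \<in> U\<close> UD M.domE by blast
    let ?s = "shear_difference p (from_chart A c p u) (from_chart A c p v)"
    obtain a where a: "?s = a *\<^sub>R \<xi> p" using span by blast
    have "w y \<noteq> 0" using \<open>y \<in> U\<close> by (simp add: U_def)
    then have "a \<noteq> 0" unfolding p(1) w[OF p(2,3)] a nz[OF p(3)] by auto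
    have "t y = g (\<psi> p) (T (\<psi> p)) ?s"
      unfolding t_def p(1) M.rep_chart[OF c p(2)] w[OF p(2,3)] g_in_chart[OF d p(3)] T_in_chart_def
        chart_inv_chart[OF d p(3)] ..
    then have t: "t y = - a" unfolding a using T[of p] by (simp add: bilinear_rmul[OF bilinear_g])
    have "w y = a *\<^sub>R in_chart B d (\<psi> p) (\<xi> p)"
      unfolding p(1) w[OF p(2,3)] a linear_scale[OF linear_in_chart[OF d p(3)]] ..
    then show ?thesis using t \<open>a \<noteq> 0\<close> p c by simp
  qed
  have smt: "smooth_on U t" unfolding t_def
    by (rule smooth_gc_along[OF c d U UD smooth_on_subset[OF smooth_along_rep[OF c d smooth_T_in_chart[OF d]] UD]
        smooth_on_subset[OF smw UD]])
  have "smooth_on U (\<lambda>y. inverse (- t y) *\<^sub>R w y)"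
    using smooth_on_scaleR[OF U smooth_on_const smt, of "-1"] main
    by (intro smooth_on_scaleR smooth_on_inverse U smooth_on_subset[OF smw UD]) auto
  then have "smooth_on U (\<lambda>y. in_chart B d (\<psi> (chart_inv c y)) (\<xi> (chart_inv c y)))"
    by (subst smooth_on_cong[OF U, where g="\<lambda>y. inverse (- t y) *\<^sub>R w y"]) (use main in auto)
  then show "\<exists>U. open U \<and> y0 \<in> U \<and>
      smooth_on U (\<lambda>y. in_chart B d (\<psi> (chart_inv c y)) (\<xi> (chart_inv c y)))"
    using U y0 by blast
qed

text \<open>Evaluating the umbilical equation on one fixed coordinate vector \<open>u\<close>
  exhibits \<rho> as a quotient of smooth functions with positive denominator.\<close>

lemma smooth_umbilical_factor:
  assumes \<xi>: "smooth_on (M.dom c d) (\<lambda>y. in_chart B d (\<psi> (chart_inv c y)) (\<xi> (chart_inv c y)))"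
    and umb: "\<And>p x y. g (\<psi> p) (II p x y) (\<xi> p) = \<rho> p * P.h p x y"
  shows "smooth_on (M.dom c d) (\<rho> \<circ> chart_inv c)"
proof -
  obtain u :: 'e where "u \<in> Basis" using nonempty_Basis by blast
  then have "u \<noteq> 0" using nonzero_Basis by blast
  note D = M.open_dom[OF c d]
  define k where "k y = gc d (M.rep c d y) (chart_II c d y u u)
     (in_chart B d (\<psi> (chart_inv c y)) (\<xi> (chart_inv c y)))" for y
  have "smooth_on (M.dom c d) k" unfolding k_def
    by (rule smooth_gc_along[OF c d D order_refl smooth_chart_II[OF c d] \<xi>])
  moreover have pos: "chart_metric c d y u u \<noteq> 0" if "y \<in> M.dom c d" for y
    using chart_metric_pos[OF c d that \<open>u \<noteq> 0\<close>] by simp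
  ultimately have "smooth_on (M.dom c d) (\<lambda>y. k y * inverse (chart_metric c d y u u))"
    by (intro smooth_on_mult smooth_on_inverse D smooth_chart_metric[OF c d]) auto
  moreover have "(\<rho> \<circ> chart_inv c) y = k y * inverse (chart_metric c d y u u)" if y: "y \<in> M.dom c d" for y
  proof -
    obtain p where p: "y = snd c p" "p \<in> fst c" "\<psi> p \<in> fst d" using y by (rule M.domE)
    have "k y = g (\<psi> p) (II p (from_chart A c p u) (from_chart A c p u)) (\<xi> p)"
      unfolding k_def p(1) M.rep_chart[OF c p(2)] M.A.chart_inv_chart[OF c p(2)] g_in_chart[OF d p(3)]
        in_chart_II[OF c d p(2,3)] M.A.in_chart_from_chart[OF c p(2)] ..
    also have "\<dots> = \<rho> p * chart_metric c d y u u"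
      unfolding umb p(1) chart_metric_eq[OF c d p(2,3)] ..
    finally show ?thesis using pos[OF y] M.A.chart_inv_chart[OF c p(2)] by (simp add: p(1))
  qed
  ultimately show ?thesis by (subst smooth_on_cong[OF D])
qed

end

theorem umbilical_lightlike_field:
  assumes nonumb: "\<forall>p. \<not> umbilical_point A B g \<psi> p" and iso: "shear_isotropic A B g \<psi>"
  shows "\<exists>\<xi> \<rho>. smooth_normal_field A B g \<psi> \<xi> \<and> (\<forall>p. lightlike (g (\<psi> p)) (\<xi> p)) \<and>
           smooth_function A \<rho> \<and>
           (\<forall>p. shape_operator A B g \<psi> p (\<xi> p) = (\<lambda>x. \<rho> p *\<^sub>R x)) \<and>
           (\<forall>\<zeta>. umbilical_field A B g \<psi> \<zeta> \<longrightarrow> (\<forall>p. \<exists>a. \<zeta> p = a *\<^sub>R \<xi> p))"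
proof -
  obtain \<xi> \<rho> where N: "\<And>p. \<xi> p \<in> normal_space A B g \<psi> p" and null: "\<And>p. g (\<psi> p) (\<xi> p) (\<xi> p) = 0"
    and T: "\<And>p. g (\<psi> p) (T (\<psi> p)) (\<xi> p) = -1"
    and span: "\<And>p x y. \<exists>c. shear_difference p x y = c *\<^sub>R \<xi> p"
    and nonzero: "\<And>p. \<exists>x y. shear_difference p x y \<noteq> 0"
    and umb: "\<And>p x y. g (\<psi> p) (II p x y) (\<xi> p) = \<rho> p * P.h p x y"
    and perp: "\<And>p \<zeta>. \<zeta> \<in> normal_space A B g \<psi> p \<Longrightarrow> g (\<psi> p) \<zeta> (\<xi> p) = 0 \<Longrightarrow> \<exists>c. \<zeta> = c *\<^sub>R \<xi> p"
  proof -
    have "\<forall>p. \<exists>l r. l \<in> normal_space A B g \<psi> p \<and> g (\<psi> p) l l = 0 \<and> g (\<psi> p) (T (\<psi> p)) l = -1 \<and>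
      (\<forall>x y. \<exists>c. shear_difference p x y = c *\<^sub>R l) \<and> (\<exists>x y. shear_difference p x y \<noteq> 0) \<and>
      (\<forall>x y. g (\<psi> p) (II p x y) l = r * P.h p x y) \<and>
      (\<forall>\<zeta>\<in>normal_space A B g \<psi> p. g (\<psi> p) \<zeta> l = 0 \<longrightarrow> (\<exists>c. \<zeta> = c *\<^sub>R l))"
      using pointwise_null_direction[OF _ iso] nonumb by blast
    from choice[OF this] obtain \<xi> where "\<forall>p. \<exists>r. \<xi> p \<in> normal_space A B g \<psi> p \<and> g (\<psi> p) (\<xi> p) (\<xi> p) = 0 \<and> g (\<psi> p) (T (\<psi> p)) (\<xi> p) = -1 \<and>
      (\<forall>x y. \<exists>c. shear_difference p x y = c *\<^sub>R \<xi> p) \<and> (\<exists>x y. shear_difference p x y \<noteq> 0) \<and>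
      (\<forall>x y. g (\<psi> p) (II p x y) (\<xi> p) = r * P.h p x y) \<and>
      (\<forall>\<zeta>\<in>normal_space A B g \<psi> p. g (\<psi> p) \<zeta> (\<xi> p) = 0 \<longrightarrow> (\<exists>c. \<zeta> = c *\<^sub>R \<xi> p))" by blast
    from choice[OF this] obtain \<rho> where "\<forall>p. \<xi> p \<in> normal_space A B g \<psi> p \<and> g (\<psi> p) (\<xi> p) (\<xi> p) = 0 \<and> g (\<psi> p) (T (\<psi> p)) (\<xi> p) = -1 \<and>
      (\<forall>x y. \<exists>c. shear_difference p x y = c *\<^sub>R \<xi> p) \<and> (\<exists>x y. shear_difference p x y \<noteq> 0) \<and>
      (\<forall>x y. g (\<psi> p) (II p x y) (\<xi> p) = \<rho> p * P.h p x y) \<and>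
      (\<forall>\<zeta>\<in>normal_space A B g \<psi> p. g (\<psi> p) \<zeta> (\<xi> p) = 0 \<longrightarrow> (\<exists>c. \<zeta> = c *\<^sub>R \<xi> p))" by blast
    then show thesis by (intro that[of \<xi> \<rho>]) blast+
  qed
  have sm: "smooth_on (M.dom c d) (\<lambda>y. in_chart B d (\<psi> (chart_inv c y)) (\<xi> (chart_inv c y)))"
    if "c \<in> A" "d \<in> B" for c d
    by (rule smooth_null_direction[OF that T span nonzero])
  then have "smooth_normal_field A B g \<psi> \<xi>"
    using N unfolding smooth_normal_field_def smooth_field_along_def M.dom_def by simp
  moreover have "lightlike (g (\<psi> p)) (\<xi> p)" for p
    unfolding lightlike_def using null T[of p] bilinear_rzero[OF bilinear_g] by force
  moreover have "smooth_function A \<rho>"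
    unfolding smooth_function_def
  proof (intro ballI smooth_on_local)
    fix c y assume c: "c \<in> A" "y \<in> snd c ` fst c"
    then obtain p where p: "p \<in> fst c" "y = snd c p" by blast
    \<comment> \<open>A single target chart need not contain the image of the domain of
      \<open>c\<close>, so the target chart is chosen point by point and smoothness is checked
      locally.\<close>
    let ?d = "chart_at B (\<psi> p)"
    have "smooth_on (M.dom c ?d) (\<rho> \<circ> chart_inv c)"
      by (rule smooth_umbilical_factor[OF c(1) chart_at_in(1) sm[OF c(1) chart_at_in(1)] umb])
    then show "\<exists>U. open U \<and> y \<in> U \<and> smooth_on U (\<rho> \<circ> chart_inv c)"
      using M.open_dom[OF c(1) chart_at_in(1)] M.in_dom[OF p(1) chart_at_in(2)] p(2) by blast
  qed
  moreover have "shape_operator A B g \<psi> p (\<xi> p) = (\<lambda>x. \<rho> p *\<^sub>R x)" for p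
  proof
    fix x
    have "P.h p (\<rho> p *\<^sub>R x) y = \<rho> p * P.h p x y" for y by (simp add: bilinear_lmul[OF P.bil_h])
    then show "shape_operator A B g \<psi> p (\<xi> p) x = \<rho> p *\<^sub>R x"
      using shape_operator_form[of p "\<xi> p" x] umb by (intro P.h_eqI[of p]) simp
  qed
  moreover have "\<exists>a. \<zeta> p = a *\<^sub>R \<xi> p" if \<zeta>: "umbilical_field A B g \<psi> \<zeta>" for \<zeta> p
  proof -
    obtain \<sigma> where \<sigma>: "\<And>p. shape_operator A B g \<psi> p (\<zeta> p) = (\<lambda>x. \<sigma> p *\<^sub>R x)"
      and \<zeta>N: "\<zeta> p \<in> normal_space A B g \<psi> p"
      using \<zeta> unfolding umbilical_field_def smooth_normal_field_def by blast
    have form: "g (\<psi> p) (II p x y) (\<zeta> p) = \<sigma> p * P.h p x y" for x y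
      using shape_operator_form[of p "\<zeta> p" x y] unfolding \<sigma> by (simp add: bilinear_lmul[OF P.bil_h])
    obtain x y where xy: "shear_difference p x y \<noteq> 0" using nonzero by blast
    obtain a where a: "shear_difference p x y = a *\<^sub>R \<xi> p" using span by blast
    \<comment> \<open>Pairing with an umbilical \<zeta> turns both terms into the same multiple of
      \<open>P.h p x x * P.h p y y\<close>. Since the difference is a nonzero multiple of \<xi>,
      this makes \<zeta> orthogonal to \<xi>, hence proportional to it.\<close>
    have "g (\<psi> p) (shear_difference p x y) (\<zeta> p) = 0"
      unfolding shear_difference_def bilinear_lsub[OF bilinear_g] bilinear_lmul[OF bilinear_g] form by simp
    then have "g (\<psi> p) (\<xi> p) (\<zeta> p) = 0"
      using xy unfolding a by (simp add: bilinear_lmul[OF bilinear_g])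
    then show ?thesis using perp[OF \<zeta>N] g_commute by metis
  qed
  ultimately show ?thesis by blast
qed

end

theorem theorem3p4:
  fixes A :: "('s::{t2_space,second_countable_topology}, 'e::euclidean_space) chart set"
    and B :: "('m::{t2_space,second_countable_topology}, 'f::euclidean_space) chart set"
    and g :: "'m \<Rightarrow> 'f \<Rightarrow> 'f \<Rightarrow> real"
    and T :: "'m \<Rightarrow> 'f"
    and \<psi> :: "'s \<Rightarrow> 'm"
  assumes "spacetime B g T"
    and "spacelike_submanifold A B g \<psi>"
    and "DIM('f) = DIM('e) + 2"
    and "DIM('e) + 2 \<ge> 4"
    and "\<forall>p. \<not> umbilical_point A B g \<psi> p"
    and "shear_isotropic A B g \<psi>"
  shows "\<exists>\<xi> \<rho>. smooth_normal_field A B g \<psi> \<xi> \<and> (\<forall>p. lightlike (g (\<psi> p)) (\<xi> p)) \<and>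
           smooth_function A \<rho> \<and>
           (\<forall>p. shape_operator A B g \<psi> p (\<xi> p) = (\<lambda>x. \<rho> p *\<^sub>R x)) \<and>
           (\<forall>\<zeta>. umbilical_field A B g \<psi> \<zeta> \<longrightarrow> (\<forall>p. \<exists>a. \<zeta> p = a *\<^sub>R \<xi> p))"
proof -
  interpret spacelike_immersion B g T A \<psi>
    by unfold_locales (use assms in auto)
  show ?thesis by (rule umbilical_lightlike_field[OF assms(5,6)])
qed

end
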